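(* Let $V$ be a non-zero finite-dimensional vector space over $\mathbb{Q}$, $L$ a full-dimensional lattice of $V$, and $G$ a unipotent algebraic subgroup of $\mathrm{GL}(V)$ (defined over $\mathbb{Q}$). Let $\mathfrak{g}\subset\mathfrak{gl}(V)$ be the Lie algebra of $G$, and let $0=V_0<V_1<\cdots<V_n=V$ be a flag of $V$ with respect to the action of $\mathfrak{g}$. Then the Main Algorithm described in the context, with input $V$, $L$, $\mathfrak{g}$ and this flag, returns a $T$-sequence for the subgroup $G_L=\{g\in G(\mathbb{Q}) \mid gL=L\}$ of $\mathrm{GL}(V)$ (whatever admissible choices are made in its steps).
   Context: Conventions. A full-dimensional lattice of a finite-dimensional $\mathbb{Q}$-vector space is the $\mathbb{Z}$-span of a $\mathbb{Q}$-basis. A unipotent algebraic subgroup $G$ of $\mathrm{GL}(V)$ is a Zariski-closed subgroup of $\mathrm{GL}(V\otimes\mathbb{C})$ defined over $\mathbb{Q}$, all of whose elements are unipotent; $G(\mathbb{Q})=G\cap \mathrm{GL}(V)$. Its Lie algebra $\mathfrak{g}$ is taken over $\mathbb{Q}$, as a Lie subalgebra of $\mathfrak{gl}(V)$. It consists of nilpotent endomorphisms, and $\exp:\mathfrak{g}\to G(\mathbb{Q})$ and $\log:G(\mathbb{Q})\to\mathfrak{g}$ (given by the usual finite power series) are mutually inverse. A chain of subspaces $0=V_0<V_1<\cdots<V_n=V$ is a flag with respect to $\mathfrak{g}$ if $\mathfrak{g}\cdot V_i\subseteq V_{i-1}$ for all $i\ge 1$. For vector spaces $A,B$, $\mathrm{Lin}(A,B)$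 is the space of linear maps $A\to B$. $T$-sequences. An ordered set $g_1,\dots,g_r$ of elements of a group $H$ is a $T$-sequence for $H$ if, with $H_i=\langle g_i,\dots,g_r\rangle$ and $H_{r+1}=1$, the chain $H_1\ge H_2\ge\cdots\ge H_{r+1}=1$ is a proper (i.e. strictly descending) central series of $H=H_1$ with infinite cyclic factors $H_i/H_{i+1}$. The empty set is a $T$-sequence for the trivial group. Relation lattices. For an abelian group $A$ (written additively) and $a_1,\dots,a_k\in A$, the relation lattice is $\{(e_1,\dots,e_k)\in\mathbb{Z}^k\mid \sum_i e_ia_i=0\}$. A basis $e^{(1)},\dots,e^{(m)}$ of a subgroup of $\mathbb{Z}^k$ is in Hermite normal form if there are $1\le i_1<\cdots<i_m\le k$ with $e^{(j)}_i=0$ for $i<i_j$, $e^{(j)}_{i_j}>0$, and $0\le e^{(l)}_{i_j}<e^{(j)}_{i_j}$ for $1\le l<j\le m$. Every subgroup of $\mathbb{Z}^k$ has a unique such basis. $L$-complements. For subspaces $U\subseteq W$ of $V$, subspaces $W'\subseteq U'$ of $V$ are a system of $L$-complements for $U\subseteq W$ if $U\oplus U'=V=W\oplus W'$ and $(L\cap U)+(L\cap U')=L=(L\cap W)+(L\cap W')$. Main Algorithm. Input: $V\neq0$, $L$, $\mathfrak{g}$ (the Lie algebra of a unipotent algebraic group $G\subset\mathrm{GL}(V)$), and a flag $0=V_0<\cdots<V_n=V$ with respect to $\mathfrak{g}$. (1) If $n=1$, return the empty set. Otherwise continue. (2) Form the derived vector space $V^\star=V_{n-1}\oplus V/V_1$,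 the derived lattice $L^\star=(L\cap V_{n-1})+(L+V_1)/V_1$ of $V^\star$, and the derived flag $0=V^\star_0<V_1^\star<\cdots<V^\star_{n-1}=V^\star$ with $V_i^\star=V_i\oplus V_{i+1}/V_1$. (3) Let $\mathfrak{n}$ and $\mathfrak{q}\subset\mathfrak{gl}(V^\star)$ be the kernel and the image of the natural action of $\mathfrak{g}$ on $V^\star$, and $\mathrm{d}\pi:\mathfrak{g}\to\mathfrak{q}$ the projection. (4) Apply the algorithm recursively to $V^\star$, $L^\star$, $\mathfrak{q}$ and the derived flag; let $q_1,\dots,q_k$ be the result. (5) Choose a system $W_{n-1}\subseteq W_1$ of $L$-complements for $V_1\subseteq V_{n-1}$. Let $p:V\to V_1$ be the projection along $W_1$, let $\epsilon:\mathrm{End}(V)\to\mathrm{Lin}(W_{n-1},V_1)$ be $\epsilon(\varphi)=p\circ\varphi|_{W_{n-1}}$, and let $\Gamma=\{\gamma\in\mathrm{Lin}(W_{n-1},V_1)\mid\gamma(L\cap W_{n-1})\subseteq L\cap V_1\}$. (6) Choose a $\mathbb{Z}$-basis $x_1,\dots,x_l$ of $\mathfrak{n}_L=\{x\in\mathfrak{n}\mid\epsilon(x)\in\Gamma\}$ and set $n_i=\exp(x_i)$. (7) For $1\le i\le k$ choose a preimage $x$ of $\log(q_i)$ under $\mathrm{d}\pi$ and set $g_{q_i}=\exp(x)$. (8) Let $W'=\epsilon(\mathfrak{n})$. (9) Let $w_1,\dots,w_k$ be the basis in Hermite normal form of the relation lattice of the elements $\epsilon(g_{q_i})+\Gamma+W'$,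 $i=1,\dots,k$, in $\mathrm{Lin}(W_{n-1},V_1)/(\Gamma+W')$ (this lattice has rank $k$). (10) For each $w_i=(e^{(i)}_1,\dots,e^{(i)}_k)$: set $g_{w_i}=g_{q_1}^{e_1^{(i)}}\cdots g_{q_k}^{e_k^{(i)}}$; choose $v_{w_i}\in W'$ and $\gamma_{w_i}\in\Gamma$ with $v_{w_i}+\gamma_{w_i}=\epsilon(g_{w_i})$; let $n_{w_i}\in\mathfrak{n}$ be the preimage of $-v_{w_i}$ under $\epsilon|_{\mathfrak{n}}$; set $g_i=g_{w_i}\cdot\exp(n_{w_i})$. (11) Return $g_1,\dots,g_k,n_1,\dots,n_l$. That all steps can be carried out (the required choices exist) is part of the assertion. *)

theory Defs
  imports
    Complex_Main
    "HOL-Library.Function_Algebras"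
    "HOL-Algebra.Generated_Groups"
    "HOL-Algebra.Elementary_Groups"
    "Jordan_Normal_Form.Matrix"
begin

section \<open>Vector spaces over the rationals\<close>

class rat_vector = ab_group_add +
  fixes scaleQ :: "rat \<Rightarrow> 'a \<Rightarrow> 'a" (infixr "*\<^sub>Q" 75)
  assumes scaleQ_add_right: "q *\<^sub>Q (x + y) = q *\<^sub>Q x + q *\<^sub>Q y"
    and scaleQ_add_left: "(q + r) *\<^sub>Q x = q *\<^sub>Q x + r *\<^sub>Q x"
    and scaleQ_scaleQ: "q *\<^sub>Q r *\<^sub>Q x = (q * r) *\<^sub>Q x"
    and scaleQ_one: "1 *\<^sub>Q x = x"

interpretation Q: vector_space "scaleQ :: rat \<Rightarrow> 'a \<Rightarrow> 'a::rat_vector"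
  by unfold_locales
    (simp_all add: scaleQ_add_right scaleQ_add_left scaleQ_scaleQ scaleQ_one)

instantiation rat :: rat_vector
begin
definition scaleQ_rat :: "rat \<Rightarrow> rat \<Rightarrow> rat" where "scaleQ_rat q x = q * x"
instance by standard (simp_all add: scaleQ_rat_def algebra_simps)
end

instantiation "fun" :: (type, rat_vector) rat_vector
begin
definition scaleQ_fun :: "rat \<Rightarrow> ('a \<Rightarrow> 'b) \<Rightarrow> 'a \<Rightarrow> 'b"
  where "scaleQ_fun q f = (\<lambda>x. q *\<^sub>Q f x)"
instance
  by standard
    (simp_all add: scaleQ_fun_def plus_fun_def fun_eq_iff
      scaleQ_add_right scaleQ_add_left scaleQ_scaleQ scaleQ_one)
end

text \<open>An ordered basis of the subspace V; its existence says that V is finite-dimensional.\<close>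

definition q_basis :: "'v::rat_vector list \<Rightarrow> 'v set \<Rightarrow> bool" where
  "q_basis bs V \<longleftrightarrow> distinct bs \<and> Q.independent (set bs) \<and> Q.span (set bs) = V"

definition zcomb :: "(nat \<Rightarrow> int) \<Rightarrow> 'v::rat_vector list \<Rightarrow> 'v" where
  "zcomb c xs = (\<Sum>i<length xs. of_int (c i) *\<^sub>Q xs ! i)"

definition z_basis :: "'v::rat_vector list \<Rightarrow> 'v set \<Rightarrow> bool" where
  "z_basis xs A \<longleftrightarrow>
     A = range (\<lambda>c. zcomb c xs) \<and> (\<forall>c. zcomb c xs = 0 \<longrightarrow> (\<forall>i<length xs. c i = 0))"

definition full_lattice :: "'v::rat_vector set \<Rightarrow> 'v set \<Rightarrow> bool" where
  "full_lattice V L \<longleftrightarrow> (\<exists>bs. q_basis bs V \<and> L = range (\<lambda>c. zcomb c bs))"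

definition set_sum :: "'v::rat_vector set \<Rightarrow> 'v set \<Rightarrow> 'v set" where
  "set_sum A B = {a + b | a b. a \<in> A \<and> b \<in> B}"

definition direct_sum :: "'v::rat_vector set \<Rightarrow> 'v set \<Rightarrow> 'v set \<Rightarrow> bool" where
  "direct_sum V A B \<longleftrightarrow>
     Q.subspace A \<and> Q.subspace B \<and> A \<inter> B = {0} \<and> set_sum A B = V"

text \<open>
  Spaces are subspaces of a type, so a linear map between subspaces is represented by the
  function that agrees with it on the domain and vanishes elsewhere. In this way equality of
  maps is equality of functions, \<^term>\<open>Lin A B\<close> is a subspace of the function space, and
  composition is \<^term>\<open>(\<circ>)\<close>.
\<close>

definition Lin :: "'v::rat_vector set \<Rightarrow> 'w::rat_vector set \<Rightarrow> ('v \<Rightarrow> 'w) set" where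
  "Lin A B = {f. f ` A \<subseteq> B
     \<and> (\<forall>x\<in>A. \<forall>y\<in>A. f (x + y) = f x + f y)
     \<and> (\<forall>q. \<forall>x\<in>A. f (q *\<^sub>Q x) = q *\<^sub>Q f x)
     \<and> (\<forall>x. x \<notin> A \<longrightarrow> f x = 0)}"

definition GL :: "'v::rat_vector set \<Rightarrow> ('v \<Rightarrow> 'v) monoid" where
  "GL V = \<lparr>carrier = {f \<in> Lin V V. bij_betw f V V},
           monoid.mult = (\<circ>),
           one = (\<lambda>v. if v \<in> V then v else 0)\<rparr>"

text \<open>The sums range over the non-zero terms only, of which there are finitely many for
  nilpotent x (respectively unipotent g).\<close>

definition nil_exp :: "'v::rat_vector set \<Rightarrow> ('v \<Rightarrow> 'v) \<Rightarrow> 'v \<Rightarrow> 'v" where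
  "nil_exp V x = (\<lambda>v. if v \<in> V
     then \<Sum>k\<in>{k. (x ^^ k) v \<noteq> 0}. (1 / fact k) *\<^sub>Q (x ^^ k) v else 0)"

definition unip_log :: "'v::rat_vector set \<Rightarrow> ('v \<Rightarrow> 'v) \<Rightarrow> 'v \<Rightarrow> 'v" where
  "unip_log V g = (let y = (\<lambda>v. g v - v) in (\<lambda>v. if v \<in> V
     then \<Sum>k\<in>{k. 0 < k \<and> (y ^^ k) v \<noteq> 0}. ((- 1) ^ (k + 1) / of_nat k) *\<^sub>Q (y ^^ k) v
     else 0))"

section \<open>Unipotent algebraic groups over the rationals\<close>

text \<open>
  The choice of an ordered basis \<open>bs\<close> of V identifies the complexification of V with the
  space of complex column vectors of length \<^term>\<open>d = length bs\<close>, hence GL of the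
  complexification with the group of invertible complex d x d matrices, and GL(V) with the
  subgroup of those that have rational entries.
\<close>

inductive polyfun :: "complex set \<Rightarrow> nat \<Rightarrow> (complex mat \<Rightarrow> complex) \<Rightarrow> bool"
  for K :: "complex set" and d :: nat where
  const: "c \<in> K \<Longrightarrow> polyfun K d (\<lambda>A. c)"
| entry: "i < d \<Longrightarrow> j < d \<Longrightarrow> polyfun K d (\<lambda>A. A $$ (i, j))"
| add: "polyfun K d f \<Longrightarrow> polyfun K d h \<Longrightarrow> polyfun K d (\<lambda>A. f A + h A)"
| mult: "polyfun K d f \<Longrightarrow> polyfun K d h \<Longrightarrow> polyfun K d (\<lambda>A. f A * h A)"

definition GL_C :: "nat \<Rightarrow> complex mat monoid" where
  "GL_C d = units_of (ring_mat TYPE(complex) d ())"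

text \<open>Zariski-closed and defined over the rationals: the zero set in GL of polynomials in the
  matrix entries with rational coefficients.\<close>

definition unipotent_algebraic_group :: "nat \<Rightarrow> complex mat set \<Rightarrow> bool" where
  "unipotent_algebraic_group d G \<longleftrightarrow>
     subgroup G (GL_C d)
     \<and> (\<exists>S. (\<forall>f\<in>S. polyfun \<rat> d f) \<and> G = {A \<in> carrier (GL_C d). \<forall>f\<in>S. f A = 0})
     \<and> (\<forall>A\<in>G. \<exists>k. (A - 1\<^sub>m d) ^\<^sub>m k = 0\<^sub>m d d)"

definition cmat :: "'v::rat_vector list \<Rightarrow> ('v \<Rightarrow> 'v) \<Rightarrow> complex mat" where
  "cmat bs f = mat (length bs) (length bs)
     (\<lambda>(i, j). of_rat (Q.representation (set bs) (f (bs ! j)) (bs ! i)))"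

definition rational_points :: "'v::rat_vector set \<Rightarrow> 'v list \<Rightarrow> complex mat set \<Rightarrow> ('v \<Rightarrow> 'v) set" where
  "rational_points V bs G = {g \<in> carrier (GL V). cmat bs g \<in> G}"

text \<open>The rational points of the tangent space of G at the identity: a tangent vector is one
  along which the differential at the identity of every polynomial vanishing on G is zero.\<close>

definition lie_algebra :: "'v::rat_vector set \<Rightarrow> 'v list \<Rightarrow> complex mat set \<Rightarrow> ('v \<Rightarrow> 'v) set" where
  "lie_algebra V bs G = {x \<in> Lin V V.
     \<forall>f. polyfun UNIV (length bs) f \<and> (\<forall>A\<in>G. f A = 0) \<longrightarrow>
       ((\<lambda>t. f (1\<^sub>m (length bs) + t \<cdot>\<^sub>m cmat bs x)) has_field_derivative 0) (at 0)}"

definition flag_wrt :: "'v::rat_vector set \<Rightarrow> ('v \<Rightarrow> 'v) set \<Rightarrow> nat \<Rightarrow> (nat \<Rightarrow> 'v set) \<Rightarrow> bool" where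
  "flag_wrt V \<gg> n F \<longleftrightarrow>
     F 0 = {0} \<and> F n = V \<and> (\<forall>i\<le>n. Q.subspace (F i)) \<and> (\<forall>i<n. F i \<subset> F (i + 1))
     \<and> (\<forall>i<n. \<forall>x\<in>\<gg>. x ` F (i + 1) \<subseteq> F i)"

section \<open>T-sequences\<close>

text \<open>Here H is a group in its own right; indices are shifted by one, so that
  \<^term>\<open>generate H (set (drop i gs))\<close> is the subgroup generated by all but the first i elements.\<close>

definition T_sequence :: "('a, 'b) monoid_scheme \<Rightarrow> 'a list \<Rightarrow> bool" where
  "T_sequence H gs \<longleftrightarrow>
     group H \<and> set gs \<subseteq> carrier H \<and>
     (let Hs = (\<lambda>i. generate H (set (drop i gs))) in
        Hs 0 = carrier H
        \<and> (\<forall>i\<le>length gs. normal (Hs i) H)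
        \<and> (\<forall>i<length gs. Hs (i + 1) \<subset> Hs i
             \<and> (\<forall>h\<in>carrier H. \<forall>x\<in>Hs i.
                  inv\<^bsub>H\<^esub> h \<otimes>\<^bsub>H\<^esub> inv\<^bsub>H\<^esub> x \<otimes>\<^bsub>H\<^esub> h \<otimes>\<^bsub>H\<^esub> x \<in> Hs (i + 1))
             \<and> ((H\<lparr>carrier := Hs i\<rparr>) Mod Hs (i + 1)) \<cong> integer_group))"

section \<open>Relation lattices and Hermite normal form\<close>

text \<open>The relation lattice of the residue classes of \<open>as\<close> modulo the subgroup B.\<close>

definition relation_lattice :: "'v::rat_vector set \<Rightarrow> 'v list \<Rightarrow> int list set" where
  "relation_lattice B as =
     {e. length e = length as \<and> zcomb (\<lambda>i. e ! i) as \<in> B}"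

definition int_basis :: "nat \<Rightarrow> int list list \<Rightarrow> int list set \<Rightarrow> bool" where
  "int_basis k ws M \<longleftrightarrow>
     (\<forall>w\<in>set ws. length w = k)
     \<and> M = range (\<lambda>c. map (\<lambda>i. \<Sum>j<length ws. c j * ws ! j ! i) [0..<k])
     \<and> (\<forall>c. (\<forall>i<k. (\<Sum>j<length ws. c j * ws ! j ! i) = 0) \<longrightarrow> (\<forall>j<length ws. c j = (0::int)))"

definition hermite_normal_form :: "nat \<Rightarrow> int list list \<Rightarrow> bool" where
  "hermite_normal_form k ws \<longleftrightarrow>
     (\<exists>p. (\<forall>j<length ws. p j < k)
        \<and> (\<forall>l j. l < j \<and> j < length ws \<longrightarrow> p l < p j)
        \<and> (\<forall>j<length ws. (\<forall>i<p j. ws ! j ! i = 0) \<and> 0 < ws ! j ! p j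
             \<and> (\<forall>l<j. 0 \<le> ws ! l ! p j \<and> ws ! l ! p j < ws ! j ! p j)))"

section \<open>Non-deterministic computations\<close>

text \<open>A computation is \<open>Stuck\<close> if some sequence of admissible choices leads to a step that
  cannot be carried out; otherwise we record the set of its possible results.\<close>

datatype 'a computation = Stuck | Results "'a set"

definition return :: "'a \<Rightarrow> 'a computation" where
  "return x = Results {x}"

definition choose_from :: "'a set \<Rightarrow> 'a computation" where
  "choose_from S = (if S = {} then Stuck else Results S)"

definition the_only :: "'a set \<Rightarrow> 'a computation" where
  "the_only S = (if is_singleton S then Results S else Stuck)"

definition and_then :: "'a computation \<Rightarrow> ('a \<Rightarrow> 'b computation) \<Rightarrow> 'b computation"
    (infixr "\<triangleright>" 54) where
  "m \<triangleright> f = (case m of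
      Stuck \<Rightarrow> Stuck
    | Results X \<Rightarrow>
        if \<exists>x\<in>X. f x = Stuck then Stuck else Results {y. \<exists>x\<in>X. \<exists>Y. f x = Results Y \<and> y \<in> Y})"

definition always_returns :: "'a computation \<Rightarrow> ('a \<Rightarrow> bool) \<Rightarrow> bool" where
  "always_returns m P \<longleftrightarrow> (\<exists>X. m = Results X \<and> X \<noteq> {} \<and> (\<forall>x\<in>X. P x))"

definition lists_from :: "nat \<Rightarrow> (nat \<Rightarrow> 'a set) \<Rightarrow> 'a list set" where
  "lists_from k S = {ys. length ys = k \<and> (\<forall>i<k. ys ! i \<in> S i)}"

section \<open>The Main Algorithm\<close>

text \<open>
  Types cannot change along a recursion in HOL, so the derived vector space is built inside a
  fixed universe \<open>'u\<close>. Given subspaces \<open>V\<^sub>1 \<subseteq> V\<^sub>m \<subseteq> V\<close>, a model of the external direct sum of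
  \<open>V\<^sub>m\<close> and \<open>V / V\<^sub>1\<close> consists of a subspace D of \<open>'u\<close>, an injection \<open>\<iota>\<close> of \<open>V\<^sub>m\<close>, and the
  composite \<open>\<kappa>\<close> of the quotient map of V by \<open>V\<^sub>1\<close> with an injection of \<open>V / V\<^sub>1\<close>, such that D is the
  internal direct sum of the two images. So \<open>\<iota> a + \<kappa> b\<close> stands for \<open>(a, b + V\<^sub>1)\<close>. The
  algorithm may use any model.
\<close>

definition derived_spaces ::
  "'v::rat_vector set \<Rightarrow> 'v set \<Rightarrow> 'v set \<Rightarrow> ('u::rat_vector set \<times> ('v \<Rightarrow> 'u) \<times> ('v \<Rightarrow> 'u)) set" where
  "derived_spaces V V\<^sub>1 V\<^sub>m = {(D, \<iota>, \<kappa>).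
     \<iota> \<in> Lin V\<^sub>m D \<and> inj_on \<iota> V\<^sub>m
     \<and> \<kappa> \<in> Lin V D \<and> {v \<in> V. \<kappa> v = 0} = V\<^sub>1
     \<and> direct_sum D (\<iota> ` V\<^sub>m) (\<kappa> ` V)}"

definition derived_action ::
  "'v::rat_vector set \<Rightarrow> 'v set \<Rightarrow> ('v \<Rightarrow> 'u::rat_vector) \<Rightarrow> ('v \<Rightarrow> 'u) \<Rightarrow> ('v \<Rightarrow> 'v) \<Rightarrow> 'u \<Rightarrow> 'u" where
  "derived_action V V\<^sub>m \<iota> \<kappa> x = (\<lambda>w. if w \<in> set_sum (\<iota> ` V\<^sub>m) (\<kappa> ` V)
     then THE z. \<exists>a\<in>V\<^sub>m. \<exists>b\<in>V. w = \<iota> a + \<kappa> b \<and> z = \<iota> (x a) + \<kappa> (x b)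
     else 0)"

text \<open>Pairs \<open>(W\<^sub>1, W\<^sub>m)\<close> such that \<open>W\<^sub>m \<subseteq> W\<^sub>1\<close> is a system of L-complements for \<open>V\<^sub>1 \<subseteq> V\<^sub>m\<close>.\<close>

definition L_complements ::
  "'v::rat_vector set \<Rightarrow> 'v set \<Rightarrow> 'v set \<Rightarrow> 'v set \<Rightarrow> ('v set \<times> 'v set) set" where
  "L_complements V L V\<^sub>1 V\<^sub>m = {(W\<^sub>1, W\<^sub>m).
     W\<^sub>m \<subseteq> W\<^sub>1 \<and> direct_sum V V\<^sub>1 W\<^sub>1 \<and> direct_sum V V\<^sub>m W\<^sub>m
     \<and> set_sum (L \<inter> V\<^sub>1) (L \<inter> W\<^sub>1) = L \<and> set_sum (L \<inter> V\<^sub>m) (L \<inter> W\<^sub>m) = L}"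

definition projection :: "'v::rat_vector set \<Rightarrow> 'v set \<Rightarrow> 'v \<Rightarrow> 'v" where
  "projection U U' v = (THE u. u \<in> U \<and> v - u \<in> U')"

definition power_product :: "('a, 'b) monoid_scheme \<Rightarrow> 'a list \<Rightarrow> int list \<Rightarrow> 'a" where
  "power_product H gs es =
     foldr (\<lambda>(g, e) h. (g [^]\<^bsub>H\<^esub> (e::int)) \<otimes>\<^bsub>H\<^esub> h) (zip gs es) \<one>\<^bsub>H\<^esub>"

text \<open>One level of the algorithm; \<open>rec\<close> is the algorithm for flags of length n - 1.
  In the body, \<open>V\<^sub>m\<close> and \<open>W\<^sub>m\<close> are the objects with index n - 1. Requiring
  \<^term>\<open>length ws = k\<close> makes the claim that the relation lattice has rank k part of the
  assertion that the algorithm does not get stuck, and \<open>the_only\<close> does the same for the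
  uniqueness of the preimages under \<open>\<epsilon>\<close>.\<close>

definition main_step ::
  "('u::rat_vector set \<Rightarrow> 'u set \<Rightarrow> ('u \<Rightarrow> 'u) set \<Rightarrow> (nat \<Rightarrow> 'u set) \<Rightarrow> ('u \<Rightarrow> 'u) list computation)
   \<Rightarrow> nat \<Rightarrow> 'v::rat_vector set \<Rightarrow> 'v set \<Rightarrow> ('v \<Rightarrow> 'v) set \<Rightarrow> (nat \<Rightarrow> 'v set)
   \<Rightarrow> ('v \<Rightarrow> 'v) list computation" where
  "main_step rec n V L \<gg> F =
    (if n = 1 then return []
     else
       (let V\<^sub>1 = F 1; V\<^sub>m = F (n - 1) in
        choose_from (derived_spaces V V\<^sub>1 V\<^sub>m) \<triangleright> (\<lambda>(D, \<iota>, \<kappa>).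
        let L' = set_sum (\<iota> ` (L \<inter> V\<^sub>m)) (\<kappa> ` L);
            F' = (\<lambda>i. set_sum (\<iota> ` F i) (\<kappa> ` F (i + 1)));
            d\<pi> = derived_action V V\<^sub>m \<iota> \<kappa>;
            \<nn> = {x \<in> \<gg>. d\<pi> x = 0};
            \<qq> = d\<pi> ` \<gg>
        in
        rec D L' \<qq> F' \<triangleright> (\<lambda>qs.
        let k = length qs in
        choose_from (L_complements V L V\<^sub>1 V\<^sub>m) \<triangleright> (\<lambda>(W\<^sub>1, W\<^sub>m).
        let p = projection V\<^sub>1 W\<^sub>1;
            \<epsilon> = (\<lambda>\<phi> w. if w \<in> W\<^sub>m then p (\<phi> w) else 0);
            \<Gamma> = {\<gamma> \<in> Lin W\<^sub>m V\<^sub>1. \<gamma> ` (L \<inter> W\<^sub>m) \<subseteq> L \<inter> V\<^sub>1}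
        in
        choose_from {xs. z_basis xs {x \<in> \<nn>. \<epsilon> x \<in> \<Gamma>}} \<triangleright> (\<lambda>xs.
        let ns = map (nil_exp V) xs in
        choose_from (lists_from k (\<lambda>i. {x \<in> \<gg>. d\<pi> x = unip_log D (qs ! i)})) \<triangleright> (\<lambda>ys.
        let gqs = map (nil_exp V) ys;
            W' = \<epsilon> ` \<nn>
        in
        choose_from {ws. length ws = k \<and> hermite_normal_form k ws
          \<and> int_basis k ws (relation_lattice (set_sum \<Gamma> W') (map \<epsilon> gqs))} \<triangleright> (\<lambda>ws.
        let gws = map (power_product (GL V) gqs) ws in
        choose_from (lists_from k (\<lambda>i. {(v, \<gamma>). v \<in> W' \<and> \<gamma> \<in> \<Gamma> \<and> v + \<gamma> = \<epsilon> (gws ! i)})) \<triangleright> (\<lambda>vs.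
        the_only (lists_from k (\<lambda>i. {x \<in> \<nn>. \<epsilon> x = - fst (vs ! i)})) \<triangleright> (\<lambda>nws.
        return (map (\<lambda>i. gws ! i \<otimes>\<^bsub>GL V\<^esub> nil_exp V (nws ! i)) [0..<k] @ ns)))))))))))"

text \<open>The universe is the space of rational sequences, into which every finite-dimensional
  rational vector space embeds. A flag of a non-zero space has positive length, so the first
  equation is irrelevant.\<close>

primrec main_algorithm_universe ::
  "nat \<Rightarrow> (nat \<Rightarrow> rat) set \<Rightarrow> (nat \<Rightarrow> rat) set \<Rightarrow> ((nat \<Rightarrow> rat) \<Rightarrow> (nat \<Rightarrow> rat)) set
   \<Rightarrow> (nat \<Rightarrow> (nat \<Rightarrow> rat) set) \<Rightarrow> ((nat \<Rightarrow> rat) \<Rightarrow> (nat \<Rightarrow> rat)) list computation" where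
  "main_algorithm_universe 0 = (\<lambda>V L \<gg> F. Stuck)"
| "main_algorithm_universe (Suc m) = main_step (main_algorithm_universe m) (Suc m)"

definition main_algorithm ::
  "nat \<Rightarrow> 'v::rat_vector set \<Rightarrow> 'v set \<Rightarrow> ('v \<Rightarrow> 'v) set \<Rightarrow> (nat \<Rightarrow> 'v set)
   \<Rightarrow> ('v \<Rightarrow> 'v) list computation" where
  "main_algorithm n = main_step (main_algorithm_universe (n - 1)) n"

end

theory Submission
  imports
    Defs
    "HOL-Computational_Algebra.Formal_Power_Series"
    "HOL-Computational_Algebra.Polynomial"
begin

text \<open>
  The only property of the Lie algebra \<open>\<gg>\<close> of a unipotent group that matters is that the exponentials of
  a space of strictly triangular endomorphisms form a group H. It holds for \<open>\<gg>\<close> because a polynomial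
  that vanishes at all \<open>exp(m x)\<close> with m natural vanishes on the whole one-parameter group, and it is
  inherited by the image \<open>\<qq>\<close> of \<open>\<gg>\<close>; so the induction over the length of the flag needs neither
  algebraic groups nor the Baker-Campbell-Hausdorff formula.

  Let \<open>\<pi>\<close> be the action on the derived space and \<open>H'\<close> the preimage under \<open>\<pi>\<close> of the stabilizer of the
  derived lattice. The kernel \<open>exp \<nn>\<close> of \<open>\<pi>\<close> is central in H, since every product of an element of \<open>\<nn>\<close>
  and one of \<open>\<gg>\<close> is zero. Modulo \<open>\<Gamma>\<close> the map \<open>\<epsilon>\<close> is a homomorphism on \<open>H'\<close> whose kernel is the
  stabilizer of L. Hence the image of that stabilizer under \<open>\<pi>\<close> consists of the products of powers of
  the \<open>q\<^sub>i\<close> whose exponents lie in the relation lattice. The latter has full rank because \<open>\<Gamma>\<close> is a full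
  lattice, so its Hermite basis is triangular and yields a T-sequence of the image, which is then
  extended by a basis of the central kernel.
\<close>

section \<open>Linear maps between subspaces\<close>

text \<open>Linear relations decide the lifting although the groups are not commutative: \<epsilon>
  has values in an additive group, so modulo \<Gamma> it forgets the order of a product and sends
  \<open>power_product (GL V) gqs e\<close> to the integral combination with coefficients
  \<open>e\<close>. Another lift of the same element of the image differs by the exponential of some
  x in \<open>\<nn>\<close>, and this changes \<epsilon> by the element \<open>\<epsilon> x\<close>
  of \<open>W'\<close>. So membership in the sum of \<Gamma> and \<open>W'\<close> tells whether
  some lift stabilizes L.

  A T-sequence is defined by generated subgroups and their quotients, which are awkward to carry
  through a recursion. The induction therefore runs over \<open>T_chain\<close>, where the subgroups
  are given and each factor is recorded by an integer coordinate. Passing to the preimage under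
  \<pi> divides the old coordinate by a diagonal entry of the Hermite basis. Only after the
  induction are the chains translated into T-sequences.\<close>

lemma LinD:
  assumes "f \<in> Lin A B"
  shows Lin_in: "x \<in> A \<Longrightarrow> f x \<in> B"
    and Lin_add: "x \<in> A \<Longrightarrow> y \<in> A \<Longrightarrow> f (x + y) = f x + f y"
    and Lin_scale: "x \<in> A \<Longrightarrow> f (q *\<^sub>Q x) = q *\<^sub>Q f x"
    and Lin_out: "x \<notin> A \<Longrightarrow> f x = 0"
  using assms by (auto simp: Lin_def)

lemma LinI:
  assumes "\<And>x. x \<in> A \<Longrightarrow> f x \<in> B"
    and "\<And>x y. x \<in> A \<Longrightarrow> y \<in> A \<Longrightarrow> f (x + y) = f x + f y"
    and "\<And>q x. x \<in> A \<Longrightarrow> f (q *\<^sub>Q x) = q *\<^sub>Q f x"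
    and "\<And>x. x \<notin> A \<Longrightarrow> f x = 0"
  shows "f \<in> Lin A B"
  using assms by (auto simp: Lin_def)

lemma Lin_zero: assumes "f \<in> Lin A B" "Q.subspace A" shows "f 0 = 0"
  using Lin_scale[OF assms(1) Q.subspace_0[OF assms(2)], of 0] by simp

lemma Lin_minus: assumes "f \<in> Lin A B" "x \<in> A" shows "f (- x) = - f x"
  using Lin_scale[OF assms, of "-1"] by simp

lemma Lin_diff: assumes "f \<in> Lin A B" "Q.subspace A" "x \<in> A" "y \<in> A"
  shows "f (x - y) = f x - f y"
  using Lin_add[OF assms(1), of x "- y"] Lin_minus[OF assms(1,4)] Q.subspace_neg[OF assms(2,4)] assms(3)
  by simp

lemma Lin_sum: assumes "f \<in> Lin A B" "Q.subspace A" "\<And>i. i \<in> I \<Longrightarrow> h i \<in> A"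
  shows "f (\<Sum>i\<in>I. h i) = (\<Sum>i\<in>I. f (h i))"
  using assms(3)
proof (induction I rule: infinite_finite_induct)
  case (insert i I)
  have "sum h I \<in> A" using insert by (intro Q.subspace_sum[OF assms(2)]) auto
  then show ?case using insert by (simp add: Lin_add[OF assms(1)])
qed (auto simp: Lin_zero[OF assms(1,2)])

lemma Lin_eqI: assumes "f \<in> Lin A B" "h \<in> Lin A C" "\<And>x. x \<in> A \<Longrightarrow> f x = h x" shows "f = h"
proof
  fix x show "f x = h x" by (cases "x \<in> A") (simp_all add: assms Lin_out[OF assms(1)] Lin_out[OF assms(2)])
qed

lemma subspace_Lin: assumes "Q.subspace B" shows "Q.subspace (Lin A B)"
  unfolding Q.subspace_def
proof (safe)
  show "0 \<in> Lin A B" by (rule LinI) (auto simp: Q.subspace_0[OF assms])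
next
  fix f h assume fh: "f \<in> Lin A B" "h \<in> Lin A B"
  show "f + h \<in> Lin A B"
    by (rule LinI) (auto simp: LinD[OF fh(1)] LinD[OF fh(2)] scaleQ_add_right intro: Q.subspace_add[OF assms])
next
  fix q f assume f: "f \<in> Lin A B"
  show "q *\<^sub>Q f \<in> Lin A B"
    by (rule LinI) (auto simp: scaleQ_fun_def LinD[OF f] scaleQ_add_right scaleQ_scaleQ mult.commute
        intro: Q.subspace_scale[OF assms])
qed

lemma Lin_comp: assumes "f \<in> Lin B C" "h \<in> Lin A B" "Q.subspace B" shows "f \<circ> h \<in> Lin A C"
  by (rule LinI) (auto simp: LinD[OF assms(1)] LinD[OF assms(2)] Lin_zero[OF assms(1,3)])

lemma subspace_image: assumes f: "f \<in> Lin A B" "Q.subspace A" and U: "U \<subseteq> A" "Q.subspace U"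
  shows "Q.subspace (f ` U)"
  unfolding Q.subspace_def
proof (intro conjI ballI allI)
  show "0 \<in> f ` U" using Lin_zero[OF f] Q.subspace_0[OF U(2)] by force
next
  fix x y assume "x \<in> f ` U" "y \<in> f ` U"
  then obtain a b where ab: "x = f a" "y = f b" "a \<in> U" "b \<in> U" by auto
  then have "f (a + b) = x + y" using U(1) Lin_add[OF f(1), of a b] by auto
  then show "x + y \<in> f ` U" using Q.subspace_add[OF U(2) ab(3,4)] by (metis image_eqI)
next
  fix q x assume "x \<in> f ` U"
  then obtain a where a: "x = f a" "a \<in> U" by auto
  then have "f (q *\<^sub>Q a) = q *\<^sub>Q x" using U(1) Lin_scale[OF f(1), of a q] by auto
  then show "q *\<^sub>Q x \<in> f ` U" using Q.subspace_scale[OF U(2) a(2)] by (metis image_eqI)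
qed

text \<open>The unit of \<open>GL V\<close>. For a subspace V the plain identity lies in
  \<open>Lin V V\<close> only if V is the whole type.\<close>

definition idmap :: "'v::rat_vector set \<Rightarrow> 'v \<Rightarrow> 'v" where
  "idmap V = (\<lambda>v. if v \<in> V then v else 0)"

lemma idmap_Lin: assumes "Q.subspace V" shows "idmap V \<in> Lin V V"
  by (rule LinI) (auto simp: idmap_def Q.subspace_add[OF assms] Q.subspace_scale[OF assms])

lemma idmap_comp: assumes "f \<in> Lin A V" "Q.subspace V" shows "idmap V \<circ> f = f"
proof
  fix x show "(idmap V \<circ> f) x = f x"
    by (cases "x \<in> A") (simp_all add: idmap_def LinD[OF assms(1)])
qed

lemma funpow_in: assumes "\<And>v. v \<in> U \<Longrightarrow> x v \<in> U" "v \<in> U" shows "(x ^^ k) v \<in> U"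
  using assms by (induction k) auto

text \<open>\<open>x ^^ 0\<close> is \<open>id\<close>, which need not vanish outside V; iterates
  are therefore treated as linear on V and not as elements of \<open>Lin V V\<close>.\<close>

lemma funpow_lin: assumes x: "x \<in> Lin V V"
  shows "v \<in> V \<Longrightarrow> w \<in> V \<Longrightarrow> (x ^^ k) (v + w) = (x ^^ k) v + (x ^^ k) w"
    and "v \<in> V \<Longrightarrow> (x ^^ k) (q *\<^sub>Q v) = q *\<^sub>Q (x ^^ k) v"
  by (induction k) (auto simp: LinD[OF x] funpow_in[of V x, OF Lin_in[OF x]])

section \<open>Power series in nilpotent endomorphisms\<close>

text \<open>One bound N for all of V lets \<open>fps_op\<close> be computed by sums of a fixed
  length, which can be added and rearranged.\<close>

definition nilp :: "'v::rat_vector set \<Rightarrow> nat \<Rightarrow> ('v \<Rightarrow> 'v) \<Rightarrow> bool" where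
  "nilp V N x \<longleftrightarrow> Q.subspace V \<and> x \<in> Lin V V \<and> (\<forall>v\<in>V. (x ^^ N) v = 0)"

text \<open>Substitution of x into a power series. Summing over the non-zero terms copies the shape
  of \<open>nil_exp\<close> and \<open>unip_log\<close>, so these become instances without the
  choice of a bound.\<close>

definition fps_op :: "'v::rat_vector set \<Rightarrow> rat fps \<Rightarrow> ('v \<Rightarrow> 'v) \<Rightarrow> 'v \<Rightarrow> 'v" where
  "fps_op V f x = (\<lambda>v. if v \<in> V then \<Sum>k\<in>{k. (x ^^ k) v \<noteq> 0}. (fps_nth f k) *\<^sub>Q (x ^^ k) v else 0)"

lemma nilpD: assumes "nilp V N x"
  shows nilp_subspace: "Q.subspace V" and nilp_Lin: "x \<in> Lin V V"
    and nilp_in: "v \<in> V \<Longrightarrow> x v \<in> V" and nilp_pow_in: "v \<in> V \<Longrightarrow> (x ^^ k) v \<in> V"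
    and nilp_0: "v \<in> V \<Longrightarrow> (x ^^ N) v = 0" and nilp_zero: "x 0 = 0"
  using assms funpow_in[of V x v k] by (auto simp: nilp_def LinD Lin_zero)

lemma nilp_pow_0: assumes "nilp V N x" "v \<in> V" "N \<le> k" shows "(x ^^ k) v = 0"
proof -
  have z: "(x ^^ j) 0 = 0" for j by (induction j) (auto simp: nilp_zero[OF assms(1)])
  have "(x ^^ k) v = (x ^^ (k - N)) ((x ^^ N) v)"
    using assms(3) by (metis comp_apply funpow_add le_add_diff_inverse2)
  then show ?thesis by (simp add: nilp_0[OF assms(1,2)] z)
qed

lemma fps_op_outside: "v \<notin> V \<Longrightarrow> fps_op V f x v = 0" by (simp add: fps_op_def)

lemma fps_op_eq: assumes "v \<in> V" "\<And>k. M \<le> k \<Longrightarrow> (x ^^ k) v = 0"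
  shows "fps_op V f x v = (\<Sum>k<M. (fps_nth f k) *\<^sub>Q (x ^^ k) v)"
proof -
  have "(\<Sum>k\<in>{k. (x ^^ k) v \<noteq> 0}. (fps_nth f k) *\<^sub>Q (x ^^ k) v) = (\<Sum>k<M. (fps_nth f k) *\<^sub>Q (x ^^ k) v)"
  proof (rule sum.mono_neutral_left)
    show "{k. (x ^^ k) v \<noteq> 0} \<subseteq> {..<M}" using assms(2) by (intro subsetI, simp, meson linorder_not_less)
  qed auto
  then show ?thesis using assms(1) by (simp add: fps_op_def)
qed

lemma fps_op_nilp_eq: assumes "nilp V N x" "v \<in> V" "N \<le> M"
  shows "fps_op V f x v = (\<Sum>k<M. (fps_nth f k) *\<^sub>Q (x ^^ k) v)"
  using assms by (intro fps_op_eq) (auto intro: nilp_pow_0)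

lemma fps_op_in: assumes "nilp V N x" "Q.subspace U" "U \<subseteq> V" "\<And>u. u \<in> U \<Longrightarrow> x u \<in> U" "u \<in> U"
  shows "fps_op V f x u \<in> U"
proof -
  have uV: "u \<in> V" using assms by auto
  show ?thesis unfolding fps_op_nilp_eq[OF assms(1) uV order_refl]
    by (intro Q.subspace_sum Q.subspace_scale assms(2) funpow_in assms)
qed

lemma fps_op_Lin: assumes "nilp V N x" shows "fps_op V f x \<in> Lin V V"
proof (rule LinI)
  note V = nilp_subspace[OF assms]
  note e = fps_op_nilp_eq[OF assms _ order_refl]
  note p = funpow_lin[OF nilp_Lin[OF assms]]
  fix v w q assume v: "v \<in> V"
  show "fps_op V f x v \<in> V" by (rule fps_op_in[OF assms V _ nilp_in[OF assms] v]) auto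
  show "fps_op V f x (q *\<^sub>Q v) = q *\<^sub>Q fps_op V f x v"
    using v Q.subspace_scale[OF V v, of q]
    by (simp add: e p Q.scale_sum_right scaleQ_scaleQ mult.commute)
  assume w: "w \<in> V"
  show "fps_op V f x (v + w) = fps_op V f x v + fps_op V f x w"
    using v w Q.subspace_add[OF V v w] by (simp add: e p scaleQ_add_right sum.distrib)
qed (simp add: fps_op_outside)

lemma fps_op_1: assumes "nilp V N x" shows "fps_op V 1 x = idmap V"
proof
  fix v show "fps_op V 1 x v = idmap V v"
  proof (cases "v \<in> V")
    case True
    have "fps_op V 1 x v = (\<Sum>k<Suc N. (fps_nth 1 k) *\<^sub>Q (x ^^ k) v)"
      by (rule fps_op_nilp_eq[OF assms True]) simp
    also have "\<dots> = (\<Sum>k<Suc N. if k = 0 then v else 0)"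
      by (rule sum.cong) (auto simp: scaleQ_one)
    finally show ?thesis using True by (simp add: idmap_def)
  qed (simp add: fps_op_outside idmap_def)
qed

lemma fps_op_X: assumes "nilp V N x" shows "fps_op V fps_X x = x"
proof
  fix v show "fps_op V fps_X x v = x v"
  proof (cases "v \<in> V")
    case True
    have "fps_op V fps_X x v = (\<Sum>k<Suc (Suc N). (fps_nth fps_X k) *\<^sub>Q (x ^^ k) v)"
      by (rule fps_op_nilp_eq[OF assms True]) simp
    also have "\<dots> = (\<Sum>k<Suc (Suc N). if k = 1 then x v else 0)"
      by (rule sum.cong) (auto simp: scaleQ_one fps_X_def)
    finally show ?thesis using True by simp
  qed (simp add: fps_op_outside Lin_out[OF nilp_Lin[OF assms]])
qed

lemma fps_op_add: assumes "nilp V N x" shows "fps_op V (f + g) x = fps_op V f x + fps_op V g x"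
proof
  fix v show "fps_op V (f + g) x v = (fps_op V f x + fps_op V g x) v"
    by (cases "v \<in> V") (simp_all add: fps_op_outside fps_op_nilp_eq[OF assms _ order_refl]
        scaleQ_add_left sum.distrib)
qed

lemma fps_op_diff: assumes "nilp V N x" shows "fps_op V (f - g) x = fps_op V f x - fps_op V g x"
  using fps_op_add[OF assms, of "f - g" g] by (simp add: algebra_simps)

text \<open>With \<open>fps_op_compose\<close> this makes substitution compatible with the
  operations on power series, so that the identities of exp and log are inherited from the formal
  series.\<close>

lemma fps_op_mult: assumes "nilp V N x" shows "fps_op V (f * g) x = fps_op V f x \<circ> fps_op V g x"
proof
  note V = nilp_subspace[OF assms]
  note e = fps_op_nilp_eq[OF assms]
  fix v show "fps_op V (f * g) x v = (fps_op V f x \<circ> fps_op V g x) v"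
  proof (cases "v \<in> V")
    case v: True
    let ?w = "fps_op V g x v"
    have w: "?w \<in> V" using Lin_in[OF fps_op_Lin[OF assms] v] .
    have xw: "(x ^^ i) ?w = (\<Sum>j<N. (fps_nth g j) *\<^sub>Q (x ^^ (i + j)) v)" for i
    proof -
      have L: "(x ^^ i) (\<Sum>j\<in>J. (fps_nth g j) *\<^sub>Q (x ^^ j) v) = (\<Sum>j\<in>J. (fps_nth g j) *\<^sub>Q (x ^^ (i + j)) v)"
        if "finite J" for J
        using that
      proof (induction J)
        case empty
        show ?case by (induction i) (auto simp: nilp_zero[OF assms])
      next
        case (insert j J)
        have "(\<Sum>j\<in>J. (fps_nth g j) *\<^sub>Q (x ^^ j) v) \<in> V"
          by (intro Q.subspace_sum Q.subspace_scale V nilp_pow_in[OF assms] v)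
        moreover have "(fps_nth g j) *\<^sub>Q (x ^^ j) v \<in> V"
          by (intro Q.subspace_scale V nilp_pow_in[OF assms] v)
        ultimately show ?case using insert nilp_pow_in[OF assms v, of j]
          by (simp add: funpow_lin[OF nilp_Lin[OF assms]] funpow_add)
      qed
      show ?thesis unfolding e[OF v order_refl] by (rule L) simp
    qed
    let ?t = "\<lambda>i j. (fps_nth f i * fps_nth g j) *\<^sub>Q (x ^^ (i + j)) v"
    have "(fps_op V f x \<circ> fps_op V g x) v = (\<Sum>i<N. (fps_nth f i) *\<^sub>Q (x ^^ i) ?w)"
      by (simp add: e[OF w order_refl])
    also have "\<dots> = (\<Sum>i<N. \<Sum>j<N. ?t i j)"
      by (simp add: xw Q.scale_sum_right scaleQ_scaleQ)
    also have "\<dots> = (\<Sum>(i, j)\<in>{..<N} \<times> {..<N}. ?t i j)"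
      by (simp add: sum.cartesian_product)
    \<comment> \<open>Pairs outside the triangle contribute 0, since \<open>x ^^ m\<close> vanishes
      on V for all m from N on.\<close>
    also have "\<dots> = (\<Sum>(i, j)\<in>{(i, j). i + j < N}. ?t i j)"
    proof (rule sum.mono_neutral_right)
      show "\<forall>i\<in>{..<N} \<times> {..<N} - {(i, j). i + j < N}. (case i of (i, j) \<Rightarrow> ?t i j) = 0"
        by clarsimp (metis nilp_pow_0[OF assms v] linorder_not_less)
    qed auto
    also have "\<dots> = (\<Sum>n<N. \<Sum>i\<le>n. ?t i (n - i))"
      by (rule sum.triangle_reindex)
    also have "\<dots> = fps_op V (f * g) x v"
      by (auto simp: e[OF v order_refl] fps_mult_nth Q.scale_sum_left atLeast0AtMost intro!: sum.cong)
    finally show ?thesis by simp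
  qed (use Lin_zero[OF fps_op_Lin[OF assms] V] in \<open>simp add: fps_op_outside\<close>)
qed

lemma fps_op_power: assumes "nilp V N x" "v \<in> V" shows "fps_op V (f ^ i) x v = (fps_op V f x ^^ i) v"
  by (induction i) (simp_all add: fps_op_1[OF assms(1)] idmap_def assms(2) fps_op_mult[OF assms(1)])

lemma fps_op_nilp: assumes "nilp V N x" "fps_nth f 0 = 0" shows "nilp V N (fps_op V f x)"
  unfolding nilp_def
proof (intro conjI ballI nilp_subspace[OF assms(1)] fps_op_Lin[OF assms(1)])
  fix v assume v: "v \<in> V"
  have "(fps_op V f x ^^ N) v = fps_op V (f ^ N) x v" using fps_op_power[OF assms(1) v] by simp
  also have "\<dots> = 0" unfolding fps_op_nilp_eq[OF assms(1) v order_refl]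
    by (intro sum.neutral) (simp add: startsby_zero_power_prefix[OF assms(2)])
  finally show "(fps_op V f x ^^ N) v = 0" .
qed

text \<open>The series \<open>g ^ i\<close> starts in degree i or later, so below degree N only
  finitely many i contribute and the two summations can be exchanged.\<close>

lemma fps_op_compose: assumes "nilp V N x" "fps_nth g 0 = 0"
  shows "fps_op V (f oo g) x = fps_op V f (fps_op V g x)"
proof
  fix v show "fps_op V (f oo g) x v = fps_op V f (fps_op V g x) v"
  proof (cases "v \<in> V")
    case v: True
    have "fps_op V f (fps_op V g x) v = (\<Sum>i<N. (fps_nth f i) *\<^sub>Q (fps_op V g x ^^ i) v)"
      by (rule fps_op_nilp_eq[OF fps_op_nilp[OF assms] v order_refl])
    also have "\<dots> = (\<Sum>i<N. \<Sum>n<N. (fps_nth f i * fps_nth (g ^ i) n) *\<^sub>Q (x ^^ n) v)"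
      by (simp add: fps_op_power[OF assms(1) v, symmetric] fps_op_nilp_eq[OF assms(1) v order_refl]
          Q.scale_sum_right scaleQ_scaleQ)
    also have "\<dots> = (\<Sum>n<N. \<Sum>i<N. (fps_nth f i * fps_nth (g ^ i) n) *\<^sub>Q (x ^^ n) v)"
      by (rule sum.swap)
    also have "\<dots> = (\<Sum>n<N. (\<Sum>i=0..n. fps_nth f i * fps_nth (g ^ i) n) *\<^sub>Q (x ^^ n) v)"
    proof (rule sum.cong)
      fix n assume "n \<in> {..<N}"
      then have "(\<Sum>i<N. fps_nth f i * fps_nth (g ^ i) n) = (\<Sum>i=0..n. fps_nth f i * fps_nth (g ^ i) n)"
        by (intro sum.mono_neutral_right) (auto simp: startsby_zero_power_prefix[OF assms(2)])
      then show "(\<Sum>i<N. (fps_nth f i * fps_nth (g ^ i) n) *\<^sub>Q (x ^^ n) v) = (\<Sum>i=0..n. fps_nth f i * fps_nth (g ^ i) n) *\<^sub>Q (x ^^ n) v"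
        by (simp add: Q.scale_sum_left[symmetric])
    qed simp
    finally show ?thesis by (simp add: fps_op_nilp_eq[OF assms(1) v order_refl] fps_compose_nth)
  qed (simp add: fps_op_outside)
qed

text \<open>Both nilpotency bounds are replaced by their maximum, after which T passes through a
  finite sum. With T = \<iota> and T = \<kappa> this compares exponentials on V with those on the
  derived space.\<close>

lemma fps_op_intertwine:
  assumes x: "nilp V N x" and T: "T \<in> Lin U W" and y: "nilp W M y"
    and U: "Q.subspace U" "U \<subseteq> V" "\<And>u. u \<in> U \<Longrightarrow> x u \<in> U" "\<And>u. u \<in> U \<Longrightarrow> T (x u) = y (T u)" and u: "u \<in> U"
  shows "T (fps_op V f x u) = fps_op W f y (T u)"
proof -
  let ?K = "max N M"
  have uV: "u \<in> V" using u U(2) by auto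
  have p: "(x ^^ k) u \<in> U" for k using funpow_in[of U x u k] U u by auto
  have c: "T ((x ^^ k) u) = (y ^^ k) (T u)" for k by (induction k) (simp_all add: U p)
  have "fps_op V f x u = (\<Sum>k<?K. (fps_nth f k) *\<^sub>Q (x ^^ k) u)"
    by (rule fps_op_nilp_eq[OF x uV]) simp
  then have "T (fps_op V f x u) = (\<Sum>k<?K. T ((fps_nth f k) *\<^sub>Q (x ^^ k) u))"
    by (simp only: Lin_sum[OF T U(1) Q.subspace_scale[OF U(1) p]])
  also have "\<dots> = (\<Sum>k<?K. (fps_nth f k) *\<^sub>Q (y ^^ k) (T u))"
    by (simp add: Lin_scale[OF T] p c)
  also have "\<dots> = fps_op W f y (T u)"
    by (rule fps_op_nilp_eq[OF y Lin_in[OF T u], symmetric]) simp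
  finally show ?thesis .
qed

section \<open>Exponential and logarithm as substitutions into power series\<close>

lemma nil_exp_fps: "nil_exp V x = fps_op V (fps_exp 1) x"
  by (simp add: nil_exp_def fps_op_def fun_eq_iff)

lemma unip_log_fps: assumes "Q.subspace V" "g \<in> Lin V V"
  shows "unip_log V g = fps_op V (fps_ln 1) (g - idmap V)"
proof
  fix v
  show "unip_log V g v = fps_op V (fps_ln 1) (g - idmap V) v"
  proof (cases "v \<in> V")
    case v: True
    have p: "((\<lambda>v. g v - v) ^^ k) v = ((g - idmap V) ^^ k) v \<and> ((g - idmap V) ^^ k) v \<in> V" for k
      by (induction k) (auto simp: idmap_def v Lin_in[OF assms(2)] Q.subspace_diff[OF assms(1)])
    have c: "fps_nth (fps_ln 1) k = (- 1) ^ (k + 1) / of_nat k" if "0 < k" for k :: nat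
      using that by (cases k) (auto simp: fps_ln_def)
    have "unip_log V g v = (\<Sum>k\<in>{k. 0 < k \<and> ((g - idmap V) ^^ k) v \<noteq> 0}. (fps_nth (fps_ln 1) k) *\<^sub>Q ((g - idmap V) ^^ k) v)"
      using v by (simp add: unip_log_def Let_def p[THEN conjunct1]) (rule sum.cong; simp add: c)
    also have "\<dots> = fps_op V (fps_ln 1) (g - idmap V) v"
    proof (cases "finite {k. ((g - idmap V) ^^ k) v \<noteq> 0}")
      case True
      have "fps_nth (fps_ln 1) 0 = (0::rat)" by (simp add: fps_ln_def)
      then show ?thesis using v True unfolding fps_op_def
        by (auto intro!: sum.mono_neutral_left gr0I)
    next
      \<comment> \<open>Sums over infinite sets are 0 by convention. The two index sets differ at
        most by 0, so both are infinite here; this covers maps g that are not unipotent.\<close>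
      case False
      have "{k. ((g - idmap V) ^^ k) v \<noteq> 0} \<subseteq> insert 0 {k. 0 < k \<and> ((g - idmap V) ^^ k) v \<noteq> 0}" by auto
      then have "infinite {k. 0 < k \<and> ((g - idmap V) ^^ k) v \<noteq> 0}"
        using False finite_subset finite_insert by blast
      then show ?thesis using v False by (simp add: fps_op_def)
    qed
    finally show ?thesis .
  qed (simp add: unip_log_def fps_op_outside Let_def)
qed

lemma nil_exp_minus_id: assumes "nilp V N x" shows "nil_exp V x - idmap V = fps_op V (fps_exp 1 - 1) x"
  by (simp add: nil_exp_fps fps_op_diff[OF assms] fps_op_1[OF assms])

text \<open>\<open>fps_ln 1\<close> is the compositional inverse of \<open>fps_exp 1 - 1\<close>, so
  log after exp is substitution into the series X.\<close>

lemma unip_log_nil_exp: assumes "nilp V N x" shows "unip_log V (nil_exp V x) = x"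
proof -
  have "unip_log V (nil_exp V x) = fps_op V (fps_ln 1) (fps_op V (fps_exp 1 - 1) x)"
    using unip_log_fps[OF nilp_subspace[OF assms], of "nil_exp V x"] fps_op_Lin[OF assms, of "fps_exp 1"]
    by (simp add: nil_exp_fps[symmetric] nil_exp_minus_id[OF assms])
  also have "\<dots> = fps_op V (fps_ln 1 oo (fps_exp 1 - 1)) x"
    by (rule fps_op_compose[OF assms, symmetric]) simp
  also have "fps_ln 1 oo (fps_exp 1 - 1) = (fps_X :: rat fps)"
    using fps_inv[of "fps_exp 1 - 1 :: rat fps"] by (simp add: fps_ln_fps_exp_inv)
  finally show ?thesis by (simp add: fps_op_X[OF assms])
qed

lemma unip_log:
  assumes g: "g \<in> Lin V V" and n: "nilp V N (g - idmap V)"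
  shows "nilp V N (unip_log V g)" and "nil_exp V (unip_log V g) = g"
proof -
  note V = nilp_subspace[OF n]
  have l: "unip_log V g = fps_op V (fps_ln 1) (g - idmap V)" by (rule unip_log_fps[OF V g])
  have l0: "fps_nth (fps_ln 1) 0 = (0::rat)" by (simp add: fps_ln_def)
  show n': "nilp V N (unip_log V g)" unfolding l by (rule fps_op_nilp[OF n l0])
  have inv: "(fps_exp 1 - 1) oo fps_ln 1 = (fps_X :: rat fps)"
    using fps_inv_right[of "fps_exp 1 - 1 :: rat fps"] by (simp add: fps_ln_fps_exp_inv)
  have "nil_exp V (unip_log V g) - idmap V = fps_op V ((fps_exp 1 - 1) oo fps_ln 1) (g - idmap V)"
    by (simp only: nil_exp_minus_id[OF n'] fps_op_compose[OF n l0] l[symmetric])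
  then show "nil_exp V (unip_log V g) = g" by (simp add: inv fps_op_X[OF n])
qed

text \<open>The multiple is the value at x of the series q X, which has no constant term, so
  \<open>fps_op_nilp\<close> applies.\<close>

lemma nilp_scale: assumes "nilp V N x" shows "nilp V N (q *\<^sub>Q x)"
proof -
  have "fps_op V (fps_const q * fps_X) x = q *\<^sub>Q x"
    unfolding fps_op_mult[OF assms] fps_op_X[OF assms]
  proof
    fix v
    have "fps_op V (fps_const q) x w = q *\<^sub>Q w" if w: "w \<in> V" for w
    proof -
      have "fps_op V (fps_const q) x w = (\<Sum>k<Suc N. if k = 0 then q *\<^sub>Q w else 0)"
        unfolding fps_op_nilp_eq[OF assms w le_SucI[OF order_refl]] by (rule sum.cong) auto
      then show ?thesis by simp
    qed
    then show "(fps_op V (fps_const q) x \<circ> x) v = (q *\<^sub>Q x) v"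
      using Lin_out[OF nilp_Lin[OF assms]] nilp_in[OF assms] Q.subspace_0[OF nilp_subspace[OF assms]]
      by (cases "v \<in> V") (simp_all add: scaleQ_fun_def)
  qed
  then show ?thesis using fps_op_nilp[OF assms, of "fps_const q * fps_X"] by simp
qed

lemma nil_exp_scale: assumes "nilp V N x" shows "nil_exp V (q *\<^sub>Q x) = fps_op V (fps_exp q) x"
proof
  fix v
  have p: "((q *\<^sub>Q x) ^^ k) v = q ^ k *\<^sub>Q (x ^^ k) v \<and> (x ^^ k) v \<in> V" if "v \<in> V" for k
    using that by (induction k)
      (auto simp: scaleQ_fun_def nilp_in[OF assms] scaleQ_one scaleQ_scaleQ Lin_scale[OF nilp_Lin[OF assms]])
  show "nil_exp V (q *\<^sub>Q x) v = fps_op V (fps_exp q) x v"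
    unfolding nil_exp_fps
    by (cases "v \<in> V") (simp_all add: fps_op_outside p fps_op_nilp_eq[OF assms _ order_refl] scaleQ_scaleQ
       fps_op_nilp_eq[OF nilp_scale[OF assms] _ order_refl])
qed

lemma nil_exp_scale_add: assumes "nilp V N x"
  shows "nil_exp V ((q + r) *\<^sub>Q x) = nil_exp V (q *\<^sub>Q x) \<circ> nil_exp V (r *\<^sub>Q x)"
  unfolding nil_exp_scale[OF assms] fps_exp_add_mult fps_op_mult[OF assms] ..

lemma nil_exp_0: assumes "Q.subspace V" shows "nil_exp V 0 = idmap V"
proof -
  have n: "nilp V 1 0" using subspace_Lin[OF assms, of V] assms by (auto simp: nilp_def Q.subspace_def)
  show ?thesis using nil_exp_scale[OF n, of 0] fps_op_1[OF n] by simp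
qed

lemma nil_exp_uminus: assumes "nilp V N x"
  shows "nil_exp V x \<circ> nil_exp V (- x) = idmap V" "nil_exp V (- x) \<circ> nil_exp V x = idmap V"
  using nil_exp_scale_add[OF assms, of 1 "- 1"] nil_exp_scale_add[OF assms, of "- 1" 1]
    nil_exp_0[OF nilp_subspace[OF assms]]
  by (simp_all add: scaleQ_one)

lemma nil_exp_Lin: assumes "nilp V N x" shows "nil_exp V x \<in> Lin V V"
  unfolding nil_exp_fps by (rule fps_op_Lin[OF assms])

section \<open>The group of automorphisms of V\<close>

lemma GL_simps: "carrier (GL V) = {f \<in> Lin V V. bij_betw f V V}" "x \<otimes>\<^bsub>GL V\<^esub> y = x \<circ> y" "\<one>\<^bsub>GL V\<^esub> = idmap V"
  by (simp_all add: GL_def idmap_def)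

lemma GL_I: assumes "Q.subspace V" "f \<in> Lin V V" "h \<in> Lin V V" "f \<circ> h = idmap V" "h \<circ> f = idmap V"
  shows "f \<in> carrier (GL V)"
proof -
  have "bij_betw f V V"
  proof (rule bij_betwI[where g = h])
    fix x assume "x \<in> V"
    then show "h (f x) = x" "f (h x) = x" using fun_cong[OF assms(4), of x] fun_cong[OF assms(5), of x]
      by (simp_all add: idmap_def)
  qed (use assms in \<open>auto simp: LinD\<close>)
  then show ?thesis using assms by (simp add: GL_simps)
qed

lemma nil_exp_GL: assumes "nilp V N x" shows "nil_exp V x \<in> carrier (GL V)"
proof -
  have n: "nilp V N (- x)" using nilp_scale[OF assms, of "-1"] by (simp add: scaleQ_one)
  show ?thesis using GL_I[OF nilp_subspace[OF assms] nil_exp_Lin[OF assms] nil_exp_Lin[OF n]] nil_exp_uminus[OF assms]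
    by blast
qed

lemma group_GL: assumes "Q.subspace V" shows "group (GL V)"
proof (rule groupI)
  show "\<one>\<^bsub>GL V\<^esub> \<in> carrier (GL V)"
    using GL_I[OF assms idmap_Lin[OF assms] idmap_Lin[OF assms]] idmap_comp[OF idmap_Lin[OF assms] assms]
    by (simp add: GL_simps)
next
  fix x y assume "x \<in> carrier (GL V)" "y \<in> carrier (GL V)"
  then show "x \<otimes>\<^bsub>GL V\<^esub> y \<in> carrier (GL V)"
    by (auto simp: GL_simps Lin_comp[OF _ _ assms] intro: bij_betw_trans)
next
  fix x assume "x \<in> carrier (GL V)"
  then show "\<one>\<^bsub>GL V\<^esub> \<otimes>\<^bsub>GL V\<^esub> x = x" using idmap_comp[OF _ assms, of x V] by (simp add: GL_simps)
next
  fix x assume "x \<in> carrier (GL V)"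
  then have x: "x \<in> Lin V V" "bij_betw x V V" by (auto simp: GL_simps)
  define y where "y = (\<lambda>v. if v \<in> V then inv_into V x v else 0)"
  have yV: "y v \<in> V" and xy: "x (y v) = v" if "v \<in> V" for v
    using that x(2) bij_betw_inv_into_right[OF x(2)] by (auto simp: y_def bij_betw_def inv_into_into)
  have inj: "u = w" if "u \<in> V" "w \<in> V" "x u = x w" for u w
    using inj_onD[OF bij_betw_imp_inj_on[OF x(2)] that(3,1,2)] .
  have "y \<in> Lin V V"
  proof (rule LinI)
    fix v w assume "v \<in> V" "w \<in> V"
    then show "y (v + w) = y v + y w"
      by - (rule inj, simp_all add: yV xy Q.subspace_add[OF assms] Lin_add[OF x(1)])
  next
    fix v q assume "v \<in> V"
    then show "y (q *\<^sub>Q v) = q *\<^sub>Q y v"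
      by - (rule inj, simp_all add: yV xy Q.subspace_scale[OF assms] Lin_scale[OF x(1)])
  qed (simp_all add: yV, simp add: y_def)
  moreover have "y (x v) = v" if "v \<in> V" for v
    using that by - (rule inj, simp_all add: yV xy Lin_in[OF x(1)])
  then have "y \<circ> x = idmap V" using Lin_out[OF x(1)]
    by (auto simp: fun_eq_iff idmap_def Lin_zero[OF \<open>y \<in> Lin V V\<close> assms])
  moreover have "x \<circ> y = idmap V" using xy by (auto simp: fun_eq_iff idmap_def y_def Lin_zero[OF x(1) assms])
  ultimately show "\<exists>y\<in>carrier (GL V). y \<otimes>\<^bsub>GL V\<^esub> x = \<one>\<^bsub>GL V\<^esub>"
    using GL_I[OF assms _ x(1)] by (auto simp: GL_simps)
qed (simp add: GL_simps comp_assoc)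

lemma nil_exp_inv: assumes "nilp V N x" shows "inv\<^bsub>GL V\<^esub> (nil_exp V x) = nil_exp V (- x)"
proof -
  have n: "nilp V N (- x)" using nilp_scale[OF assms, of "-1"] by (simp add: scaleQ_one)
  show ?thesis
    by (rule group.inv_equality[OF group_GL[OF nilp_subspace[OF assms]]])
      (simp_all add: nil_exp_uminus[OF assms] nil_exp_GL[OF assms] nil_exp_GL[OF n], simp add: GL_simps nil_exp_uminus[OF assms])
qed

lemma nil_exp_square_zero:
  assumes "Q.subspace V" "x \<in> Lin V V" "\<And>v. v \<in> V \<Longrightarrow> x (x v) = 0" shows "nil_exp V x = idmap V + x"
proof
  have n: "nilp V 2 x" using assms by (simp add: nilp_def numeral_2_eq_2)
  fix v show "nil_exp V x v = (idmap V + x) v"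
    unfolding nil_exp_fps
    by (cases "v \<in> V") (simp_all add: fps_op_outside fps_op_nilp_eq[OF n _ order_refl] Lin_out[OF assms(2)]
      numeral_2_eq_2 idmap_def scaleQ_one)
qed

section \<open>Lattices\<close>

definition qcomb :: "(nat \<Rightarrow> rat) \<Rightarrow> 'v::rat_vector list \<Rightarrow> 'v" where
  "qcomb c xs = (\<Sum>i<length xs. c i *\<^sub>Q xs ! i)"

lemma zcomb_qcomb: "zcomb c xs = qcomb (\<lambda>i. of_int (c i)) xs"
  by (simp add: zcomb_def qcomb_def)

lemma qcomb_add: "qcomb (\<lambda>i. c i + d i) xs = qcomb c xs + qcomb d xs"
  by (simp add: qcomb_def scaleQ_add_left sum.distrib)

lemma qcomb_scale: "qcomb (\<lambda>i. q * c i) xs = q *\<^sub>Q qcomb c xs"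
  by (simp add: qcomb_def Q.scale_sum_right scaleQ_scaleQ)

lemma qcomb_diff: "qcomb (\<lambda>i. c i - d i) xs = qcomb c xs - qcomb d xs"
  by (simp add: qcomb_def Q.scale_left_diff_distrib sum_subtractf)

lemma qcomb_cong: "(\<And>i. i < length xs \<Longrightarrow> c i = d i) \<Longrightarrow> qcomb c xs = qcomb d xs"
  by (simp add: qcomb_def)

lemma qcomb_append: "qcomb c (xs @ ys) = qcomb c xs + qcomb (\<lambda>i. c (length xs + i)) ys"
proof -
  have "(\<Sum>i<length xs + m. c i *\<^sub>Q (xs @ ys) ! i) = qcomb c xs + (\<Sum>i<m. c (length xs + i) *\<^sub>Q ys ! i)" for m
    by (induction m) (simp_all add: qcomb_def nth_append add.assoc)
  then show ?thesis by (simp add: qcomb_def)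
qed

lemma qcomb_zero: "qcomb (\<lambda>i. 0) xs = 0" by (simp add: qcomb_def)

lemma qcomb_unit: "j < length xs \<Longrightarrow> qcomb (\<lambda>i. if i = j then q else 0) xs = q *\<^sub>Q xs ! j"
  by (simp add: qcomb_def if_distrib[of "\<lambda>q. q *\<^sub>Q _"] cong: if_cong)

lemma zcomb_add: "zcomb (\<lambda>i. c i + d i) xs = zcomb c xs + zcomb d xs"
  and zcomb_diff: "zcomb (\<lambda>i. c i - d i) xs = zcomb c xs - zcomb d xs"
  and zcomb_scale: "zcomb (\<lambda>i. m * c i) xs = of_int m *\<^sub>Q zcomb c xs"
  and zcomb_cong: "(\<And>i. i < length xs \<Longrightarrow> c i = d i) \<Longrightarrow> zcomb c xs = zcomb d xs"
  and zcomb_zero: "zcomb (\<lambda>i. 0) xs = 0"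
  and zcomb_append: "zcomb c (xs @ ys) = zcomb c xs + zcomb (\<lambda>i. c (length xs + i)) ys"
  by (simp_all add: zcomb_qcomb qcomb_add qcomb_diff qcomb_scale qcomb_zero qcomb_append cong: qcomb_cong)

lemma zcomb_unit: "j < length xs \<Longrightarrow> zcomb (\<lambda>i. if i = j then 1 else 0) xs = xs ! j"
  using qcomb_unit[of j xs 1] by (simp add: zcomb_qcomb scaleQ_one if_distrib[of of_int] cong: if_cong)

text \<open>Coefficient families are functions on all of nat, so those of a concatenation are glued
  with a shift by \<open>length xs\<close>.\<close>

lemma ex_append_coeffs:
  "\<exists>c. (\<forall>i<length xs. c i = a i) \<and> (\<forall>i. c (length xs + i) = b i)"
  by (rule exI[of _ "\<lambda>i. if i < length xs then a i else b (i - length xs)"]) simp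

abbreviation zspan :: "'v::rat_vector list \<Rightarrow> 'v set" where "zspan xs \<equiv> range (\<lambda>c. zcomb c xs)"
abbreviation qspan :: "'v::rat_vector list \<Rightarrow> 'v set" where "qspan xs \<equiv> range (\<lambda>c. qcomb c xs)"

definition add_subgroup :: "'v::ab_group_add set \<Rightarrow> bool" where
  "add_subgroup A \<longleftrightarrow> 0 \<in> A \<and> (\<forall>x\<in>A. \<forall>y\<in>A. x - y \<in> A)"

lemma add_subgroupD: assumes "add_subgroup A"
  shows add_subgroup_0: "0 \<in> A" and add_subgroup_diff: "x \<in> A \<Longrightarrow> y \<in> A \<Longrightarrow> x - y \<in> A"
    and add_subgroup_neg: "x \<in> A \<Longrightarrow> - x \<in> A" and add_subgroup_add: "x \<in> A \<Longrightarrow> y \<in> A \<Longrightarrow> x + y \<in> A"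
proof -
  show 0: "0 \<in> A" and d: "x \<in> A \<Longrightarrow> y \<in> A \<Longrightarrow> x - y \<in> A" for x y
    using assms by (auto simp: add_subgroup_def)
  show n: "x \<in> A \<Longrightarrow> - x \<in> A" for x using d[OF 0, of x] by simp
  show "x \<in> A \<Longrightarrow> y \<in> A \<Longrightarrow> x + y \<in> A" using d[OF _ n, of x y] by simp
qed

lemma add_subgroup_scale: assumes "add_subgroup A" "x \<in> A" shows "of_int m *\<^sub>Q x \<in> A"
proof -
  have n: "of_nat k *\<^sub>Q x \<in> A" for k
    by (induction k) (simp_all add: add_subgroup_0[OF assms(1)] scaleQ_add_left scaleQ_one assms(2)
        add_subgroup_add[OF assms(1)])
  show ?thesis using n[of "nat m"] add_subgroup_neg[OF assms(1) n, of "nat (- m)"]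
    by (cases "0 \<le> m") (auto simp: of_nat_nat)
qed

lemma add_subgroup_zcomb: assumes "add_subgroup A" "set xs \<subseteq> A" shows "zcomb c xs \<in> A"
proof -
  have "(\<Sum>i<k. of_int (c i) *\<^sub>Q xs ! i) \<in> A" if "k \<le> length xs" for k
    using that assms(2)
    by (induction k) (auto simp: add_subgroup_0[OF assms(1)] intro!: add_subgroup_add[OF assms(1)] add_subgroup_scale[OF assms(1)])
  then show ?thesis by (simp add: zcomb_def)
qed

lemma add_subgroup_zspan: "add_subgroup (zspan xs)"
  unfolding add_subgroup_def
  by (auto simp: zcomb_diff[symmetric] intro: range_eqI[where x = "\<lambda>i. 0"] zcomb_zero[symmetric])

lemma add_subgroup_subspace: "Q.subspace U \<Longrightarrow> add_subgroup U"
  by (auto simp: add_subgroup_def Q.subspace_0 Q.subspace_diff)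

lemma add_subgroup_Int: "add_subgroup A \<Longrightarrow> add_subgroup B \<Longrightarrow> add_subgroup (A \<inter> B)"
  by (auto simp: add_subgroup_def)

lemma set_sum_group: assumes "add_subgroup A" "add_subgroup B" shows "add_subgroup (set_sum A B)"
  unfolding add_subgroup_def set_sum_def
proof (intro conjI ballI)
  show "0 \<in> {a + b |a b. a \<in> A \<and> b \<in> B}" using add_subgroup_0[OF assms(1)] add_subgroup_0[OF assms(2)] by force
  fix x y assume "x \<in> {a + b |a b. a \<in> A \<and> b \<in> B}" "y \<in> {a + b |a b. a \<in> A \<and> b \<in> B}"
  then obtain a b c d where "x = a + b" "y = c + d" "a \<in> A" "b \<in> B" "c \<in> A" "d \<in> B" by blast
  moreover have "a + b - (c + d) = (a - c) + (b - d)" by simp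
  ultimately show "x - y \<in> {a + b |a b. a \<in> A \<and> b \<in> B}"
    using add_subgroup_diff[OF assms(1), of a c] add_subgroup_diff[OF assms(2), of b d] by blast
qed

lemma set_zspan: "set xs \<subseteq> zspan xs"
  using zcomb_unit[of _ xs] by (auto simp: in_set_conv_nth) (metis rangeI)

lemma subspace_qspan: "Q.subspace (qspan xs)"
  unfolding Q.subspace_def
  by (auto simp: qcomb_add[symmetric] qcomb_scale[symmetric] intro: range_eqI[of _ _ "\<lambda>i. 0"] simp: qcomb_zero)

lemma set_qspan: "set xs \<subseteq> qspan xs"
  using qcomb_unit[of _ xs 1] by (auto simp: in_set_conv_nth scaleQ_one) (metis rangeI)

lemma qspan_subset: assumes "Q.subspace U" "set xs \<subseteq> U" shows "qspan xs \<subseteq> U"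
  unfolding qcomb_def using assms by (auto intro!: Q.subspace_sum Q.subspace_scale)

lemma span_qspan: "Q.span (set xs) = qspan xs"
  using Q.span_minimal[OF set_qspan subspace_qspan] qspan_subset[OF Q.subspace_span Q.span_superset]
  by blast

lemma zspan_subset_qspan: "zspan xs \<subseteq> qspan xs" by (auto simp: zcomb_qcomb)

definition q_indep :: "'v::rat_vector list \<Rightarrow> bool" where
  "q_indep xs \<longleftrightarrow> (\<forall>c. qcomb c xs = 0 \<longrightarrow> (\<forall>i<length xs. c i = 0))"

lemma q_indep_iff: "q_indep xs \<longleftrightarrow> distinct xs \<and> Q.independent (set xs)"
proof
  assume q: "q_indep xs"
  show "distinct xs \<and> Q.independent (set xs)"
  proof
    show d: "distinct xs"
    proof (rule ccontr)
      assume "\<not> distinct xs"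
      then obtain i j where ij: "i < length xs" "j < length xs" "i \<noteq> j" "xs ! i = xs ! j"
        by (auto simp: distinct_conv_nth)
      let ?c = "\<lambda>k. (if k = i then 1 else 0) - (if k = j then 1 else 0 :: rat)"
      have c: "qcomb ?c xs = 0"
        using ij by (simp add: qcomb_diff qcomb_unit)
      have "?c i = 0" using spec[OF mp[OF spec[OF q[unfolded q_indep_def], of ?c] c], of i] ij(1) by (rule mp)
      then show False using ij(3) by simp
    qed
    show "Q.independent (set xs)"
    proof
      assume "Q.dependent (set xs)"
      then obtain u v where u: "v \<in> set xs" "u v \<noteq> 0" "(\<Sum>v\<in>set xs. u v *\<^sub>Q v) = 0"
        by (auto simp: Q.dependent_finite)
      have "qcomb (\<lambda>i. u (xs ! i)) xs = (\<Sum>v\<in>set xs. u v *\<^sub>Q v)"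
        unfolding qcomb_def by (rule sum.reindex_bij_betw[OF bij_betw_nth[OF d]]) auto
      then show False using q u by (auto simp: q_indep_def in_set_conv_nth)
    qed
  qed
next
  assume a: "distinct xs \<and> Q.independent (set xs)"
  show "q_indep xs" unfolding q_indep_def
  proof (intro allI impI)
    fix c i assume c: "qcomb c xs = 0" and i: "i < length xs"
    define u where "u v = c (the_inv_into {..<length xs} (nth xs) v)" for v
    have b: "bij_betw (nth xs) {..<length xs} (set xs)" using bij_betw_nth a by blast
    have ui: "u (xs ! j) = c j" if "j < length xs" for j
      using that b by (simp add: u_def the_inv_into_f_f bij_betw_def)
    have "(\<Sum>v\<in>set xs. u v *\<^sub>Q v) = (\<Sum>j<length xs. u (xs ! j) *\<^sub>Q xs ! j)"
      by (rule sum.reindex_bij_betw[OF b, symmetric])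
    also have "\<dots> = 0" using c ui by (simp add: qcomb_def)
    finally have "u (xs ! i) = 0"
      by (rule Q.independentD[OF conjunct2[OF a] finite_set order_refl]) (simp add: i)
    then show "c i = 0" using ui i by simp
  qed
qed

lemma q_indep_unique: assumes "q_indep xs" "qcomb c xs = qcomb d xs" "i < length xs" shows "c i = d i"
  using assms qcomb_diff[of c d xs] by (auto simp: q_indep_def)

lemma zcomb_unique: assumes "q_indep xs" "zcomb c xs = zcomb d xs" "i < length xs" shows "c i = d i"
  using q_indep_unique[OF assms(1), of "\<lambda>i. of_int (c i)" "\<lambda>i. of_int (d i)" i] assms(2,3) by (simp add: zcomb_qcomb)

lemma common_denominator: "\<exists>N>0. \<forall>x\<in>S. \<exists>z. of_int N * f x = (of_int z :: rat)" if "finite S"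
  using that
proof (induction S)
  case (insert a S)
  then obtain N where N: "N > 0" "\<forall>x\<in>S. \<exists>z. of_int N * f x = (of_int z :: rat)" by auto
  obtain p q where pq: "f a = of_int p / of_int q" "q > 0"
    using quotient_of_div[of "f a"] quotient_of_denom_pos[of "f a"] by (metis prod.exhaust_sel)
  have "of_int (N * q) * f a = (of_int (N * p) :: rat)" using pq by simp
  then have "\<exists>z. of_int (N * q) * f a = (of_int z :: rat)" by blast
  moreover have "\<exists>z. of_int (N * q) * f x = (of_int z :: rat)" if x: "x \<in> S" for x
  proof -
    obtain z where z: "of_int N * f x = (of_int z :: rat)" using x N by auto
    have "of_int (N * q) * f x = of_int q * (of_int N * f x)" by simp
    also have "\<dots> = of_int (q * z)" unfolding z by simp
    finally show ?thesis by blast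
  qed
  ultimately show ?case using N(1) pq(2) by (intro exI[of _ "N * q"]) (auto simp del: of_int_mult)
qed (auto intro: exI[of _ 1])

lemma qspan_multiple: assumes "v \<in> qspan xs" shows "\<exists>m>0. of_int m *\<^sub>Q v \<in> zspan xs"
proof -
  obtain c where c: "v = qcomb c xs" using assms by auto
  obtain N where N: "N > 0" "\<forall>i\<in>{..<length xs}. \<exists>z. of_int N * c i = (of_int z :: rat)"
    using common_denominator[of "{..<length xs}" c] by auto
  then obtain z where "\<forall>i<length xs. of_int N * c i = (of_int (z i) :: rat)" by (metis lessThan_iff)
  then have "of_int N *\<^sub>Q v = zcomb z xs" unfolding c qcomb_scale[symmetric] zcomb_qcomb
    by (auto intro: qcomb_cong)
  then show ?thesis using N(1) by blast
qed

text \<open>A common denominator turns a rational relation into an integral one.\<close>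

lemma z_basis_q_indep: assumes "z_basis xs A" shows "q_indep xs"
  unfolding q_indep_def
proof (intro allI impI)
  fix c i assume c: "qcomb c xs = 0" and i: "i < length xs"
  obtain N where N: "N > 0" "\<forall>i\<in>{..<length xs}. \<exists>z. of_int N * c i = (of_int z :: rat)"
    using common_denominator[of "{..<length xs}" c] by auto
  then obtain z where z: "\<forall>i<length xs. of_int N * c i = (of_int (z i) :: rat)" by (metis lessThan_iff)
  have "zcomb z xs = of_int N *\<^sub>Q qcomb c xs" using z unfolding qcomb_scale[symmetric] zcomb_qcomb
    by (auto intro: qcomb_cong)
  then have "z i = 0" using assms i c by (auto simp: z_basis_def)
  then show "c i = 0" using z i N(1) by fastforce
qed

lemma z_basis_iff: "z_basis xs A \<longleftrightarrow> q_indep xs \<and> A = zspan xs"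
  using z_basis_q_indep[of xs A] by (auto simp: z_basis_def q_indep_def zcomb_qcomb)

lemma full_lattice_iff: "full_lattice V L \<longleftrightarrow> (\<exists>xs. q_indep xs \<and> V = qspan xs \<and> L = zspan xs)"
  by (auto simp: full_lattice_def q_basis_def q_indep_iff span_qspan)

lemma full_lattice_subset: "full_lattice V L \<Longrightarrow> L \<subseteq> V"
  using zspan_subset_qspan unfolding full_lattice_iff by blast

lemma q_indep_append: assumes "q_indep (xs @ ys)"
  shows "q_indep xs" "q_indep ys" "qspan xs \<inter> qspan ys = {0}"
proof -
  have z: "(\<forall>i<length xs. a i = 0) \<and> (\<forall>i<length ys. b i = 0)" if "qcomb a xs + qcomb b ys = 0" for a b
  proof -
    obtain c where c: "\<forall>i<length xs. c i = a i" "\<forall>i. c (length xs + i) = b i"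
      using ex_append_coeffs by blast
    have "qcomb c (xs @ ys) = 0" using that c by (simp add: qcomb_append cong: qcomb_cong)
    then have *: "c i = 0" if "i < length xs + length ys" for i
      using assms that by (auto simp: q_indep_def)
    show ?thesis using * c by (metis add_less_cancel_left trans_less_add1)
  qed
  show "q_indep xs" "q_indep ys"
    using z[of _ "\<lambda>i. 0"] z[of "\<lambda>i. 0"] by (auto simp: q_indep_def qcomb_zero)
  show "qspan xs \<inter> qspan ys = {0}"
  proof
    show "qspan xs \<inter> qspan ys \<subseteq> {0}"
    proof
      fix v assume "v \<in> qspan xs \<inter> qspan ys"
      then obtain a b where ab: "v = qcomb a xs" "v = qcomb b ys" by blast
      have "qcomb a xs + qcomb (\<lambda>i. - 1 * b i) ys = 0"
        unfolding qcomb_scale using ab by simp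
      then have "\<forall>i<length xs. a i = 0" using z by blast
      then have "qcomb a xs = qcomb (\<lambda>i. 0) xs" by (intro qcomb_cong) auto
      then show "v \<in> {0}" using ab(1) by (simp add: qcomb_zero)
    qed
    show "{0} \<subseteq> qspan xs \<inter> qspan ys"
      using Q.subspace_0[OF subspace_qspan[of xs]] Q.subspace_0[OF subspace_qspan[of ys]] by blast
  qed
qed

lemma zspan_append: "zspan (xs @ ys) = set_sum (zspan xs) (zspan ys)"
proof (rule equalityI; rule subsetI)
  fix v assume "v \<in> set_sum (zspan xs) (zspan ys)"
  then obtain a b where ab: "v = zcomb a xs + zcomb b ys" by (auto simp: set_sum_def)
  obtain c where c: "\<forall>i<length xs. c i = a i" "\<forall>i. c (length xs + i) = b i"
    using ex_append_coeffs by blast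
  have "v = zcomb c (xs @ ys)" using ab c by (simp add: zcomb_append cong: zcomb_cong)
  then show "v \<in> zspan (xs @ ys)" by blast
qed (auto simp: set_sum_def zcomb_append)

lemma qspan_append: "qspan (xs @ ys) = set_sum (qspan xs) (qspan ys)"
proof (rule equalityI; rule subsetI)
  fix v assume "v \<in> set_sum (qspan xs) (qspan ys)"
  then obtain a b where ab: "v = qcomb a xs + qcomb b ys" by (auto simp: set_sum_def)
  obtain c where c: "\<forall>i<length xs. c i = a i" "\<forall>i. c (length xs + i) = b i"
    using ex_append_coeffs by blast
  have "v = qcomb c (xs @ ys)" using ab c by (simp add: qcomb_append cong: qcomb_cong)
  then show "v \<in> qspan (xs @ ys)" by blast
qed (auto simp: set_sum_def qcomb_append)

lemma q_indep_appendI: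
  assumes "q_indep xs" "q_indep ys" "qspan xs \<inter> qspan ys = {0}"
  shows "q_indep (xs @ ys)"
  unfolding q_indep_def
proof (intro allI impI)
  fix c i assume c: "qcomb c (xs @ ys) = 0" and i: "i < length (xs @ ys)"
  let ?d = "\<lambda>i. c (length xs + i)"
  have "qcomb c xs = - 1 *\<^sub>Q qcomb ?d ys" using c by (simp add: qcomb_append eq_neg_iff_add_eq_0 scaleQ_one)
  then have "qcomb c xs = qcomb (\<lambda>i. - 1 * ?d i) ys" unfolding qcomb_scale .
  then have "qcomb c xs \<in> qspan xs \<inter> qspan ys" by blast
  then have x: "qcomb c xs = 0" using assms(3) by blast
  then have y: "qcomb ?d ys = 0" using c by (simp add: qcomb_append)
  show "c i = 0"
  proof (cases "i < length xs")
    case True then show ?thesis using assms(1) x by (auto simp: q_indep_def)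
  next
    case False
    then have "?d (i - length xs) = 0" using assms(2) y i unfolding q_indep_def
      by (metis add_diff_inverse_nat length_append nat_add_left_cancel_less)
    then show ?thesis using False by simp
  qed
qed

text \<open>By induction on N: the values of the last coordinate on the common kernel of the others are the
  multiples of the least positive one.\<close>

lemma split_int_hom:
  fixes \<phi> :: "'v::rat_vector \<Rightarrow> nat \<Rightarrow> int"
  assumes A: "add_subgroup A" and \<phi>: "\<And>x y i. x \<in> A \<Longrightarrow> y \<in> A \<Longrightarrow> i < N \<Longrightarrow> \<phi> (x - y) i = \<phi> x i - \<phi> y i"
  defines "K \<equiv> (\<lambda>m. {x\<in>A. \<forall>i<m. \<phi> x i = 0})"
  shows "\<exists>ys. set ys \<subseteq> A \<and> (\<forall>x\<in>A. \<exists>c. x - zcomb c ys \<in> K N)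
    \<and> (\<forall>c. zcomb c ys \<in> K N \<longrightarrow> (\<forall>i<length ys. c i = 0))"
  using \<phi>
proof (induction N)
  case 0
  show ?case by (rule exI[of _ "[]"]) (simp add: K_def zcomb_def)
next
  case (Suc N)
  note \<phi> = Suc.prems
  obtain ys where ys: "set ys \<subseteq> A" "\<forall>x\<in>A. \<exists>c. x - zcomb c ys \<in> K N"
    "\<forall>c. zcomb c ys \<in> K N \<longrightarrow> (\<forall>i<length ys. c i = 0)"
    using Suc by auto
  have \<phi>0: "\<phi> 0 i = 0" if "i < Suc N" for i
    using \<phi>[OF add_subgroup_0[OF A] add_subgroup_0[OF A] that] by simp
  have KS: "K (Suc N) = {x\<in>K N. \<phi> x N = 0}" by (auto simp: K_def less_Suc_eq)
  have KN: "add_subgroup (K N)"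
    unfolding add_subgroup_def K_def by (auto simp: \<phi> \<phi>0 add_subgroup_0[OF A] add_subgroup_diff[OF A])
  have KA: "K N \<subseteq> A" by (auto simp: K_def)
  show ?case
  proof (cases "\<forall>x\<in>K N. \<phi> x N = 0")
    case True
    then have "K (Suc N) = K N" using KS by auto
    then show ?thesis using ys by auto
  next
    case False
    then obtain x1 where x1: "x1 \<in> K N" "\<phi> x1 N \<noteq> 0" by auto
    have "\<phi> (0 - x1) N = - \<phi> x1 N" using x1 KA \<phi>[OF add_subgroup_0[OF A], of x1 N] \<phi>0 by auto
    then have ex: "\<exists>x. x \<in> K N \<and> \<phi> x N > 0"
      using x1 add_subgroup_neg[OF KN x1(1)] by (intro exI[of _ "if \<phi> x1 N > 0 then x1 else - x1"]) auto
    define x0 where "x0 = (ARG_MIN (\<lambda>x. nat (\<phi> x N)) x. x \<in> K N \<and> \<phi> x N > 0)"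
    have x0: "x0 \<in> K N" "\<phi> x0 N > 0"
      using arg_min_natI[of "\<lambda>x. x \<in> K N \<and> \<phi> x N > 0", OF someI_ex[OF ex]] by (auto simp: x0_def)
    have min: "\<phi> x0 N \<le> \<phi> x N" if "x \<in> K N" "\<phi> x N > 0" for x
    proof -
      have "nat (\<phi> x0 N) \<le> nat (\<phi> x N)"
        unfolding x0_def using arg_min_nat_le[of "\<lambda>x. x \<in> K N \<and> \<phi> x N > 0" x "\<lambda>x. nat (\<phi> x N)"] that by auto
      then show ?thesis using that by simp
    qed
    \<comment> \<open>Additivity is given for single differences. Natural multiples follow by
      induction; for a negative multiple the subtraction is undone.\<close>
    have \<phi>s: "\<phi> (x - of_int m *\<^sub>Q x0) N = \<phi> x N - m * \<phi> x0 N" if x: "x \<in> K N" for x m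
    proof -
      have x0A: "x0 \<in> A" using x0 KA by auto
      have n: "\<phi> (z - of_nat k *\<^sub>Q x0) N = \<phi> z N - int k * \<phi> x0 N" if z: "z \<in> A" for z k
      proof (induction k)
        case (Suc k)
        have "z - of_nat k *\<^sub>Q x0 \<in> A"
          using add_subgroup_diff[OF A z add_subgroup_scale[OF A x0A, of "int k"]] by simp
        moreover have "z - of_nat (Suc k) *\<^sub>Q x0 = z - of_nat k *\<^sub>Q x0 - x0"
          by (simp add: scaleQ_add_left scaleQ_one)
        ultimately show ?case using Suc \<phi>[OF _ x0A, of "z - of_nat k *\<^sub>Q x0" N] by (simp add: algebra_simps)
      qed simp
      show ?thesis
      proof (cases "0 \<le> m")
        case True
        then show ?thesis using n[of x "nat m"] x KA by (auto simp: of_nat_nat)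
      next
        case False
        then have e: "- of_int m = (of_nat (nat (- m)) :: rat)" by (simp add: of_nat_nat)
        have "x - of_int m *\<^sub>Q x0 \<in> A"
          using x KA add_subgroup_diff[OF A _ add_subgroup_scale[OF A x0A]] by auto
        moreover have "x - of_int m *\<^sub>Q x0 - of_nat (nat (- m)) *\<^sub>Q x0 = x"
          by (simp add: e[symmetric])
        ultimately show ?thesis using n[of "x - of_int m *\<^sub>Q x0" "nat (- m)"] False by simp
      qed
    qed
    let ?zs = "ys @ [x0]"
    have zz: "zcomb c ?zs = zcomb c ys + of_int (c (length ys)) *\<^sub>Q x0" for c
      by (simp add: zcomb_append) (simp add: zcomb_def)
    have "\<exists>c. x - zcomb c ?zs \<in> K (Suc N)" if xA: "x \<in> A" for x
    proof -
      obtain c where c: "x - zcomb c ys \<in> K N" using ys xA by auto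
      \<comment> \<open>Division with remainder: subtracting the multiple of \<open>x0\<close>
        leaves a last coordinate that is non-negative and below the least positive value, hence
        0.\<close>
      let ?k = "x - zcomb c ys" let ?m = "\<phi> ?k N div \<phi> x0 N"
      let ?r = "?k - of_int ?m *\<^sub>Q x0"
      have r: "?r \<in> K N" using add_subgroup_diff[OF KN c add_subgroup_scale[OF KN x0(1)]] .
      have "\<phi> ?r N = \<phi> ?k N mod \<phi> x0 N" by (simp add: \<phi>s[OF c] minus_div_mult_eq_mod)
      then have "0 \<le> \<phi> ?r N" "\<phi> ?r N < \<phi> x0 N" using x0(2) by auto
      then have "\<phi> ?r N = 0" using min[OF r] by linarith
      then have "?r \<in> K (Suc N)" using r KS by simp
      moreover have "?r = x - zcomb (c(length ys := ?m)) ?zs"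
        by (simp add: zz diff_diff_add cong: zcomb_cong)
      ultimately show ?thesis by (intro exI) (erule (1) back_subst[of "\<lambda>z. z \<in> K (Suc N)"])
    qed
    moreover have "\<forall>i<length ?zs. c i = 0" if c: "zcomb c ?zs \<in> K (Suc N)" for c
    proof -
      have "zcomb c ?zs \<in> K N" using c KS by auto
      then have "zcomb c ys \<in> K N"
        using add_subgroup_diff[OF KN _ add_subgroup_scale[OF KN x0(1)], of "zcomb c ?zs" "c (length ys)"]
        by (simp add: zz)
      then have c0: "\<forall>i<length ys. c i = 0" using ys(3) by auto
      then have "zcomb c ys = zcomb (\<lambda>i. 0) ys" by (intro zcomb_cong) auto
      \<comment> \<open>Written as a difference from 0 so that \<open>\<phi>s\<close>
        applies.\<close>
      then have z: "zcomb c ?zs = 0 - of_int (- c (length ys)) *\<^sub>Q x0" by (simp add: zz zcomb_zero)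
      have "\<phi> (zcomb c ?zs) N = c (length ys) * \<phi> x0 N"
        unfolding z \<phi>s[OF add_subgroup_0[OF KN]] by (simp add: \<phi>0)
      then have "c (length ys) = 0" using c KS x0(2) by auto
      then show ?thesis using c0 by (auto simp: less_Suc_eq)
    qed
    ultimately show ?thesis using ys(1) x0(1) KA by (intro exI[of _ ?zs]) auto
  qed
qed

text \<open>Here the common kernel is trivial and A embeds into Z^N by \<phi>. In the application
  the coordinates are the entries of integral matrices.\<close>

lemma z_basis_int_hom:
  fixes \<phi> :: "'v::rat_vector \<Rightarrow> nat \<Rightarrow> int"
  assumes A: "add_subgroup A" and \<phi>: "\<And>x y i. x \<in> A \<Longrightarrow> y \<in> A \<Longrightarrow> i < N \<Longrightarrow> \<phi> (x - y) i = \<phi> x i - \<phi> y i"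
    and inj: "\<And>x. x \<in> A \<Longrightarrow> (\<And>i. i < N \<Longrightarrow> \<phi> x i = 0) \<Longrightarrow> x = 0"
  shows "\<exists>ys. z_basis ys A"
proof -
  have "\<phi> 0 i = 0" if "i < N" for i using \<phi>[OF add_subgroup_0[OF A] add_subgroup_0[OF A] that] by simp
  then have K: "{x\<in>A. \<forall>i<N. \<phi> x i = 0} = {0}" using inj add_subgroup_0[OF A] by auto
  obtain ys where ys: "set ys \<subseteq> A" "\<forall>x\<in>A. \<exists>c. x - zcomb c ys = 0"
     "\<forall>c. zcomb c ys = 0 \<longrightarrow> (\<forall>i<length ys. c i = 0)"
    using split_int_hom[where N = N and \<phi> = \<phi>, OF A \<phi>] unfolding K by auto
  have "A = zspan ys" using ys(2) add_subgroup_zcomb[OF A ys(1)] by fastforce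
  then show ?thesis using ys(3) by (auto simp: z_basis_def)
qed

text \<open>A basis of U is extended to one of the ambient space. The coordinates outside U have a
  common denominator on \<open>bs\<close>; multiplied by it they become integral on A, and their
  common kernel is the intersection of A and U. So \<open>split_int_hom\<close> applies.\<close>

lemma lattice_split:
  fixes U :: "'v::rat_vector set"
  assumes A: "add_subgroup A" "A \<subseteq> zspan bs" and U: "Q.subspace U"
  shows "\<exists>ys. set ys \<subseteq> A \<and> (\<forall>x\<in>A. \<exists>c. x - zcomb c ys \<in> U) \<and> (\<forall>c. zcomb c ys \<in> U \<longrightarrow> (\<forall>i<length ys. c i = 0))"
proof -
  obtain B where B: "B \<subseteq> U" "Q.independent B" "U \<subseteq> Q.span B"
    using Q.maximal_independent_subset[of U] by auto
  define C where "C = Q.extend_basis B"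
  have C: "B \<subseteq> C" "Q.independent C" "Q.span C = UNIV"
    using Q.extend_basis_superset[OF B(2)] Q.independent_extend_basis[OF B(2)] Q.span_extend_basis[OF B(2)]
    by (auto simp: C_def)
  let ?r = "Q.representation C"
  have sp: "v \<in> Q.span C" for v using C(3) by simp
  have radd: "?r (v + w) b = ?r v b + ?r w b" for v w b using Q.representation_add[OF C(2) sp sp] by simp
  have rdiff: "?r (v - w) b = ?r v b - ?r w b" for v w b using Q.representation_diff[OF C(2) sp sp] by simp
  have rsc: "?r (q *\<^sub>Q v) b = q * ?r v b" for v q b using Q.representation_scale[OF C(2) sp] by simp
  have rsum: "?r (\<Sum>i\<in>I. q i *\<^sub>Q f i) b = (\<Sum>i\<in>I. q i * ?r (f i) b)" for I :: "nat set" and q f b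
    by (induction I rule: infinite_finite_induct) (simp_all add: Q.representation_zero radd rsc)
  have UB: "Q.span B = U" using B(1,3) U Q.span_minimal by blast
  have Uiff: "v \<in> U \<longleftrightarrow> (\<forall>b. b \<notin> B \<longrightarrow> ?r v b = 0)" for v
  proof
    assume "v \<in> U"
    then have v: "v \<in> Q.span B" using UB by simp
    have "?r v = Q.representation B v" by (rule Q.representation_extend[OF C(2) v C(1)])
    then show "\<forall>b. b \<notin> B \<longrightarrow> ?r v b = 0" using Q.representation_ne_zero[of B v] by auto
  next
    assume a: "\<forall>b. b \<notin> B \<longrightarrow> ?r v b = 0"
    have "v = (\<Sum>b | ?r v b \<noteq> 0. ?r v b *\<^sub>Q b)" by (rule Q.sum_nonzero_representation_eq[OF C(2) sp, symmetric])
    also have "\<dots> \<in> Q.span B" using a by (auto intro!: Q.span_sum Q.span_scale intro: Q.span_base)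
    finally show "v \<in> U" using UB by simp
  qed
  \<comment> \<open>The basis C may be infinite, but only finitely many of its elements outside B
    occur in the expansions of the entries of \<open>bs\<close>.\<close>
  define S where "S = (\<Union>b\<in>set bs. {c. ?r b c \<noteq> 0}) - B"
  have S: "finite S" by (auto simp: S_def Q.finite_representation)
  then obtain cs where cs: "set cs = S" using finite_list by blast
  obtain N where N: "N > 0" "\<forall>p\<in>set bs \<times> S. \<exists>z. of_int N * (case p of (b, c) \<Rightarrow> ?r b c) = (of_int z :: rat)"
    using common_denominator[of "set bs \<times> S" "\<lambda>(b, c). ?r b c"] S by auto
  then have N2: "\<exists>z. of_int N * ?r b c = (of_int z :: rat)" if "b \<in> set bs" "c \<in> S" for b c
    using that by fastforce
  then obtain z where z: "\<And>b c. b \<in> set bs \<Longrightarrow> c \<in> S \<Longrightarrow> of_int N * ?r b c = (of_int (z b c) :: rat)" by metis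
  have int: "\<exists>y. of_int N * ?r v c = (of_int y :: rat)" if v: "v \<in> A" and c: "c \<in> S" for v c
  proof -
    obtain a where a: "v = zcomb a bs" using v A by auto
    have "of_int N * ?r v c = (\<Sum>i<length bs. of_int (a i) * (of_int N * ?r (bs ! i) c))"
      unfolding a zcomb_def rsum by (simp add: sum_distrib_left mult_ac)
    also have "\<dots> = of_int (\<Sum>i<length bs. a i * z (bs ! i) c)" using z c by simp
    finally show ?thesis by blast
  qed
  \<comment> \<open>The floor only changes the type: on A the argument is integral by
    \<open>int\<close>.\<close>
  define \<phi> where "\<phi> v i = \<lfloor>of_int N * ?r v (cs ! i)\<rfloor>" for v i
  have \<phi>: "of_int (\<phi> v i) = of_int N * ?r v (cs ! i)" if "v \<in> A" "i < length cs" for v i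
    using int[OF that(1), of "cs ! i"] that(2) cs by (auto simp: \<phi>_def)
  have add: "\<phi> (x - y) i = \<phi> x i - \<phi> y i" if "x \<in> A" "y \<in> A" "i < length cs" for x y i
  proof -
    have "(of_int (\<phi> (x - y) i) :: rat) = of_int (\<phi> x i - \<phi> y i)"
      using \<phi>[OF add_subgroup_diff[OF A(1) that(1,2)] that(3)] \<phi>[OF that(1,3)] \<phi>[OF that(2,3)]
      by (simp add: rdiff algebra_simps)
    then show ?thesis by (simp only: of_int_eq_iff)
  qed
  have K: "x \<in> U \<longleftrightarrow> (\<forall>i<length cs. \<phi> x i = 0)" if x: "x \<in> A" for x
  proof
    assume "x \<in> U"
    then have "?r x c = 0" if "c \<in> S" for c using that Uiff[of x] by (auto simp: S_def)
    then show "\<forall>i<length cs. \<phi> x i = 0" using cs by (auto simp: \<phi>_def)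
  next
    assume a: "\<forall>i<length cs. \<phi> x i = 0"
    have rS: "?r x c = 0" if "c \<in> S" for c
    proof -
      have "c \<in> set cs" using that cs by simp
      then obtain i where "i < length cs" "c = cs ! i" by (auto simp: in_set_conv_nth)
      then show ?thesis using \<phi>[OF x, of i] a N(1) by auto
    qed
    show "x \<in> U" unfolding Uiff
    proof (intro allI impI)
      fix b assume b: "b \<notin> B"
      show "?r x b = 0"
      proof (cases "b \<in> S")
        case False
        then have "?r v b = 0" if "v \<in> set bs" for v using b that by (auto simp: S_def)
        moreover obtain a where a: "x = zcomb a bs" using x A by auto
        ultimately show ?thesis unfolding a zcomb_def rsum by simp
      qed (rule rS)
    qed
  qed
  have "\<exists>ys. set ys \<subseteq> A \<and> (\<forall>x\<in>A. \<exists>c. x - zcomb c ys \<in> {x\<in>A. \<forall>i<length cs. \<phi> x i = 0})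
    \<and> (\<forall>c. zcomb c ys \<in> {x\<in>A. \<forall>i<length cs. \<phi> x i = 0} \<longrightarrow> (\<forall>i<length ys. c i = 0))"
    by (rule split_int_hom[OF A(1)]) (rule add)
  then obtain ys where ys: "set ys \<subseteq> A" "\<forall>x\<in>A. \<exists>c. x - zcomb c ys \<in> {x\<in>A. \<forall>i<length cs. \<phi> x i = 0}"
    "\<forall>c. zcomb c ys \<in> {x\<in>A. \<forall>i<length cs. \<phi> x i = 0} \<longrightarrow> (\<forall>i<length ys. c i = 0)"
    by (elim exE conjE) (rule that; assumption)
  have "\<exists>c. x - zcomb c ys \<in> U" if xA: "x \<in> A" for x
  proof -
    obtain c where "x - zcomb c ys \<in> {x\<in>A. \<forall>i<length cs. \<phi> x i = 0}" using bspec[OF ys(2) xA] by (elim exE)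
    then have "x - zcomb c ys \<in> U" using K by simp
    then show "\<exists>c. x - zcomb c ys \<in> U" by (intro exI[of _ c])
  qed
  moreover have "\<forall>i<length ys. c i = 0" if "zcomb c ys \<in> U" for c
    using ys(3) K[OF add_subgroup_zcomb[OF A(1) ys(1), of c]] that add_subgroup_zcomb[OF A(1) ys(1), of c] by simp
  ultimately show ?thesis using ys(1) by (intro exI[of _ ys] conjI ballI allI impI) simp_all
qed

section \<open>Bases of lattices adapted to subspaces\<close>

lemma sublattice_basis:
  assumes "add_subgroup A" "A \<subseteq> zspan bs" shows "\<exists>ys. z_basis ys A"
proof -
  have "\<exists>ys. set ys \<subseteq> A \<and> (\<forall>x\<in>A. \<exists>c. x - zcomb c ys \<in> {0}) \<and> (\<forall>c. zcomb c ys \<in> {0} \<longrightarrow> (\<forall>i<length ys. c i = 0))"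
    by (rule lattice_split[OF assms]) (auto simp: Q.subspace_def)
  then obtain ys where ys: "set ys \<subseteq> A" "\<forall>x\<in>A. \<exists>c. x - zcomb c ys = 0"
     "\<forall>c. zcomb c ys = 0 \<longrightarrow> (\<forall>i<length ys. c i = 0)"
    by auto
  have "A = zspan ys" using ys(2) add_subgroup_zcomb[OF assms(1) ys(1)] by fastforce
  then show ?thesis using ys(3) by (auto simp: z_basis_def)
qed

text \<open>\<open>xs\<close> is a basis of the intersection of the lattice with U, and
  \<open>ys\<close> lifts a basis of the quotient, which is free because U is a subspace. That
  \<open>xs\<close> spans all of U holds because every vector of the rational span has a non-zero
  multiple in the lattice.\<close>

lemma adapted_basis:
  assumes "Q.subspace U" "U \<subseteq> qspan bs"
  shows "\<exists>xs ys. q_indep (xs @ ys) \<and> zspan (xs @ ys) = zspan bs \<and> qspan (xs @ ys) = qspan bs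
    \<and> zspan bs \<inter> U = zspan xs \<and> U = qspan xs"
proof -
  let ?L = "zspan bs"
  have s: "add_subgroup (?L \<inter> U)" "?L \<inter> U \<subseteq> zspan bs"
    by (auto intro: add_subgroup_Int add_subgroup_zspan add_subgroup_subspace[OF assms(1)])
  obtain xs where xs: "z_basis xs (?L \<inter> U)" using sublattice_basis[OF s] by auto
  obtain ys where ys: "set ys \<subseteq> ?L" "\<forall>x\<in>?L. \<exists>c. x - zcomb c ys \<in> U"
    "\<forall>c. zcomb c ys \<in> U \<longrightarrow> (\<forall>i<length ys. c i = 0)"
    using lattice_split[OF add_subgroup_zspan order_refl assms(1)] by blast
  have x: "q_indep xs" "?L \<inter> U = zspan xs" using xs by (auto simp: z_basis_iff)
  have y: "q_indep ys"
    using ys(3) Q.subspace_0[OF assms(1)] z_basis_q_indep[of ys "zspan ys"] by (auto simp: z_basis_def)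
  have U: "U = qspan xs"
  proof
    show "qspan xs \<subseteq> U" using qspan_subset[OF assms(1)] set_zspan[of xs] x(2) by blast
    show "U \<subseteq> qspan xs"
    proof
      fix v assume v: "v \<in> U"
      then have "v \<in> qspan bs" using assms(2) by (rule subsetD[rotated])
      from qspan_multiple[OF this] obtain m where m: "m > 0" "of_int m *\<^sub>Q v \<in> zspan bs" by (elim exE conjE)
      then have "of_int m *\<^sub>Q v \<in> zspan xs" using x(2) Q.subspace_scale[OF assms(1) v] by blast
      then have "of_int m *\<^sub>Q v \<in> qspan xs" using zspan_subset_qspan by blast
      then have "(1 / of_int m) *\<^sub>Q of_int m *\<^sub>Q v \<in> qspan xs" by (rule Q.subspace_scale[OF subspace_qspan])
      then show "v \<in> qspan xs" using m(1) by (simp add: scaleQ_scaleQ scaleQ_one)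
    qed
  qed
  have "qspan xs \<inter> qspan ys = {0}"
  proof
    show "qspan xs \<inter> qspan ys \<subseteq> {0}"
    proof
      fix v assume v: "v \<in> qspan xs \<inter> qspan ys"
      then obtain m c where m: "m > 0" "of_int m *\<^sub>Q v = zcomb c ys" using qspan_multiple[of v ys] by auto
      have "of_int m *\<^sub>Q v \<in> U" using v U Q.subspace_scale[OF assms(1)] by auto
      then have "zcomb c ys = zcomb (\<lambda>i. 0) ys" using m(2) ys(3) by (intro zcomb_cong) auto
      then show "v \<in> {0}" using m by (simp add: zcomb_zero)
    qed
    show "{0} \<subseteq> qspan xs \<inter> qspan ys"
      using Q.subspace_0[OF subspace_qspan[of xs]] Q.subspace_0[OF subspace_qspan[of ys]] by blast
  qed
  then have i: "q_indep (xs @ ys)" by (rule q_indep_appendI[OF x(1) y])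
  have L: "zspan (xs @ ys) = ?L"
  proof
    have "set (xs @ ys) \<subseteq> ?L" using ys(1) set_zspan[of xs] x(2) by auto
    then show "zspan (xs @ ys) \<subseteq> ?L" using add_subgroup_zcomb[OF add_subgroup_zspan, of "xs @ ys" bs] by blast
    show "?L \<subseteq> zspan (xs @ ys)"
    proof
      fix v assume v: "v \<in> ?L"
      then obtain c where c: "v - zcomb c ys \<in> U" using ys by blast
      moreover have "v - zcomb c ys \<in> ?L"
        using add_subgroup_diff[OF add_subgroup_zspan v add_subgroup_zcomb[OF add_subgroup_zspan ys(1)]] .
      ultimately have "v - zcomb c ys \<in> zspan xs" using x(2) by blast
      then have "(v - zcomb c ys) + zcomb c ys \<in> set_sum (zspan xs) (zspan ys)" unfolding set_sum_def by blast
      then show "v \<in> zspan (xs @ ys)" unfolding zspan_append by simp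
    qed
  qed
  have "qspan (xs @ ys) = qspan bs"
  proof -
    have "qspan as \<subseteq> qspan cs" if "zspan as = zspan cs" for as cs :: "'a list"
      using that set_zspan[of as] zspan_subset_qspan[of cs] by (intro qspan_subset[OF subspace_qspan]) blast
    then show ?thesis using L by blast
  qed
  then show ?thesis using i L x(2) U by blast
qed

lemma full_lattice_Int:
  assumes "full_lattice V L" "Q.subspace U" "U \<subseteq> V" shows "full_lattice U (L \<inter> U)"
proof -
  obtain bs where bs: "V = qspan bs" "L = zspan bs" using assms(1) by (auto simp: full_lattice_iff)
  obtain xs ys where "q_indep (xs @ ys)" "zspan bs \<inter> U = zspan xs" "U = qspan xs"
    using adapted_basis[of U bs] assms(2,3) bs by blast
  then show ?thesis using q_indep_append(1)[of xs ys] bs unfolding full_lattice_iff by (intro exI[of _ xs]) simp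
qed

text \<open>In a basis adapted to W the part that spans W is replaced by one adapted to U within
  W.\<close>

lemma adapted_basis2:
  assumes "full_lattice V L" "Q.subspace U" "Q.subspace W" "U \<subseteq> W" "W \<subseteq> V"
  shows "\<exists>xs ys zs. q_indep (xs @ ys @ zs) \<and> L = zspan (xs @ ys @ zs) \<and> V = qspan (xs @ ys @ zs)
    \<and> L \<inter> U = zspan xs \<and> U = qspan xs \<and> L \<inter> W = zspan (xs @ ys) \<and> W = qspan (xs @ ys)"
proof -
  obtain bs where bs: "V = qspan bs" "L = zspan bs" using assms(1) by (auto simp: full_lattice_iff)
  obtain us zs where u: "q_indep (us @ zs)" "zspan (us @ zs) = L" "qspan (us @ zs) = V" "L \<inter> W = zspan us" "W = qspan us"
    using adapted_basis[of W bs] assms(3,5) bs by blast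
  obtain xs ys where x: "q_indep (xs @ ys)" "zspan (xs @ ys) = zspan us" "qspan (xs @ ys) = qspan us" "zspan us \<inter> U = zspan xs" "U = qspan xs"
    using adapted_basis[of U us] assms(2,4) u by blast
  have LU: "L \<inter> U = zspan xs" using u(4) x(4) assms(4) by blast
  have 1: "q_indep ((xs @ ys) @ zs)"
    using q_indep_appendI[OF x(1) q_indep_append(2)[OF u(1)]] q_indep_append(3)[OF u(1)] x(3) by simp
  have 2: "zspan ((xs @ ys) @ zs) = L" "qspan ((xs @ ys) @ zs) = V"
    using u(2,3) x(2,3) unfolding zspan_append[of "xs @ ys" zs] qspan_append[of "xs @ ys" zs] zspan_append[of us] qspan_append[of us] by simp_all
  show ?thesis
    by (rule exI[of _ xs], rule exI[of _ ys], rule exI[of _ zs])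
      (use 1 2 LU x(2,3,5) u(4,5) in simp)
qed

lemma direct_sum_append: assumes "q_indep (xs @ ys)" shows "direct_sum (qspan (xs @ ys)) (qspan xs) (qspan ys)"
  using q_indep_append[OF assms] by (simp add: direct_sum_def subspace_qspan qspan_append)

lemma zspan_Int_qspan: assumes "q_indep (xs @ ys)"
  shows "zspan (xs @ ys) \<inter> qspan xs = zspan xs" "zspan (xs @ ys) \<inter> qspan ys = zspan ys"
proof -
  note i = q_indep_append(3)[OF assms]
  have 1: "u = a \<and> v = b" if "u \<in> qspan xs" "v \<in> qspan ys" "a \<in> qspan xs" "b \<in> qspan ys" "u + v = a + b" for u v a b
  proof -
    have "u - a = b - v" using that(5) by (simp add: algebra_simps)
    then have "u - a \<in> qspan xs \<inter> qspan ys"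
      using Q.subspace_diff[OF subspace_qspan that(1,3)] Q.subspace_diff[OF subspace_qspan that(4,2)] by simp
    then show ?thesis using i \<open>u - a = b - v\<close> by auto
  qed
  have 0: "0 \<in> qspan xs" "0 \<in> qspan ys" "0 \<in> zspan xs" "0 \<in> zspan ys"
    using Q.subspace_0[OF subspace_qspan[of xs]] Q.subspace_0[OF subspace_qspan[of ys]]
      add_subgroup_0[OF add_subgroup_zspan[of xs]] add_subgroup_0[OF add_subgroup_zspan[of ys]] by auto
  note s = zspan_subset_qspan[of xs] zspan_subset_qspan[of ys]
  show "zspan (xs @ ys) \<inter> qspan xs = zspan xs"
  proof
    show "zspan (xs @ ys) \<inter> qspan xs \<subseteq> zspan xs"
    proof
      fix w assume w: "w \<in> zspan (xs @ ys) \<inter> qspan xs"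
      then obtain u v where uv: "u \<in> zspan xs" "v \<in> zspan ys" "w = u + v" unfolding zspan_append set_sum_def by blast
      then have "u = w" using 1[OF subsetD[OF s(1) uv(1)] subsetD[OF s(2) uv(2)] IntD2[OF w] 0(2)] uv(3) by simp
      then show "w \<in> zspan xs" using uv by simp
    qed
    have "w + 0 \<in> set_sum (zspan xs) (zspan ys)" if "w \<in> zspan xs" for w using that 0 unfolding set_sum_def by blast
    then show "zspan xs \<subseteq> zspan (xs @ ys) \<inter> qspan xs" using s by (auto simp: zspan_append)
  qed
  show "zspan (xs @ ys) \<inter> qspan ys = zspan ys"
  proof
    show "zspan (xs @ ys) \<inter> qspan ys \<subseteq> zspan ys"
    proof
      fix w assume w: "w \<in> zspan (xs @ ys) \<inter> qspan ys"
      then obtain u v where uv: "u \<in> zspan xs" "v \<in> zspan ys" "w = u + v" unfolding zspan_append set_sum_def by blast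
      then have "v = w" using 1[OF subsetD[OF s(1) uv(1)] subsetD[OF s(2) uv(2)] 0(1) IntD2[OF w]] uv(3) by simp
      then show "w \<in> zspan ys" using uv by simp
    qed
    have "0 + w \<in> set_sum (zspan xs) (zspan ys)" if "w \<in> zspan ys" for w using that 0 unfolding set_sum_def by blast
    then show "zspan ys \<subseteq> zspan (xs @ ys) \<inter> qspan ys" using s by (auto simp: zspan_append)
  qed
qed

text \<open>For a basis adapted to both subspaces, the last two blocks span a complement of
  \<open>V1\<close>, and the last block spans one of \<open>Vm\<close>.\<close>

lemma L_complements_nonempty:
  assumes "full_lattice V L" "Q.subspace V1" "Q.subspace Vm" "V1 \<subseteq> Vm" "Vm \<subseteq> V"
  shows "L_complements V L V1 Vm \<noteq> {}"
proof -
  obtain xs ys zs where b: "q_indep (xs @ ys @ zs)" "L = zspan (xs @ ys @ zs)" "V = qspan (xs @ ys @ zs)"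
    "L \<inter> V1 = zspan xs" "V1 = qspan xs" "L \<inter> Vm = zspan (xs @ ys)" "Vm = qspan (xs @ ys)"
    using adapted_basis2[OF assms] by blast
  have b': "q_indep ((xs @ ys) @ zs)" using b(1) by simp
  have 1: "direct_sum V V1 (qspan (ys @ zs))" using direct_sum_append[OF b(1)] b(3,5) by simp
  have 2: "direct_sum V Vm (qspan zs)" using direct_sum_append[OF b'] b(3,7) by simp
  have 3: "L \<inter> qspan (ys @ zs) = zspan (ys @ zs)" using zspan_Int_qspan(2)[OF b(1)] b(2) by simp
  have 4: "L \<inter> qspan zs = zspan zs" using zspan_Int_qspan(2)[OF b'] b(2) by simp
  have 5: "set_sum (L \<inter> V1) (L \<inter> qspan (ys @ zs)) = L" by (simp only: 3 b(4) zspan_append[symmetric] b(2)[symmetric])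
  have 6: "set_sum (L \<inter> Vm) (L \<inter> qspan zs) = L" by (simp only: 4 b(6) zspan_append[symmetric] b(2)[symmetric] append_assoc)
  have "qspan zs \<subseteq> qspan (ys @ zs)"
    using qspan_subset[OF subspace_qspan, of zs "ys @ zs"] set_qspan[of "ys @ zs"] by auto
  then have "(qspan (ys @ zs), qspan zs) \<in> L_complements V L V1 Vm"
    using 1 2 5 6 by (simp add: L_complements_def)
  then show ?thesis by blast
qed

section \<open>Hermite normal forms of square shape\<close>

text \<open>With as many rows as columns, the strictly increasing pivots must be 0, ..., k -
  1.\<close>

lemma hermite_normal_form_square:
  assumes "hermite_normal_form k ws" "length ws = k"
  shows "\<And>i j. i < j \<Longrightarrow> j < k \<Longrightarrow> ws ! j ! i = 0" and "\<And>j. j < k \<Longrightarrow> 0 < ws ! j ! j"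
proof -
  obtain p where p: "\<forall>j<k. p j < k" "\<forall>l j. l < j \<and> j < k \<longrightarrow> p l < p j"
    "\<forall>j<k. (\<forall>i<p j. ws ! j ! i = 0) \<and> 0 < ws ! j ! p j"
    using assms unfolding hermite_normal_form_def by blast
  have ge: "j \<le> p j" if "j < k" for j
    using that
  proof (induction j)
    case (Suc j)
    then have "j \<le> p j" "p j < p (Suc j)" using p(2) by auto
    then show ?case by simp
  qed simp
  \<comment> \<open>Counting down from the last pivot, which is at most k - 1.\<close>
  have le: "p (k - Suc m) \<le> k - Suc m" if "m < k" for m
    using that
  proof (induction m)
    case 0
    then show ?case using p(1)[rule_format, of "k - Suc 0"] by arith
  next
    case (Suc m)
    then have "p (k - Suc m) \<le> k - Suc m" by simp
    moreover have "p (k - Suc (Suc m)) < p (k - Suc m)" using Suc.prems p(2) by auto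
    ultimately show ?case by simp
  qed
  have id: "p j = j" if "j < k" for j
    using ge[OF that] le[of "k - Suc j"] that by simp
  show "\<And>i j. i < j \<Longrightarrow> j < k \<Longrightarrow> ws ! j ! i = 0" "\<And>j. j < k \<Longrightarrow> 0 < ws ! j ! j"
    using p(3) id by auto
qed

text \<open>In column i the later rows have entry 0 and the earlier ones coefficient 0.\<close>

lemma triangular_row_sum:
  fixes ws :: "int list list"
  assumes "\<And>i j. i < j \<Longrightarrow> j < k \<Longrightarrow> ws ! j ! i = 0" "i < k" "\<forall>j<i. c j = 0"
  shows "(\<Sum>j<k. c j * ws ! j ! i) = c i * ws ! i ! i"
proof -
  have "(\<Sum>j<k. c j * ws ! j ! i) = (\<Sum>j<k. if j = i then c i * ws ! i ! i else 0)"
  proof (rule sum.cong)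
    fix j assume "j \<in> {..<k}"
    then show "c j * ws ! j ! i = (if j = i then c i * ws ! i ! i else 0)"
      using assms(1)[of i j] assms(3) by (cases j i rule: linorder_cases) auto
  qed simp
  then show ?thesis using assms(2) by simp
qed

text \<open>The leading zeros of \<open>e\<close> force the corresponding coefficients to vanish one
  after the other, so \<open>e ! i\<close> is the next coefficient times the diagonal entry. This is
  the divisibility that \<open>T_chain_extension\<close> asks for.\<close>

lemma triangular_leading_dvd:
  assumes M: "int_basis k ws M" and ws: "length ws = k" "\<And>i j. i < j \<Longrightarrow> j < k \<Longrightarrow> ws ! j ! i = 0"
    "\<And>j. j < k \<Longrightarrow> 0 < ws ! j ! j" and e: "e \<in> M" "i < k" "\<forall>j<i. e ! j = 0"
  shows "ws ! i ! i dvd e ! i"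
proof -
  obtain c where c: "e = map (\<lambda>i. \<Sum>j<k. c j * ws ! j ! i) [0..<k]"
    using M e(1) ws(1) by (auto simp: int_basis_def)
  have c0: "c j = 0" if "j < i" for j
    using that
  proof (induction j rule: less_induct)
    case (less j)
    then have "e ! j = c j * ws ! j ! j" using e(2) c triangular_row_sum[OF ws(2), of k j c] by auto
    then show ?case using e less.prems ws(3)[of j] by auto
  qed
  then have "e ! i = c i * ws ! i ! i" using e(2) c triangular_row_sum[OF ws(2), of k i c] by auto
  then show ?thesis by simp
qed

text \<open>Among the elements with i leading zeros and a positive entry at i, one with the least
  such entry is taken as \<open>r i\<close>. Its entry \<open>d i\<close> divides the i-th entry of
  every element of M with i leading zeros. The entries to its right are then reduced modulo the
  later diagonal entries, from left to right, so that a reduction does not spoil the previous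
  ones.\<close>

lemma hermite_basis_exists:
  assumes len: "\<And>e. e \<in> M \<Longrightarrow> length e = k"
    and diff: "\<And>e f m. e \<in> M \<Longrightarrow> f \<in> M \<Longrightarrow> map (\<lambda>i. e ! i - m * f ! i) [0..<k] \<in> M"
    and rank: "\<And>i. i < k \<Longrightarrow> \<exists>e\<in>M. (\<forall>l<i. e ! l = 0) \<and> 0 < e ! i" and z: "replicate k 0 \<in> M"
  shows "\<exists>ws. length ws = k \<and> hermite_normal_form k ws \<and> int_basis k ws M"
proof -
  let ?P = "\<lambda>i e. e \<in> M \<and> (\<forall>l<i. e ! l = 0) \<and> 0 < e ! i"
  define r where "r i = (ARG_MIN (\<lambda>e. nat (e ! i)) e. ?P i e)" for i
  have r: "?P i (r i)" if ik: "i < k" for i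
  proof -
    obtain e where "?P i e" using rank[OF ik] by auto
    then show ?thesis unfolding r_def by (rule arg_min_natI)
  qed
  have rmin: "r i ! i \<le> e ! i" if "i < k" "?P i e" for i e
  proof -
    have "nat (r i ! i) \<le> nat (e ! i)"
      unfolding r_def by (rule arg_min_nat_le[of "?P i" e "\<lambda>e. nat (e ! i)"]) (use that in auto)
    then show ?thesis using that(2) by (simp add: nat_le_eq_zle)
  qed
  define d where "d i = r i ! i" for i
  have dpos: "0 < d i" if "i < k" for i using r[OF that] by (simp add: d_def)
  have dvd: "d i dvd e ! i" if i: "i < k" and e: "e \<in> M" "\<forall>l<i. e ! l = 0" for i e
  proof -
    \<comment> \<open>The entry of this element at i is the remainder modulo \<open>d i\<close>;
      were it positive, it would contradict the minimality of \<open>d i\<close>.\<close>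
    let ?e = "map (\<lambda>j. e ! j - (e ! i div d i) * r i ! j) [0..<k]"
    have eM: "?e \<in> M" using diff[OF e(1)] r[OF i] by blast
    have ei: "?e ! i = e ! i mod d i" using i by (simp add: d_def minus_div_mult_eq_mod)
    have l0: "\<forall>l<i. ?e ! l = 0" using i e(2) r[OF i] by auto
    have ge: "0 \<le> ?e ! i" and lt: "?e ! i < d i" using dpos[OF i] unfolding ei by auto
    have "\<not> 0 < ?e ! i"
    proof
      assume "0 < ?e ! i"
      then have "d i \<le> ?e ! i" using rmin[OF i, of ?e] eM l0 unfolding d_def by blast
      then show False using lt by linarith
    qed
    then have "?e ! i = 0" using ge by linarith
    then show ?thesis unfolding ei by auto
  qed
  have red: "\<exists>e\<in>M. (\<forall>l<i. e ! l = 0) \<and> e ! i = d i \<and> (\<forall>j. i < j \<and> j < t \<longrightarrow> 0 \<le> e ! j \<and> e ! j < d j)"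
    if i: "i < k" and t: "t \<le> k" for i t
    using t
  proof (induction t)
    case 0
    show ?case using r[OF i] by (auto simp: d_def)
  next
    case (Suc t)
    then obtain e where e: "e \<in> M" "\<forall>l<i. e ! l = 0" "e ! i = d i" "\<forall>j. i < j \<and> j < t \<longrightarrow> 0 \<le> e ! j \<and> e ! j < d j"
      by auto
    show ?case
    proof (cases "i < t")
      case False
      then show ?thesis using e by (intro bexI[of _ e]) auto
    next
      case True
      have tk: "t < k" using Suc.prems by simp
      let ?e = "map (\<lambda>j. e ! j - (e ! t div d t) * r t ! j) [0..<k]"
      have lt: "?e ! j = e ! j" if "j < t" for j using that tk r[OF tk] by auto
      have et: "?e ! t = e ! t mod d t" using tk by (simp add: d_def minus_div_mult_eq_mod)
      have "?e \<in> M" using diff[OF e(1)] r[OF tk] by blast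
      moreover have "0 \<le> ?e ! t \<and> ?e ! t < d t" unfolding et using dpos[OF tk] by simp
      ultimately show ?thesis using e True lt by (intro bexI[of _ ?e]) (auto simp: less_Suc_eq)
    qed
  qed
  have "\<forall>i. \<exists>e. i < k \<longrightarrow> e \<in> M \<and> (\<forall>l<i. e ! l = 0) \<and> e ! i = d i \<and> (\<forall>j. i < j \<and> j < k \<longrightarrow> 0 \<le> e ! j \<and> e ! j < d j)"
    using red[OF _ order_refl] by blast
  from choice[OF this] obtain w where w': "\<forall>i. i < k \<longrightarrow> w i \<in> M \<and> (\<forall>l<i. w i ! l = 0) \<and> w i ! i = d i \<and> (\<forall>j. i < j \<and> j < k \<longrightarrow> 0 \<le> w i ! j \<and> w i ! j < d j)" ..
  have w: "w i \<in> M \<and> (\<forall>l<i. w i ! l = 0) \<and> w i ! i = d i \<and> (\<forall>j. i < j \<and> j < k \<longrightarrow> 0 \<le> w i ! j \<and> w i ! j < d j)"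
    if "i < k" for i
    by (rule mp[OF spec[OF w'] that])
  define ws where "ws = map w [0..<k]"
  have lws: "length ws = k" and wsn: "\<And>i. i < k \<Longrightarrow> ws ! i = w i" by (simp_all add: ws_def)
  have hnf: "hermite_normal_form k ws"
    unfolding hermite_normal_form_def by (rule exI[of _ id]) (auto simp: lws wsn w dpos)
  have tri: "\<And>i j. i < j \<Longrightarrow> j < k \<Longrightarrow> ws ! j ! i = 0" using wsn w by simp
  have pos: "\<And>j. j < k \<Longrightarrow> 0 < ws ! j ! j" using wsn w dpos by simp
  have "int_basis k ws M"
    unfolding int_basis_def
  proof (intro conjI)
    show "\<forall>w\<in>set ws. length w = k" using len w by (auto simp: ws_def)
    show "\<forall>c. (\<forall>i<k. (\<Sum>j<length ws. c j * ws ! j ! i) = 0) \<longrightarrow> (\<forall>j<length ws. c j = 0)"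
    proof (intro allI impI)
      fix c j assume c: "\<forall>i<k. (\<Sum>j<length ws. c j * ws ! j ! i) = 0" and "j < length ws"
      then have "j < k" using lws by simp
      then show "c j = 0"
      proof (induction j rule: less_induct)
        case (less j)
        then have "c j * ws ! j ! j = 0" using triangular_row_sum[OF tri, of k j c] c lws by auto
        then show ?case using pos[OF less.prems] by simp
      qed
    qed
    let ?v = "\<lambda>c. map (\<lambda>i. \<Sum>j<length ws. c j * ws ! j ! i) [0..<k]"
    have "?v c \<in> M" for c
    proof -
      have "map (\<lambda>i. \<Sum>j<t. c j * ws ! j ! i) [0..<k] \<in> M" if "t \<le> k" for t
        using that
      proof (induction t)
        case 0
        then show ?case using z by (simp add: map_replicate_const)
      next
        case (Suc t)
        have "map (\<lambda>i. map (\<lambda>i. \<Sum>j<t. c j * ws ! j ! i) [0..<k] ! i - (- c t) * ws ! t ! i) [0..<k] \<in> M"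
          by (rule diff) (use Suc wsn w in auto)
        moreover have "map (\<lambda>i. map (\<lambda>i. \<Sum>j<t. c j * ws ! j ! i) [0..<k] ! i - (- c t) * ws ! t ! i) [0..<k]
           = map (\<lambda>i. \<Sum>j<Suc t. c j * ws ! j ! i) [0..<k]" by simp
        ultimately show ?case by (simp only:)
      qed
      then show ?thesis using lws by simp
    qed
    moreover have "e \<in> range ?v" if e: "e \<in> M" for e
    proof -
      \<comment> \<open>Elimination column by column: the remainder stays in M and has t leading
        zeros, so \<open>dvd\<close> supplies the next coefficient.\<close>
      have "\<exists>c. map (\<lambda>i. e ! i - (\<Sum>j<t. c j * ws ! j ! i)) [0..<k] \<in> M \<and> (\<forall>i<t. e ! i = (\<Sum>j<t. c j * ws ! j ! i))"
        if "t \<le> k" for t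
        using that
      proof (induction t)
        case 0
        have "map (\<lambda>i. e ! i) [0..<k] = e" using len[OF e] by (auto intro: nth_equalityI)
        then show ?case using e by simp
      next
        case (Suc t)
        then obtain c where c: "map (\<lambda>i. e ! i - (\<Sum>j<t. c j * ws ! j ! i)) [0..<k] \<in> M"
          "\<forall>i<t. e ! i = (\<Sum>j<t. c j * ws ! j ! i)" by auto
        have tk: "t < k" using Suc.prems by simp
        let ?f = "map (\<lambda>i. e ! i - (\<Sum>j<t. c j * ws ! j ! i)) [0..<k]"
        have "d t dvd ?f ! t" by (rule dvd[OF tk c(1)]) (use c(2) tk in auto)
        then obtain m where m: "e ! t - (\<Sum>j<t. c j * ws ! j ! t) = d t * m" using tk by (auto simp: dvd_def)
        define c' where "c' = c(t := m)"
        have c': "(\<Sum>j<Suc t. c' j * ws ! j ! i) = (\<Sum>j<t. c j * ws ! j ! i) + m * ws ! t ! i" for i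
          by (simp add: c'_def)
        have "map (\<lambda>i. ?f ! i - m * ws ! t ! i) [0..<k] \<in> M" by (rule diff[OF c(1)]) (use wsn w tk in auto)
        moreover have "map (\<lambda>i. ?f ! i - m * ws ! t ! i) [0..<k] = map (\<lambda>i. e ! i - (\<Sum>j<Suc t. c' j * ws ! j ! i)) [0..<k]"
          unfolding c' by simp
        moreover have "e ! i = (\<Sum>j<Suc t. c' j * ws ! j ! i)" if "i < Suc t" for i
          unfolding c' using that m c(2) tri[of i t] tk w[OF tk] wsn[OF tk] by (auto simp: less_Suc_eq algebra_simps)
        ultimately show ?case by (intro exI[of _ c']) auto
      qed
      from this[OF order_refl] obtain c where "\<forall>i<k. e ! i = (\<Sum>j<k. c j * ws ! j ! i)" by auto
      then have "e = ?v c" using len[OF e] lws by (intro nth_equalityI) auto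
      then show ?thesis by blast
    qed
    ultimately show "M = range ?v" by blast
  qed
  then show ?thesis using hnf lws by blast
qed

section \<open>Central chains with coordinates\<close>

text \<open>The coordinate \<open>\<chi> i\<close> identifies the factor of \<open>A i\<close> by \<open>A (i + 1)\<close> with the integers.\<close>

definition T_chain :: "('a, 'b) monoid_scheme \<Rightarrow> 'a set \<Rightarrow> 'a list \<Rightarrow> (nat \<Rightarrow> 'a set) \<Rightarrow> (nat \<Rightarrow> 'a \<Rightarrow> int) \<Rightarrow> bool" where
  "T_chain G S gs A \<chi> \<longleftrightarrow> A 0 = S \<and> A (length gs) = {\<one>\<^bsub>G\<^esub>} \<and> (\<forall>i\<le>length gs. subgroup (A i) G)
    \<and> (\<forall>i<length gs. gs ! i \<in> A i \<and> \<chi> i (gs ! i) = 1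
         \<and> (\<forall>x\<in>A i. \<forall>y\<in>A i. \<chi> i (x \<otimes>\<^bsub>G\<^esub> y) = \<chi> i x + \<chi> i y)
         \<and> A (Suc i) = {x\<in>A i. \<chi> i x = 0}
         \<and> (\<forall>h\<in>S. \<forall>x\<in>A i. inv\<^bsub>G\<^esub> h \<otimes>\<^bsub>G\<^esub> inv\<^bsub>G\<^esub> x \<otimes>\<^bsub>G\<^esub> h \<otimes>\<^bsub>G\<^esub> x \<in> A (Suc i)))"

lemma T_chainD: assumes "T_chain G S gs A \<chi>"
  shows "A 0 = S" "A (length gs) = {\<one>\<^bsub>G\<^esub>}" "i \<le> length gs \<Longrightarrow> subgroup (A i) G"
    "i < length gs \<Longrightarrow> gs ! i \<in> A i" "i < length gs \<Longrightarrow> \<chi> i (gs ! i) = 1"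
    "i < length gs \<Longrightarrow> x \<in> A i \<Longrightarrow> y \<in> A i \<Longrightarrow> \<chi> i (x \<otimes>\<^bsub>G\<^esub> y) = \<chi> i x + \<chi> i y"
    "i < length gs \<Longrightarrow> A (Suc i) = {x\<in>A i. \<chi> i x = 0}"
    "i < length gs \<Longrightarrow> h \<in> S \<Longrightarrow> x \<in> A i \<Longrightarrow> inv\<^bsub>G\<^esub> h \<otimes>\<^bsub>G\<^esub> inv\<^bsub>G\<^esub> x \<otimes>\<^bsub>G\<^esub> h \<otimes>\<^bsub>G\<^esub> x \<in> A (Suc i)"
  using assms by (auto simp: T_chain_def)

lemma (in group) int_pow_subgroup: assumes "subgroup A G" "x \<in> A" shows "x [^] (m::int) \<in> A"
  using group.int_pow_closed[OF subgroup_imp_group[OF assms(1)], of x m] int_pow_consistent[OF assms, of m] assms by simp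

lemma (in group) additive_int_pow:
  fixes \<chi> :: "'a \<Rightarrow> int"
  assumes A: "subgroup A G" and add: "\<And>x y. x \<in> A \<Longrightarrow> y \<in> A \<Longrightarrow> \<chi> (x \<otimes> y) = \<chi> x + \<chi> y" and x: "x \<in> A"
  shows "\<chi> (x [^] (m::int)) = m * \<chi> x"
proof -
  interpret A: subgroup A G by fact
  have 1: "\<chi> \<one> = 0" using add[of \<one> \<one>] by simp
  have xc: "x \<in> carrier G" using x by simp
  have n: "x [^] n \<in> A \<and> \<chi> (x [^] n) = int n * \<chi> x" for n :: nat
    by (induction n) (auto simp: 1 add x algebra_simps)
  show ?thesis
  proof (cases m)
    case (nonneg n)
    then show ?thesis using n by (simp add: int_pow_int)
  next
    case (neg n)
    have "\<chi> (inv (x [^] Suc n) \<otimes> x [^] Suc n) = \<chi> (inv (x [^] Suc n)) + \<chi> (x [^] Suc n)"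
      by (rule add) (use n[of "Suc n"] in auto)
    then have "\<chi> (inv (x [^] Suc n)) = - (int (Suc n) * \<chi> x)" using n[of "Suc n"] xc 1 by (simp del: nat_pow_Suc)
    then show ?thesis using neg xc by (simp add: int_pow_neg_int del: nat_pow_Suc of_nat_Suc)
  qed
qed

lemma (in group) T_chain_antimono: assumes "T_chain G S gs A \<chi>" "i \<le> j" "j \<le> length gs" shows "A j \<subseteq> A i"
  using assms(2,3)
proof (induction j rule: dec_induct)
  case (step j)
  then show ?case using T_chainD(7)[OF assms(1), of j] by auto
qed simp

text \<open>Cancelling the power of \<open>gs ! i\<close> prescribed by the coordinate leaves an
  element of coordinate 0.\<close>

lemma (in group) T_chain_split:
  assumes c: "T_chain G S gs A \<chi>" and i: "i < length gs" and x: "x \<in> A i"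
  obtains y where "y \<in> A (Suc i)" "x = gs ! i [^] \<chi> i x \<otimes> y"
proof -
  interpret A: subgroup "A i" G using T_chainD(3)[OF c] i by simp
  note g = T_chainD(4)[OF c i]
  let ?g = "gs ! i [^] \<chi> i x" let ?g' = "gs ! i [^] (- \<chi> i x)"
  have p: "gs ! i [^] m \<in> A i" "\<chi> i (gs ! i [^] m) = m" for m :: int
    using int_pow_subgroup[OF A.subgroup_axioms g] additive_int_pow[OF A.subgroup_axioms T_chainD(6)[OF c i] g]
      T_chainD(5)[OF c i] by auto
  have "?g' \<otimes> x \<in> A (Suc i)"
    using p x T_chainD(6)[OF c i p(1) x] by (simp add: T_chainD(7)[OF c i])
  moreover have "x = ?g \<otimes> (?g' \<otimes> x)"
    using g x A.subset by (simp add: m_assoc[symmetric] int_pow_mult[symmetric] subset_iff)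
  ultimately show ?thesis by (rule that)
qed

text \<open>By descending induction from the trivial group, since \<open>T_chain_split\<close>
  generates \<open>A i\<close> by \<open>gs ! i\<close> and \<open>A (Suc i)\<close>.\<close>

lemma (in group) T_chain_generate:
  assumes c: "T_chain G S gs A \<chi>" and i: "i \<le> length gs"
  shows "generate G (set (drop i gs)) = A i"
  using i
proof (induction i rule: inc_induct)
  case base
  show ?case using T_chainD(2)[OF c] by (simp add: generate_empty)
next
  case (step i)
  interpret A: subgroup "A i" G using T_chainD(3)[OF c] step by simp
  have i: "i < length gs" using step by simp
  have d: "drop i gs = gs ! i # drop (Suc i) gs" using i by (simp add: Cons_nth_drop_Suc)
  have sub: "A (Suc i) \<subseteq> A i" using T_chain_antimono[OF c, of i "Suc i"] i by simp
  have g: "gs ! i \<in> A i" using T_chainD(4)[OF c i] .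
  have dA: "set (drop i gs) \<subseteq> A i"
    using g sub generate.incl[of _ "set (drop (Suc i) gs)" G] step.IH unfolding d by auto
  then have dC: "set (drop i gs) \<subseteq> carrier G" using A.subset by blast
  have gen: "subgroup (generate G (set (drop i gs))) G" by (rule generate_is_subgroup[OF dC])
  show ?case
  proof
    show "generate G (set (drop i gs)) \<subseteq> A i" by (rule generate_subgroup_incl[OF dA A.subgroup_axioms])
    show "A i \<subseteq> generate G (set (drop i gs))"
    proof
      fix x assume "x \<in> A i"
      then obtain y where y: "y \<in> A (Suc i)" "x = gs ! i [^] \<chi> i x \<otimes> y" using T_chain_split[OF c i] by blast
      have "generate G (set (drop (Suc i) gs)) \<subseteq> generate G (set (drop i gs))"
        by (rule mono_generate) (auto simp: d)
      then have "y \<in> generate G (set (drop i gs))" using y(1) step.IH by auto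
      moreover have "gs ! i \<in> generate G (set (drop i gs))" by (rule generate.incl) (simp add: d)
      ultimately have "gs ! i [^] \<chi> i x \<otimes> y \<in> generate G (set (drop i gs))"
        by (intro subgroup.m_closed[OF gen] int_pow_subgroup[OF gen])
      then show "x \<in> generate G (set (drop i gs))" by (subst y(2))
    qed
  qed
qed

text \<open>\<open>A i\<close> is normal because it contains its commutators with S, which even lie
  in \<open>A (Suc i)\<close>. The factor is infinite cyclic by the isomorphism theorem for
  \<open>\<chi> i\<close>, which is onto because \<open>gs ! i\<close> has coordinate 1.\<close>

lemma (in group) T_chain_T_sequence:
  assumes S: "subgroup S G" and c: "T_chain G S gs A \<chi>"
  shows "T_sequence (G\<lparr>carrier := S\<rparr>) gs"
proof -
  let ?H = "G\<lparr>carrier := S\<rparr>"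
  interpret S: subgroup S G by fact
  interpret H: group ?H by (rule subgroup_imp_group[OF S])
  have AS: "A i \<subseteq> S" if "i \<le> length gs" for i using T_chain_antimono[OF c, of 0 i] that T_chainD(1)[OF c] by simp
  have inv: "inv\<^bsub>?H\<^esub> h = inv h" if "h \<in> S" for h using m_inv_consistent[OF S that] .
  have gs: "set gs \<subseteq> S" using AS[OF less_imp_le] T_chainD(4)[OF c] unfolding set_conv_nth by auto
  have gen: "generate ?H (set (drop i gs)) = A i" if "i \<le> length gs" for i
  proof -
    have "set (drop i gs) \<subseteq> S" using gs set_drop_subset[of i gs] by blast
    then show ?thesis using generate_consistent[OF _ S] T_chain_generate[OF c that] by simp
  qed
  have nor: "A i \<lhd> ?H" if i: "i \<le> length gs" for i
    unfolding H.normal_inv_iff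
  proof (intro conjI ballI)
    interpret A: subgroup "A i" G using T_chainD(3)[OF c i] .
    show "subgroup (A i) ?H" by (rule subgroup_incl[OF A.subgroup_axioms S AS[OF i]])
    fix h x assume h: "h \<in> carrier ?H" and x: "x \<in> A i"
    then have hS: "h \<in> S" by simp
    have "h \<otimes> x \<otimes> inv h \<in> A i"
    proof (cases "i = length gs")
      case True
      then show ?thesis using x T_chainD(2)[OF c] hS by simp
    next
      case False
      then have i': "i < length gs" using i by simp
      \<comment> \<open>The commutator condition for the inverses of h and x is about the element h
        x h^-1 x^-1, which differs from the conjugate of x by a factor in
        \<open>A i\<close>.\<close>
      have "inv (inv h) \<otimes> inv (inv x) \<otimes> inv h \<otimes> inv x \<in> A (Suc i)"
        by (rule T_chainD(8)[OF c i']) (use hS x in auto)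
      then have "h \<otimes> x \<otimes> inv h \<otimes> inv x \<in> A i"
        using T_chain_antimono[OF c, of i "Suc i"] i' hS x by auto
      then have "h \<otimes> x \<otimes> inv h \<otimes> inv x \<otimes> x \<in> A i" using x by simp
      then show ?thesis using hS x by (simp add: m_assoc)
    qed
    then show "h \<otimes>\<^bsub>?H\<^esub> x \<otimes>\<^bsub>?H\<^esub> inv\<^bsub>?H\<^esub> h \<in> A i" using inv[OF hS] by simp
  qed
  have step: "A (i + 1) \<subset> A i \<and> (\<forall>h\<in>S. \<forall>x\<in>A i. inv\<^bsub>?H\<^esub> h \<otimes>\<^bsub>?H\<^esub> inv\<^bsub>?H\<^esub> x \<otimes>\<^bsub>?H\<^esub> h \<otimes>\<^bsub>?H\<^esub> x \<in> A (i + 1))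
      \<and> ((?H\<lparr>carrier := A i\<rparr>) Mod A (i + 1)) \<cong> integer_group" if i: "i < length gs" for i
  proof (intro conjI ballI)
    interpret A: subgroup "A i" G using T_chainD(3)[OF c] i by simp
    note ch = T_chainD(4-7)[OF c i]
    have "gs ! i \<notin> A (i + 1)" using ch(2,4) by simp
    then show "A (i + 1) \<subset> A i" using ch(1,4) by auto
    show "inv\<^bsub>?H\<^esub> h \<otimes>\<^bsub>?H\<^esub> inv\<^bsub>?H\<^esub> x \<otimes>\<^bsub>?H\<^esub> h \<otimes>\<^bsub>?H\<^esub> x \<in> A (i + 1)" if "h \<in> S" "x \<in> A i" for h x
      using T_chainD(8)[OF c i that] inv[OF that(1)] inv[of x] AS[of i] i that by auto
    let ?K = "G\<lparr>carrier := A i\<rparr>"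
    interpret hom: group_hom ?K integer_group "\<chi> i"
      by (rule group_hom.intro[OF subgroup_imp_group[OF A.subgroup_axioms]])
        (auto simp: group_hom_axioms_def hom_def ch)
    have m: "\<chi> i (gs ! i [^] m) = m" for m :: int
      using additive_int_pow[OF A.subgroup_axioms ch(3) ch(1)] ch(2) by simp
    have "m \<in> \<chi> i ` A i" for m
      by (rule image_eqI[where x = "gs ! i [^] m"]) (simp_all add: m int_pow_subgroup[OF A.subgroup_axioms ch(1)])
    then have "\<chi> i ` carrier ?K = carrier integer_group" by auto
    then have "?K Mod (kernel ?K integer_group (\<chi> i)) \<cong> integer_group" by (rule hom.FactGroup_iso)
    moreover have "kernel ?K integer_group (\<chi> i) = A (i + 1)" using ch(4) by (simp add: kernel_def)
    ultimately show "((?H\<lparr>carrier := A i\<rparr>) Mod A (i + 1)) \<cong> integer_group" by simp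
  qed
  show ?thesis
    unfolding T_sequence_def Let_def
  proof (intro conjI allI impI)
    show "generate ?H (set (drop 0 gs)) = carrier ?H" using gen[of 0] T_chainD(1)[OF c] by simp
  next
    fix i assume "i \<le> length gs"
    then show "generate ?H (set (drop i gs)) \<lhd> ?H" using gen nor by simp
  next
    fix i assume i: "i < length gs"
    have g: "generate ?H (set (drop i gs)) = A i" "generate ?H (set (drop (i + 1) gs)) = A (i + 1)"
      using gen[of i] gen[of "i + 1"] i by auto
    show "generate ?H (set (drop (i + 1) gs)) \<subset> generate ?H (set (drop i gs))"
      "\<forall>h\<in>carrier ?H. \<forall>x\<in>generate ?H (set (drop i gs)).
        inv\<^bsub>?H\<^esub> h \<otimes>\<^bsub>?H\<^esub> inv\<^bsub>?H\<^esub> x \<otimes>\<^bsub>?H\<^esub> h \<otimes>\<^bsub>?H\<^esub> x \<in> generate ?H (set (drop (i + 1) gs))"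
      "?H\<lparr>carrier := generate ?H (set (drop i gs))\<rparr> Mod generate ?H (set (drop (i + 1) gs)) \<cong> integer_group"
      unfolding g using step[OF i] by auto
  qed (use gs H.is_group in auto)
qed

section \<open>Products of powers and normal forms\<close>

lemma (in group) power_product_simps:
  "power_product G [] es = \<one>"
  "power_product G (g # gs) (e # es) = g [^] e \<otimes> power_product G gs es"
  by (simp_all add: power_product_def)

text \<open>The product of the later powers lies in \<open>A (Suc i)\<close>, where
  \<open>\<chi> i\<close> vanishes, so the coordinate sees only the leading exponent.\<close>

lemma (in group) power_product_drop:
  assumes c: "T_chain G S gs A \<chi>" and e: "length e = length gs" and i: "i \<le> length gs"
  shows "power_product G (drop i gs) (drop i e) \<in> A i"
    "i < length gs \<Longrightarrow> \<chi> i (power_product G (drop i gs) (drop i e)) = e ! i"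
proof -
  have st: "power_product G (drop i gs) (drop i e) = gs ! i [^] (e ! i) \<otimes> power_product G (drop (Suc i) gs) (drop (Suc i) e)"
    if "i < length gs" for i
    using that e by (simp add: Cons_nth_drop_Suc[symmetric] power_product_simps)
  have in_A: "power_product G (drop i gs) (drop i e) \<in> A i" if "i \<le> length gs" for i
    using that
  proof (induction i rule: inc_induct)
    case base
    show ?case using T_chainD(2)[OF c] e by (simp add: power_product_simps)
  next
    case (step i)
    have sg: "subgroup (A i) G" using T_chainD(3)[OF c] step by simp
    have "A (Suc i) \<subseteq> A i" using T_chain_antimono[OF c, of i "Suc i"] step by simp
    then show ?case using st[of i] step int_pow_subgroup[OF sg T_chainD(4)[OF c]] subgroup.m_closed[OF sg] by auto
  qed
  then show "power_product G (drop i gs) (drop i e) \<in> A i" using i .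
  show "\<chi> i (power_product G (drop i gs) (drop i e)) = e ! i" if il: "i < length gs"
  proof -
    have sg: "subgroup (A i) G" using T_chainD(3)[OF c] i by simp
    note ch = T_chainD(4-7)[OF c il]
    have p: "gs ! i [^] m \<in> A i" "\<chi> i (gs ! i [^] m) = m" for m :: int
      using int_pow_subgroup[OF sg ch(1)] additive_int_pow[OF sg ch(3) ch(1)] ch(2) by auto
    have "power_product G (drop (Suc i) gs) (drop (Suc i) e) \<in> {x \<in> A i. \<chi> i x = 0}"
      using in_A[of "Suc i"] il ch(4) by simp
    then show ?thesis unfolding st[OF il] using ch(3)[OF p(1)] p(2) by simp
  qed
qed

lemma (in group) power_product_leading_zeros:
  assumes "set gs \<subseteq> carrier G" "length e = length gs" "i \<le> length gs" "\<forall>j<i. e ! j = 0"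
  shows "power_product G gs e = power_product G (drop i gs) (drop i e)"
  using assms
proof (induction gs arbitrary: e i)
  case (Cons g gs)
  have cl: "power_product G gs' e' \<in> carrier G" if "set gs' \<subseteq> carrier G" "length e' = length gs'" for gs' e'
    using that
  proof (induction gs' arbitrary: e')
    case (Cons a as) then show ?case by (cases e') (auto simp: power_product_simps)
  qed (simp add: power_product_simps)
  obtain a e' where e: "e = a # e'" using Cons.prems by (cases e) auto
  show ?case
  proof (cases i)
    case (Suc i')
    have "a = 0" using Cons.prems(4) e Suc by auto
    moreover have "power_product G gs e' = power_product G (drop i' gs) (drop i' e')"
      using Cons.prems e Suc by (intro Cons.IH) auto
    ultimately show ?thesis using cl[of gs e'] Cons.prems e Suc by (simp add: power_product_simps)
  qed simp
qed simp

text \<open>The exponents are the coordinates of the successive remainders in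
  \<open>T_chain_split\<close>. Zeros in front give exponent vectors of full length, as they occur
  in the relation lattice.\<close>

lemma (in group) T_chain_normal_form:
  assumes c: "T_chain G S gs A \<chi>" and i: "i \<le> length gs" and x: "x \<in> A i"
  shows "\<exists>e. length e = length gs \<and> (\<forall>j<i. e ! j = 0) \<and> x = power_product G (drop i gs) (drop i e)"
  using i x
proof (induction i arbitrary: x rule: inc_induct)
  case base
  then show ?case using T_chainD(2)[OF c] by (intro exI[of _ "replicate (length gs) 0"]) (auto simp: power_product_simps)
next
  case (step i)
  then have il: "i < length gs" by simp
  obtain y where y: "y \<in> A (Suc i)" "x = gs ! i [^] \<chi> i x \<otimes> y" using T_chain_split[OF c il step.prems] .
  obtain e where e: "length e = length gs" "\<forall>j<Suc i. e ! j = 0" "y = power_product G (drop (Suc i) gs) (drop (Suc i) e)"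
    using step.IH[OF y(1)] by auto
  let ?e = "e[i := \<chi> i x]"
  have "drop i ?e = \<chi> i x # drop (Suc i) e" using il e(1) by (simp add: Cons_nth_drop_Suc[symmetric])
  then have "power_product G (drop i gs) (drop i ?e) = gs ! i [^] \<chi> i x \<otimes> y"
    using il e(3) by (simp add: Cons_nth_drop_Suc[symmetric] power_product_simps)
  then show ?case using y(2) e by (intro exI[of _ ?e]) auto
qed

text \<open>The chain of preimages of the \<open>A i\<close> ends in the kernel N and is continued
  by the chain of N. On the preimage of \<open>A i\<close> the coordinate of the image takes only
  multiples of \<open>d i\<close> and takes the value \<open>d i\<close> at \<open>gs ! i\<close>;
  division by \<open>d i\<close> therefore gives an additive coordinate with value 1 there.
  Commutators with N are trivial because N is central.\<close>

lemma T_chain_extension: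
  fixes G :: "('a, 'b) monoid_scheme" and G' :: "('c, 'd) monoid_scheme"
  assumes G: "group G" and G': "group G'" and S: "subgroup S G"
    and c: "T_chain G' S' qs A \<chi>" and len: "length gs = length qs"
    and \<pi>: "\<And>x. x \<in> S \<Longrightarrow> \<pi> x \<in> S'" "\<And>x y. x \<in> S \<Longrightarrow> y \<in> S \<Longrightarrow> \<pi> (x \<otimes>\<^bsub>G\<^esub> y) = \<pi> x \<otimes>\<^bsub>G'\<^esub> \<pi> y"
    and d: "\<And>i x. i < length qs \<Longrightarrow> x \<in> S \<Longrightarrow> \<pi> x \<in> A i \<Longrightarrow> d i dvd \<chi> i (\<pi> x)"
    and g: "\<And>i. i < length qs \<Longrightarrow> gs ! i \<in> S \<and> \<pi> (gs ! i) \<in> A i \<and> \<chi> i (\<pi> (gs ! i)) = d i \<and> 0 < d i"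
    and cB: "T_chain G N ns B \<psi>" and N: "N = {x\<in>S. \<pi> x = \<one>\<^bsub>G'\<^esub>}"
    and cen: "\<And>h x. h \<in> S \<Longrightarrow> x \<in> N \<Longrightarrow> h \<otimes>\<^bsub>G\<^esub> x = x \<otimes>\<^bsub>G\<^esub> h"
  shows "\<exists>A \<chi>. T_chain G S (gs @ ns) A \<chi>"
proof -
  interpret G: group G by fact
  interpret G': group G' by fact
  interpret S: subgroup S G by fact
  let ?k = "length qs"
  \<comment> \<open>The two chains are joined at index \<open>?k\<close>, where the preimage of the
    trivial group is N, the same as \<open>B 0\<close>.\<close>
  define A' where "A' i = (if i \<le> ?k then {x\<in>S. \<pi> x \<in> A i} else B (i - ?k))" for i
  define \<chi>' where "\<chi>' i = (if i < ?k then (\<lambda>x. \<chi> i (\<pi> x) div d i) else \<psi> (i - ?k))" for i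
  have S'A: "S' = A 0" using T_chainD(1)[OF c] by simp
  have S': "subgroup S' G'" using T_chainD(3)[OF c, of 0] S'A by simp
  have \<pi>c: "\<pi> x \<in> carrier G'" if "x \<in> S" for x using \<pi>(1)[OF that] subgroup.subset[OF S'] by auto
  have \<pi>1: "\<pi> \<one>\<^bsub>G\<^esub> = \<one>\<^bsub>G'\<^esub>"
    using \<pi>(2)[of "\<one>\<^bsub>G\<^esub>" "\<one>\<^bsub>G\<^esub>"] \<pi>c[of "\<one>\<^bsub>G\<^esub>"] G'.l_cancel_one' by (simp add: eq_commute)
  have \<pi>inv: "\<pi> (inv\<^bsub>G\<^esub> x) = inv\<^bsub>G'\<^esub> (\<pi> x)" if "x \<in> S" for x
    using \<pi>(2)[of "inv\<^bsub>G\<^esub> x" x] that \<pi>c \<pi>1 by (intro G'.inv_equality[symmetric]) auto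
  have N': "A' ?k = N" using N T_chainD(2)[OF c] by (simp add: A'_def)
  have B0: "B 0 = N" using T_chainD(1)[OF cB] .
  have A'B: "A' (?k + j) = B j" for j using N' B0 by (cases j) (auto simp: A'_def)
  have BN: "B j \<subseteq> N" if "j \<le> length ns" for j using G.T_chain_antimono[OF cB, of 0 j] B0 that by simp
  have "T_chain G S (gs @ ns) A' \<chi>'"
    unfolding T_chain_def
  proof (intro conjI allI impI)
    show "A' 0 = S" using \<pi>(1) S'A by (auto simp: A'_def)
    show "A' (length (gs @ ns)) = {\<one>\<^bsub>G\<^esub>}" using A'B[of "length ns"] T_chainD(2)[OF cB] len by simp
    show "subgroup (A' i) G" if i: "i \<le> length (gs @ ns)" for i
    proof (cases "i \<le> ?k")
      case True
      interpret Ai: subgroup "A i" G' using T_chainD(3)[OF c True] .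
      show ?thesis using True by (intro G.subgroupI) (auto simp: A'_def \<pi> \<pi>1 \<pi>inv intro!: exI[of _ "\<one>\<^bsub>G\<^esub>"])
    next
      case False
      then show ?thesis using T_chainD(3)[OF cB, of "i - ?k"] i len by (simp add: A'_def)
    qed
    fix i assume i: "i < length (gs @ ns)"
    have "(gs @ ns) ! i \<in> A' i \<and> \<chi>' i ((gs @ ns) ! i) = 1
      \<and> (\<forall>x\<in>A' i. \<forall>y\<in>A' i. \<chi>' i (x \<otimes>\<^bsub>G\<^esub> y) = \<chi>' i x + \<chi>' i y)
      \<and> A' (Suc i) = {x\<in>A' i. \<chi>' i x = 0}
      \<and> (\<forall>h\<in>S. \<forall>x\<in>A' i. inv\<^bsub>G\<^esub> h \<otimes>\<^bsub>G\<^esub> inv\<^bsub>G\<^esub> x \<otimes>\<^bsub>G\<^esub> h \<otimes>\<^bsub>G\<^esub> x \<in> A' (Suc i))"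
    proof (cases "i < ?k")
      case True
      note ch = T_chainD(4-8)[OF c True]
      have A'i: "A' i = {x\<in>S. \<pi> x \<in> A i}" "A' (Suc i) = {x\<in>S. \<pi> x \<in> A (Suc i)}" using True by (auto simp: A'_def)
      have \<chi>'i: "\<chi>' i x = \<chi> i (\<pi> x) div d i" for x using True by (simp add: \<chi>'_def)
      have gi: "(gs @ ns) ! i = gs ! i" using True len by (simp add: nth_append)
      have dp: "0 < d i" using g[OF True] by simp
      show ?thesis
      proof (intro conjI ballI)
        show "(gs @ ns) ! i \<in> A' i" "\<chi>' i ((gs @ ns) ! i) = 1" unfolding gi using g[OF True] by (auto simp: A'i \<chi>'i)
        show "\<chi>' i (x \<otimes>\<^bsub>G\<^esub> y) = \<chi>' i x + \<chi>' i y" if "x \<in> A' i" "y \<in> A' i" for x y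
        proof -
          have "\<chi> i (\<pi> (x \<otimes>\<^bsub>G\<^esub> y)) = \<chi> i (\<pi> x) + \<chi> i (\<pi> y)" using that ch(3) \<pi>(2) by (auto simp: A'i)
          then show ?thesis unfolding \<chi>'i using d[OF True, of x] that by (simp add: A'i div_plus_div_distrib_dvd_left)
        qed
        have "\<chi> i (\<pi> x) = 0 \<longleftrightarrow> \<chi> i (\<pi> x) div d i = 0" if "x \<in> A' i" for x
          using d[OF True, of x] that dp by (auto simp: A'i dvd_div_eq_0_iff)
        then show "A' (Suc i) = {x\<in>A' i. \<chi>' i x = 0}" using ch(4) unfolding \<chi>'i by (auto simp: A'i)
        show "inv\<^bsub>G\<^esub> h \<otimes>\<^bsub>G\<^esub> inv\<^bsub>G\<^esub> x \<otimes>\<^bsub>G\<^esub> h \<otimes>\<^bsub>G\<^esub> x \<in> A' (Suc i)" if "h \<in> S" "x \<in> A' i" for h x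
          using that ch(5)[OF \<pi>(1)[OF that(1)], of "\<pi> x"] by (auto simp: A'i \<pi>(2) \<pi>inv)
      qed
    next
      case False
      define j where "j = i - ?k"
      have ij: "i = ?k + j" and j: "j < length ns" using False i len by (auto simp: j_def)
      have gi: "(gs @ ns) ! i = ns ! j" using ij len by (simp add: nth_append)
      have e: "A' i = B j" "A' (Suc i) = B (Suc j)" "\<chi>' i = \<psi> j" using A'B[of j] A'B[of "Suc j"] ij by (auto simp: \<chi>'_def)
      show ?thesis unfolding gi e
      proof (intro conjI ballI)
        show "inv\<^bsub>G\<^esub> h \<otimes>\<^bsub>G\<^esub> inv\<^bsub>G\<^esub> x \<otimes>\<^bsub>G\<^esub> h \<otimes>\<^bsub>G\<^esub> x \<in> B (Suc j)" if h: "h \<in> S" and x: "x \<in> B j" for h x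
        proof -
          have xN: "x \<in> N" using BN[of j] j x by auto
          have xc: "x \<in> carrier G" "h \<in> carrier G" using xN N h by auto
          have "inv\<^bsub>G\<^esub> h \<otimes>\<^bsub>G\<^esub> inv\<^bsub>G\<^esub> x \<otimes>\<^bsub>G\<^esub> h \<otimes>\<^bsub>G\<^esub> x = inv\<^bsub>G\<^esub> h \<otimes>\<^bsub>G\<^esub> inv\<^bsub>G\<^esub> x \<otimes>\<^bsub>G\<^esub> (x \<otimes>\<^bsub>G\<^esub> h)"
            using xc cen[OF h xN] by (simp add: G.m_assoc)
          also have "\<dots> = \<one>\<^bsub>G\<^esub>" using xc by (simp add: G.m_assoc G.inv_solve_left')
          finally show ?thesis using subgroup.one_closed[OF T_chainD(3)[OF cB, of "Suc j"]] j by simp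
        qed
      qed (use T_chainD(4-7)[OF cB j] in auto)
    qed
    then show "(gs @ ns) ! i \<in> A' i" "\<chi>' i ((gs @ ns) ! i) = 1"
      "\<forall>x\<in>A' i. \<forall>y\<in>A' i. \<chi>' i (x \<otimes>\<^bsub>G\<^esub> y) = \<chi>' i x + \<chi>' i y"
      "A' (Suc i) = {x\<in>A' i. \<chi>' i x = 0}"
      "\<forall>h\<in>S. \<forall>x\<in>A' i. inv\<^bsub>G\<^esub> h \<otimes>\<^bsub>G\<^esub> inv\<^bsub>G\<^esub> x \<otimes>\<^bsub>G\<^esub> h \<otimes>\<^bsub>G\<^esub> x \<in> A' (Suc i)" by blast+
  qed
  then show ?thesis by blast
qed

section \<open>Groups of exponentials\<close>

text \<open>The hypotheses carried through the recursion. Closure under products suffices for a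
  group: inverses are exponentials of negatives, which lie in the subspace
  \<open>\<gg>\<close>.\<close>

definition exp_data :: "'v::rat_vector set \<Rightarrow> ('v \<Rightarrow> 'v) set \<Rightarrow> nat \<Rightarrow> (nat \<Rightarrow> 'v set) \<Rightarrow> bool" where
  "exp_data V \<gg> n F \<longleftrightarrow> Q.subspace V \<and> Q.subspace \<gg> \<and> \<gg> \<subseteq> Lin V V \<and> flag_wrt V \<gg> n F \<and> 1 \<le> n
     \<and> (\<forall>x\<in>\<gg>. \<forall>y\<in>\<gg>. \<exists>z\<in>\<gg>. nil_exp V x \<circ> nil_exp V y = nil_exp V z)"

text \<open>Each application of x lowers the index in the flag, so \<open>x ^^ k\<close> maps V into
  \<open>F (n - k)\<close>.\<close>

lemma flag_nilp:
  assumes "Q.subspace V" "\<gg> \<subseteq> Lin V V" "flag_wrt V \<gg> n F" "x \<in> \<gg>" shows "nilp V n x"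
  unfolding nilp_def
proof (intro conjI ballI assms(1) subsetD[OF assms(2,4)])
  fix v assume v: "v \<in> V"
  have F: "F 0 = {0}" "F n = V" and act: "x ` F (i + 1) \<subseteq> F i" if "i < n" for i
    using assms(3,4) that unfolding flag_wrt_def by blast+
  have "(x ^^ k) v \<in> F (n - k)" if "k \<le> n" for k
    using that
  proof (induction k)
    case 0
    show ?case using v assms(3) by (simp add: flag_wrt_def)
  next
    case (Suc k)
    then have "x ((x ^^ k) v) \<in> x ` F (n - Suc k + 1)" by (simp add: Suc_diff_Suc)
    then show ?case using act[of "n - Suc k"] Suc.prems by auto
  qed
  from this[of n] show "(x ^^ n) v = 0" using assms(3) by (simp add: flag_wrt_def)
qed

text \<open>The group of the theorem with exponentials in place of rational points;
  \<open>lie_algebra_exp_data\<close> identifies the two descriptions.\<close>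

definition stab :: "'v::rat_vector set \<Rightarrow> ('v \<Rightarrow> 'v) set \<Rightarrow> 'v set \<Rightarrow> ('v \<Rightarrow> 'v) set" where
  "stab V \<gg> L = {h \<in> nil_exp V ` \<gg>. h ` L = L}"

text \<open>(exp X - 1) / X is a power series. Consequently exp x - 1 kills what x kills, and its
  image lies in that of x.\<close>

lemma nil_exp_decomp:
  assumes "nilp V N x"
  obtains s where "s \<in> Lin V V" "nil_exp V x - idmap V = x \<circ> s" "nil_exp V x - idmap V = s \<circ> x"
proof -
  define f where "f = fps_shift 1 (fps_exp 1 - 1 :: rat fps)"
  have e: "fps_exp 1 - 1 = f * fps_X" by (rule fps_ext) (auto simp: f_def)
  then have e': "fps_exp 1 - 1 = fps_X * f" by (simp add: mult.commute)
  show ?thesis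
  proof (rule that)
    show "fps_op V f x \<in> Lin V V" by (rule fps_op_Lin[OF assms])
    show "nil_exp V x - idmap V = x \<circ> fps_op V f x"
      unfolding nil_exp_minus_id[OF assms] e' fps_op_mult[OF assms] fps_op_X[OF assms] ..
    show "nil_exp V x - idmap V = fps_op V f x \<circ> x"
      unfolding nil_exp_minus_id[OF assms] e fps_op_mult[OF assms] fps_op_X[OF assms] ..
  qed
qed

locale exp_group =
  fixes V :: "'v::rat_vector set" and \<gg> :: "('v \<Rightarrow> 'v) set" and n :: nat and F :: "nat \<Rightarrow> 'v set"
  assumes data: "exp_data V \<gg> n F"
begin

lemma V: "Q.subspace V" and gsub: "Q.subspace \<gg>" and gLin: "x \<in> \<gg> \<Longrightarrow> x \<in> Lin V V" and n1: "1 \<le> n"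
  and F0: "F 0 = {0}" and Fn: "F n = V" and Fsub: "i \<le> n \<Longrightarrow> Q.subspace (F i)"
  and Fstrict: "i < n \<Longrightarrow> F i \<subset> F (Suc i)"
  using data by (auto simp: exp_data_def flag_wrt_def)

lemma Fact: assumes "i < n" "x \<in> \<gg>" "v \<in> F (Suc i)" shows "x v \<in> F i"
proof -
  have "x ` F (i + 1) \<subseteq> F i" using data assms(1,2) unfolding exp_data_def flag_wrt_def by blast
  then show ?thesis using assms(3) by auto
qed

lemma exp_mult: "x \<in> \<gg> \<Longrightarrow> y \<in> \<gg> \<Longrightarrow> \<exists>z\<in>\<gg>. nil_exp V x \<circ> nil_exp V y = nil_exp V z"
  using data by (auto simp: exp_data_def)

lemma Fmono: "i \<le> j \<Longrightarrow> j \<le> n \<Longrightarrow> F i \<subseteq> F j"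
proof (induction j rule: dec_induct)
  case (step j)
  then show ?case using Fstrict[of j] by auto
qed simp

lemma FV: "i \<le> n \<Longrightarrow> F i \<subseteq> V" using Fmono[of i n] Fn by simp

lemma Finv: "i \<le> n \<Longrightarrow> x \<in> \<gg> \<Longrightarrow> v \<in> F i \<Longrightarrow> x v \<in> F i"
proof (cases i)
  case 0
  assume "x \<in> \<gg>" "v \<in> F i"
  then show ?thesis using 0 F0 Lin_zero[OF gLin V] by auto
next
  case (Suc j)
  assume "i \<le> n" "x \<in> \<gg>" "v \<in> F i"
  then show ?thesis using Suc Fact[of j x v] Fmono[of j i] by auto
qed

lemma nilp: "x \<in> \<gg> \<Longrightarrow> nilp V n x"
  using data flag_nilp by (auto simp: exp_data_def)

lemma neg: "x \<in> \<gg> \<Longrightarrow> - x \<in> \<gg>" using Q.subspace_neg[OF gsub] .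

interpretation GL: group "GL V" by (rule group_GL[OF V])

lemma exp_GL: "x \<in> \<gg> \<Longrightarrow> nil_exp V x \<in> carrier (GL V)" by (rule nil_exp_GL[OF nilp])

lemma exp_inv: "x \<in> \<gg> \<Longrightarrow> inv\<^bsub>GL V\<^esub> (nil_exp V x) = nil_exp V (- x)" by (rule nil_exp_inv[OF nilp])

lemma exp_subgroup: "subgroup (nil_exp V ` \<gg>) (GL V)"
proof (rule GL.subgroupI)
  show "nil_exp V ` \<gg> \<noteq> {}" using Q.subspace_0[OF gsub] by blast
next
  fix a b assume "a \<in> nil_exp V ` \<gg>" "b \<in> nil_exp V ` \<gg>"
  then show "a \<otimes>\<^bsub>GL V\<^esub> b \<in> nil_exp V ` \<gg>" using exp_mult by (auto simp: GL_simps)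
qed (auto simp: exp_GL exp_inv neg)

text \<open>Inclusions in place of equality: in the applications one argument covers all elements of
  a subgroup, hence h and its inverse at once.\<close>

lemma stabI:
  assumes "h \<in> nil_exp V ` \<gg>" "h ` L \<subseteq> L" "(inv\<^bsub>GL V\<^esub> h) ` L \<subseteq> L" "L \<subseteq> V" shows "h \<in> stab V \<gg> L"
proof -
  have hc: "h \<in> carrier (GL V)" using assms(1) exp_GL by auto
  have "h ((inv\<^bsub>GL V\<^esub> h) l) = l" if "l \<in> L" for l
    using fun_cong[OF GL.r_inv[OF hc], of l] that assms(4) by (auto simp: GL_simps idmap_def)
  then have "L \<subseteq> h ` L" using assms(3) by (metis image_subset_iff rev_image_eqI subsetI)
  then show ?thesis using assms by (simp add: stab_def)
qed

lemma stab_subgroup: assumes "L \<subseteq> V" shows "subgroup (stab V \<gg> L) (GL V)"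
proof -
  interpret H: subgroup "nil_exp V ` \<gg>" "GL V" by (rule exp_subgroup)
  show ?thesis
  proof (rule GL.subgroupI)
    show "stab V \<gg> L \<subseteq> carrier (GL V)" using H.subset by (auto simp: stab_def)
    have "idmap V ` L = L" using assms by (auto simp: idmap_def image_def)
    moreover have "idmap V \<in> nil_exp V ` \<gg>" using H.one_closed by (simp add: GL_simps)
    ultimately have "idmap V \<in> stab V \<gg> L" unfolding stab_def by simp
    then show "stab V \<gg> L \<noteq> {}" by blast
  next
    fix a assume a: "a \<in> stab V \<gg> L"
    then have ac: "a \<in> carrier (GL V)" "a \<in> nil_exp V ` \<gg>" using H.subset by (auto simp: stab_def)
    have i: "(inv\<^bsub>GL V\<^esub> a) (a l) = l" if "l \<in> L" for l
      using fun_cong[OF GL.l_inv[OF ac(1)], of l] that assms by (auto simp: GL_simps idmap_def)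
    have aL: "L = a ` L" using a by (simp add: stab_def)
    have "(inv\<^bsub>GL V\<^esub> a) ` L = (inv\<^bsub>GL V\<^esub> a) ` a ` L" using aL by simp
    also have "\<dots> = L" using i by (simp add: image_image)
    finally show "inv\<^bsub>GL V\<^esub> a \<in> stab V \<gg> L" using H.m_inv_closed[OF ac(2)] by (simp add: stab_def)
  next
    fix a b assume "a \<in> stab V \<gg> L" "b \<in> stab V \<gg> L"
    then have ab: "a \<in> nil_exp V ` \<gg>" "b \<in> nil_exp V ` \<gg>" "a ` L = L" "b ` L = L" by (simp_all add: stab_def)
    have "(a \<circ> b) ` L = L" using ab(3,4) by (simp only: image_comp[symmetric])
    then show "a \<otimes>\<^bsub>GL V\<^esub> b \<in> stab V \<gg> L"
      using H.m_closed[OF ab(1,2)] by (simp add: stab_def GL_simps)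
  qed
qed

end

lemma qcomb_map: assumes "f \<in> Lin A B" "Q.subspace A" "set xs \<subseteq> A" shows "qcomb c (map f xs) = f (qcomb c xs)"
proof -
  have x: "xs ! i \<in> A" if "i < length xs" for i using that assms(3) by auto
  have "f (qcomb c xs) = (\<Sum>i<length xs. f (c i *\<^sub>Q xs ! i))"
    unfolding qcomb_def by (rule Lin_sum[OF assms(1,2)]) (use x Q.subspace_scale[OF assms(2)] in auto)
  then show ?thesis using x by (simp add: qcomb_def Lin_scale[OF assms(1)])
qed

section \<open>The derived space\<close>

text \<open>The model of the derived space is fixed but arbitrary, which covers every choice of it.
  The bound on n ensures that \<open>F 1\<close> is contained in \<open>F (n - 1)\<close>.\<close>

locale derived = exp_group V \<gg> n F for V :: "'v::rat_vector set" and \<gg> n F +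
  fixes L :: "'v set" and D :: "'u::rat_vector set" and \<iota> \<kappa> :: "'v \<Rightarrow> 'u"
  assumes L: "full_lattice V L" and n2: "2 \<le> n" and D: "(D, \<iota>, \<kappa>) \<in> derived_spaces V (F 1) (F (n - 1))"
begin

abbreviation "V1 \<equiv> F 1"
abbreviation "Vm \<equiv> F (n - 1)"
definition "d\<pi> = derived_action V Vm \<iota> \<kappa>"
definition "L' = set_sum (\<iota> ` (L \<inter> Vm)) (\<kappa> ` L)"
definition "F' = (\<lambda>i. set_sum (\<iota> ` F i) (\<kappa> ` F (i + 1)))"
definition "\<nn> = {x \<in> \<gg>. d\<pi> x = 0}"
definition "\<qq> = d\<pi> ` \<gg>"
text \<open>The endomorphisms that act on \<open>Vm\<close> and on V modulo \<open>V1\<close>. Both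
  \<open>\<gg>\<close> and its exponentials lie in P, so one multiplicative map
  \<open>d\<pi>\<close> on P serves the Lie algebra and the group.\<close>

definition "P = {f \<in> Lin V V. (\<forall>a\<in>Vm. f a \<in> Vm) \<and> (\<forall>a\<in>V1. f a \<in> V1)}"

lemma V1: "Q.subspace V1" and Vm: "Q.subspace Vm" and V1m: "V1 \<subseteq> Vm" and VmV: "Vm \<subseteq> V" and V1V: "V1 \<subseteq> V"
  using Fsub[of 1] Fsub[of "n - 1"] n2 Fmono[of 1 "n - 1"] FV[of "n - 1"] FV[of 1] by auto

lemma gV1: "x \<in> \<gg> \<Longrightarrow> v \<in> V1 \<Longrightarrow> x v = 0" using Fact[of 0 x v] F0 n1 by auto
lemma gV: "x \<in> \<gg> \<Longrightarrow> v \<in> V \<Longrightarrow> x v \<in> Vm" using Fact[of "n - 1" x v] Fn n1 by auto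

lemma LV: "L \<subseteq> V" by (rule full_lattice_subset[OF L])

lemma L_group: "add_subgroup L" using L add_subgroup_zspan by (auto simp: full_lattice_iff)

lemma iota: "\<iota> \<in> Lin Vm D" and iota_inj: "inj_on \<iota> Vm" and kappa: "\<kappa> \<in> Lin V D"
  and kappa0: "v \<in> V \<Longrightarrow> \<kappa> v = 0 \<longleftrightarrow> v \<in> V1" and Dsum: "direct_sum D (\<iota> ` Vm) (\<kappa> ` V)"
  using D by (auto simp: derived_spaces_def)

lemma D_eq: "D = set_sum (\<iota> ` Vm) (\<kappa> ` V)" and D_Int: "\<iota> ` Vm \<inter> \<kappa> ` V = {0}"
  and D_iota: "Q.subspace (\<iota> ` Vm)" and D_kappa: "Q.subspace (\<kappa> ` V)"
  using Dsum by (auto simp: direct_sum_def)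

lemma D_sub: "Q.subspace D"
proof -
  have "D = {a + b |a b. a \<in> \<iota> ` Vm \<and> b \<in> \<kappa> ` V}" using D_eq by (simp add: set_sum_def)
  then show ?thesis using Q.subspace_sums[OF D_iota D_kappa] by simp
qed

lemma D_cases: assumes "w \<in> D" obtains a b where "a \<in> Vm" "b \<in> V" "w = \<iota> a + \<kappa> b"
  using assms D_eq by (auto simp: set_sum_def)

lemma D_in: "a \<in> Vm \<Longrightarrow> b \<in> V \<Longrightarrow> \<iota> a + \<kappa> b \<in> D"
  using D_eq by (auto simp: set_sum_def)

lemma D_unique:
  assumes "a \<in> Vm" "b \<in> V" "a' \<in> Vm" "b' \<in> V" "\<iota> a + \<kappa> b = \<iota> a' + \<kappa> b'"
  shows "a = a'" "b - b' \<in> V1"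
proof -
  have e: "\<iota> (a - a') = \<kappa> (b' - b)"
    using assms by (simp add: Lin_diff[OF iota Vm] Lin_diff[OF kappa V] algebra_simps)
  moreover have "\<iota> (a - a') \<in> \<iota> ` Vm" "\<kappa> (b' - b) \<in> \<kappa> ` V"
    using assms Q.subspace_diff[OF Vm] Q.subspace_diff[OF V] by auto
  ultimately have "\<iota> (a - a') = 0" "\<kappa> (b' - b) = 0" using D_Int by auto
  then have "\<iota> a = \<iota> a'" "b' - b \<in> V1"
    using assms kappa0[OF Q.subspace_diff[OF V]] by (auto simp: Lin_diff[OF iota Vm])
  then show "a = a'" "b - b' \<in> V1"
    using iota_inj assms Q.subspace_neg[OF V1, of "b' - b"] by (auto simp: inj_on_def)
qed

lemma kappa_eq: "b \<in> V \<Longrightarrow> b' \<in> V \<Longrightarrow> \<kappa> b = \<kappa> b' \<longleftrightarrow> b - b' \<in> V1"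
  using kappa0[OF Q.subspace_diff[OF V, of b b']] by (auto simp: Lin_diff[OF kappa V])

lemma P_D: "f \<in> P \<Longrightarrow> f \<in> Lin V V" "f \<in> P \<Longrightarrow> a \<in> Vm \<Longrightarrow> f a \<in> Vm" "f \<in> P \<Longrightarrow> a \<in> V1 \<Longrightarrow> f a \<in> V1"
  by (auto simp: P_def)

text \<open>The description by \<open>THE\<close> is unambiguous: the component a is determined, b
  is determined up to \<open>V1\<close>, and f maps \<open>V1\<close> into itself, where \<kappa>
  vanishes.\<close>

lemma dpi: assumes f: "f \<in> P" and ab: "a \<in> Vm" "b \<in> V"
  shows "d\<pi> f (\<iota> a + \<kappa> b) = \<iota> (f a) + \<kappa> (f b)"
proof -
  have "(THE z. \<exists>a'\<in>Vm. \<exists>b'\<in>V. \<iota> a + \<kappa> b = \<iota> a' + \<kappa> b' \<and> z = \<iota> (f a') + \<kappa> (f b')) = \<iota> (f a) + \<kappa> (f b)"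
  proof (rule the_equality)
    show "\<exists>a'\<in>Vm. \<exists>b'\<in>V. \<iota> a + \<kappa> b = \<iota> a' + \<kappa> b' \<and> \<iota> (f a) + \<kappa> (f b) = \<iota> (f a') + \<kappa> (f b')" using ab by blast
    fix z assume "\<exists>a'\<in>Vm. \<exists>b'\<in>V. \<iota> a + \<kappa> b = \<iota> a' + \<kappa> b' \<and> z = \<iota> (f a') + \<kappa> (f b')"
    then obtain a' b' where z: "a' \<in> Vm" "b' \<in> V" "\<iota> a + \<kappa> b = \<iota> a' + \<kappa> b'" "z = \<iota> (f a') + \<kappa> (f b')" by blast
    note u = D_unique[OF ab z(1,2,3)]
    have "f b - f b' \<in> V1" using P_D(3)[OF f u(2)] by (simp add: Lin_diff[OF P_D(1)[OF f] V ab(2) z(2)])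
    then have "\<kappa> (f b) = \<kappa> (f b')" using kappa_eq Lin_in[OF P_D(1)[OF f]] ab z by blast
    then show "z = \<iota> (f a) + \<kappa> (f b)" using u z by simp
  qed
  moreover have "\<iota> a + \<kappa> b \<in> set_sum (\<iota> ` Vm) (\<kappa> ` V)" using ab by (auto simp: set_sum_def)
  ultimately show ?thesis by (simp add: d\<pi>_def derived_action_def)
qed

lemma dpi_out: "w \<notin> D \<Longrightarrow> d\<pi> f w = 0" by (simp add: d\<pi>_def derived_action_def D_eq)

lemma dpi_eqI:
  assumes "\<And>a b. a \<in> Vm \<Longrightarrow> b \<in> V \<Longrightarrow> h (\<iota> a + \<kappa> b) = k (\<iota> a + \<kappa> b)" "\<And>w. w \<notin> D \<Longrightarrow> h w = k w" shows "h = k"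
  using assms D_cases by (metis ext)

lemma dpi_iota: "f \<in> P \<Longrightarrow> a \<in> Vm \<Longrightarrow> d\<pi> f (\<iota> a) = \<iota> (f a)"
  using dpi[of f a 0] Q.subspace_0[OF V] by (simp add: Lin_zero[OF kappa V] Lin_zero[OF P_D(1) V])

lemma dpi_kappa: "f \<in> P \<Longrightarrow> b \<in> V \<Longrightarrow> d\<pi> f (\<kappa> b) = \<kappa> (f b)"
  using dpi[of f 0 b] Q.subspace_0[OF Vm] by (simp add: Lin_zero[OF iota Vm] Lin_zero[OF P_D(1) V])

lemma dpi_Lin: assumes f: "f \<in> P" shows "d\<pi> f \<in> Lin D D"
proof (rule LinI)
  note fP = P_D[OF f]
  fix w q assume "w \<in> D"
  then obtain a b where w: "a \<in> Vm" "b \<in> V" "w = \<iota> a + \<kappa> b" by (rule D_cases)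
  have ab: "f a \<in> Vm" "f b \<in> V" using fP w Lin_in[OF fP(1)] by auto
  show "d\<pi> f w \<in> D" using w D_in[OF ab] by (simp add: dpi[OF f])
  have aV: "a \<in> V" using w VmV by auto
  have "d\<pi> f (q *\<^sub>Q w) = d\<pi> f (\<iota> (q *\<^sub>Q a) + \<kappa> (q *\<^sub>Q b))"
    using w by (simp add: Lin_scale[OF iota] Lin_scale[OF kappa] scaleQ_add_right)
  also have "\<dots> = \<iota> (f (q *\<^sub>Q a)) + \<kappa> (f (q *\<^sub>Q b))"
    by (rule dpi[OF f Q.subspace_scale[OF Vm w(1)] Q.subspace_scale[OF V w(2)]])
  also have "\<dots> = q *\<^sub>Q d\<pi> f w"
    unfolding w(3) dpi[OF f w(1,2)] using w ab aV
    by (simp add: Lin_scale[OF fP(1)] Lin_scale[OF iota] Lin_scale[OF kappa] scaleQ_add_right)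
  finally show "d\<pi> f (q *\<^sub>Q w) = q *\<^sub>Q d\<pi> f w" .
  fix w' assume "w' \<in> D"
  then obtain a' b' where w': "a' \<in> Vm" "b' \<in> V" "w' = \<iota> a' + \<kappa> b'" by (rule D_cases)
  have ab': "f a' \<in> Vm" "f b' \<in> V" "a' \<in> V" using fP w' Lin_in[OF fP(1)] VmV by auto
  have "d\<pi> f (w + w') = d\<pi> f (\<iota> (a + a') + \<kappa> (b + b'))"
    using w w' by (simp add: Lin_add[OF iota] Lin_add[OF kappa] algebra_simps)
  also have "\<dots> = \<iota> (f (a + a')) + \<kappa> (f (b + b'))"
    by (rule dpi[OF f Q.subspace_add[OF Vm w(1) w'(1)] Q.subspace_add[OF V w(2) w'(2)]])
  also have "\<dots> = d\<pi> f w + d\<pi> f w'"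
    unfolding w(3) w'(3) dpi[OF f w(1,2)] dpi[OF f w'(1,2)] using w ab aV w' ab'
    by (simp add: Lin_add[OF fP(1)] Lin_add[OF iota] Lin_add[OF kappa] algebra_simps)
  finally show "d\<pi> f (w + w') = d\<pi> f w + d\<pi> f w'" .
qed (rule dpi_out)

lemma P_comp: "f \<in> P \<Longrightarrow> h \<in> P \<Longrightarrow> f \<circ> h \<in> P"
  using Lin_comp[of f V V h V] V by (auto simp: P_def)

lemma P_sub: "Q.subspace P"
  using subspace_Lin[OF V, of V] V1 Vm unfolding Q.subspace_def P_def scaleQ_fun_def by auto

lemma dpi_comp: assumes "f \<in> P" "h \<in> P" shows "d\<pi> (f \<circ> h) = d\<pi> f \<circ> d\<pi> h"
proof (rule dpi_eqI)
  fix a b assume ab: "a \<in> Vm" "b \<in> V"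
  then show "d\<pi> (f \<circ> h) (\<iota> a + \<kappa> b) = (d\<pi> f \<circ> d\<pi> h) (\<iota> a + \<kappa> b)"
    using Lin_in[OF P_D(1)[OF assms(2)]] P_D(2)[OF assms(2)]
    by (simp add: dpi[OF P_comp[OF assms]] dpi[OF assms(1)] dpi[OF assms(2)])
qed (simp add: dpi_out Lin_zero[OF dpi_Lin[OF assms(1)] D_sub])

lemma dpi_add: assumes "f \<in> P" "h \<in> P" shows "d\<pi> (f + h) = d\<pi> f + d\<pi> h"
proof (rule dpi_eqI)
  fix a b assume ab: "a \<in> Vm" "b \<in> V"
  then show "d\<pi> (f + h) (\<iota> a + \<kappa> b) = (d\<pi> f + d\<pi> h) (\<iota> a + \<kappa> b)"
    using Lin_in[OF P_D(1)[OF assms(2)]] P_D(2)[OF assms(2)] Lin_in[OF P_D(1)[OF assms(1)]] P_D(2)[OF assms(1)]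
    by (simp add: dpi[OF Q.subspace_add[OF P_sub assms]] dpi[OF assms(1)] dpi[OF assms(2)]
        Lin_add[OF iota] Lin_add[OF kappa] algebra_simps)
qed (simp add: dpi_out)

lemma dpi_scale: assumes "f \<in> P" shows "d\<pi> (q *\<^sub>Q f) = q *\<^sub>Q d\<pi> f"
proof (rule dpi_eqI)
  fix a b assume ab: "a \<in> Vm" "b \<in> V"
  then show "d\<pi> (q *\<^sub>Q f) (\<iota> a + \<kappa> b) = (q *\<^sub>Q d\<pi> f) (\<iota> a + \<kappa> b)"
    unfolding dpi[OF Q.subspace_scale[OF P_sub assms] ab] scaleQ_fun_def[of q "d\<pi> f"] dpi[OF assms ab] using Lin_in[OF P_D(1)[OF assms]] P_D(2)[OF assms]
    by (simp add: scaleQ_fun_def Lin_scale[OF iota] Lin_scale[OF kappa] scaleQ_add_right)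
qed (simp add: dpi_out scaleQ_fun_def)

lemma g_P: "x \<in> \<gg> \<Longrightarrow> x \<in> P"
  using gLin Finv[of "n - 1" x] Finv[of 1 x] n2 by (auto simp: P_def)

lemma exp_P: assumes x: "x \<in> \<gg>" shows "nil_exp V x \<in> P"
proof -
  note xP = P_D[OF g_P[OF x]]
  have "fps_op V (fps_exp 1) x a \<in> Vm" if "a \<in> Vm" for a
    by (rule fps_op_in[OF nilp[OF x] Vm VmV _ that]) (rule xP)
  moreover have "fps_op V (fps_exp 1) x a \<in> V1" if "a \<in> V1" for a
    by (rule fps_op_in[OF nilp[OF x] V1 V1V _ that]) (rule xP)
  ultimately show ?thesis using nil_exp_Lin[OF nilp[OF x]] by (simp add: P_def nil_exp_fps)
qed

section \<open>The derived flag and the image of the Lie algebra\<close>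

lemma F'n: "F' (n - 1) = D" using D_eq n2 Fn by (simp add: F'_def)

lemma F'_sub: assumes "i < n" shows "Q.subspace (F' i)"
  unfolding F'_def set_sum_def
proof (rule Q.subspace_sums)
  show "Q.subspace (\<iota> ` F i)" by (rule subspace_image[OF iota Vm _ Fsub]) (use assms Fmono[of i "n - 1"] in auto)
  show "Q.subspace (\<kappa> ` F (i + 1))" by (rule subspace_image[OF kappa V _ Fsub]) (use assms FV[of "i + 1"] in auto)
qed

lemma F'_strict: assumes "i < n - 1" shows "F' i \<subset> F' (i + 1)"
proof
  show "F' i \<subseteq> F' (i + 1)"
    unfolding F'_def set_sum_def using Fmono[of i "i + 1"] Fmono[of "i + 1" "i + 2"] assms by fastforce
  have "i < n" and i1: "F (i + 1) \<subseteq> V" using assms FV[of "i + 1"] by simp_all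
  then obtain v where v: "v \<in> F (i + 1)" "v \<notin> F i" using Fstrict[of i] by auto
  have vm: "v \<in> Vm" using Fmono[of "i + 1" "n - 1"] assms v by auto
  have 0: "0 \<in> F (i + 2)" using Q.subspace_0[OF Fsub[of "i + 2"]] assms by simp
  \<comment> \<open>The first component alone separates the two steps of the derived flag.\<close>
  have "\<iota> v + \<kappa> 0 \<in> F' (i + 1)" unfolding F'_def set_sum_def using v 0 by auto
  moreover have "\<iota> v + \<kappa> 0 \<notin> F' i"
  proof
    assume "\<iota> v + \<kappa> 0 \<in> F' i"
    then obtain a b where ab: "a \<in> F i" "b \<in> F (i + 1)" "\<iota> v + \<kappa> 0 = \<iota> a + \<kappa> b" by (auto simp: F'_def set_sum_def)
    have "v = a"
      by (rule D_unique(1)[OF vm Q.subspace_0[OF V] _ _ ab(3)])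
        (use ab i1 Fmono[of i "n - 1"] assms in auto)
    then show False using ab v by simp
  qed
  ultimately show "F' i \<noteq> F' (i + 1)" by blast
qed

lemma q_sub: "Q.subspace \<qq>"
  unfolding Q.subspace_def \<qq>_def
proof (intro conjI ballI allI)
  have "d\<pi> (0 *\<^sub>Q 0) = 0 *\<^sub>Q d\<pi> 0" by (rule dpi_scale[OF Q.subspace_0[OF P_sub]])
  then show "0 \<in> d\<pi> ` \<gg>" using Q.subspace_0[OF gsub] by (metis Q.scale_zero_left image_eqI)
next
  fix x y assume "x \<in> d\<pi> ` \<gg>" "y \<in> d\<pi> ` \<gg>"
  then show "x + y \<in> d\<pi> ` \<gg>" using dpi_add[OF g_P g_P] Q.subspace_add[OF gsub] by (auto simp: image_iff) metis
next
  fix q x assume "x \<in> d\<pi> ` \<gg>"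
  then show "q *\<^sub>Q x \<in> d\<pi> ` \<gg>" using dpi_scale[OF g_P] Q.subspace_scale[OF gsub] by (auto simp: image_iff) metis
qed

lemma q_flag: "flag_wrt D \<qq> (n - 1) F'"
  unfolding flag_wrt_def
proof (intro conjI allI impI ballI)
  \<comment> \<open>The second summand of \<open>F' 0\<close> vanishes because \<open>V1\<close> is
    the kernel of \<kappa>.\<close>
  have "\<kappa> ` V1 = {0}" using kappa0 V1V Q.subspace_0[OF V1] by (auto simp: image_iff subset_iff intro!: bexI[of _ 0])
  then show "F' 0 = {0}" using F0 Lin_zero[OF iota Vm] by (simp add: F'_def set_sum_def)
  show "F' (n - 1) = D" by (rule F'n)
  show "Q.subspace (F' i)" if "i \<le> n - 1" for i using F'_sub[of i] that n2 by simp
  show "F' i \<subset> F' (i + 1)" if "i < n - 1" for i by (rule F'_strict[OF that])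
  fix i x assume i: "i < n - 1" and "x \<in> \<qq>"
  then obtain y where y: "y \<in> \<gg>" "x = d\<pi> y" by (auto simp: \<qq>_def)
  show "x ` F' (i + 1) \<subseteq> F' i"
  proof
    fix z assume "z \<in> x ` F' (i + 1)"
    then obtain a b where ab: "a \<in> F (i + 1)" "b \<in> F (i + 2)" "z = x (\<iota> a + \<kappa> b)" by (auto simp: F'_def set_sum_def)
    have "F (i + 2) \<subseteq> V" using i by (intro FV) simp
    then have "z = \<iota> (y a) + \<kappa> (y b)"
      unfolding ab(3) y(2) using i ab Fmono[of "i + 1" "n - 1"] by (intro dpi[OF g_P[OF y(1)]]) auto
    moreover have "y a \<in> F i" "y b \<in> F (i + 1)" using Fact[of i y a] Fact[of "i + 1" y b] i y ab by auto
    ultimately show "z \<in> F' i" by (auto simp: F'_def set_sum_def)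
  qed
qed

lemma dpi_nilp: assumes "x \<in> \<gg>" shows "nilp D (n - 1) (d\<pi> x)"
  by (rule flag_nilp[OF D_sub _ q_flag]) (use assms dpi_Lin[OF g_P] in \<open>auto simp: \<qq>_def\<close>)

text \<open>The maps \<iota> on \<open>Vm\<close> and \<kappa> on V intertwine x with
  \<open>d\<pi> x\<close>, hence also the exponentials, and D is the sum of their images.\<close>

lemma dpi_exp: assumes "x \<in> \<gg>" shows "d\<pi> (nil_exp V x) = nil_exp D (d\<pi> x)"
proof (rule dpi_eqI)
  fix a b assume ab: "a \<in> Vm" "b \<in> V"
  have 1: "\<iota> (nil_exp V x a) = nil_exp D (d\<pi> x) (\<iota> a)" unfolding nil_exp_fps
    by (rule fps_op_intertwine[OF nilp[OF assms] iota dpi_nilp[OF assms] Vm VmV])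
      (use P_D[OF g_P[OF assms]] ab dpi_iota[OF g_P[OF assms]] in auto)
  have 2: "\<kappa> (nil_exp V x b) = nil_exp D (d\<pi> x) (\<kappa> b)" unfolding nil_exp_fps
    by (rule fps_op_intertwine[OF nilp[OF assms] kappa dpi_nilp[OF assms] V order_refl])
      (use Lin_in[OF gLin[OF assms]] ab dpi_kappa[OF g_P[OF assms]] in auto)
  show "d\<pi> (nil_exp V x) (\<iota> a + \<kappa> b) = nil_exp D (d\<pi> x) (\<iota> a + \<kappa> b)"
    using ab by (simp add: dpi[OF exp_P[OF assms]] 1 2 Lin_add[OF nil_exp_Lin[OF dpi_nilp[OF assms]]]
        Lin_in[OF iota] Lin_in[OF kappa])
qed (simp add: dpi_out Lin_out[OF nil_exp_Lin[OF dpi_nilp[OF assms]]])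

lemma q_data: "exp_data D \<qq> (n - 1) F'"
  unfolding exp_data_def
proof (intro conjI D_sub q_sub q_flag ballI)
  show "\<qq> \<subseteq> Lin D D" using dpi_Lin[OF g_P] by (auto simp: \<qq>_def)
  show "1 \<le> n - 1" using n2 by simp
  fix x y assume "x \<in> \<qq>" "y \<in> \<qq>"
  then obtain u v where uv: "u \<in> \<gg>" "v \<in> \<gg>" "x = d\<pi> u" "y = d\<pi> v" by (auto simp: \<qq>_def)
  obtain z where z: "z \<in> \<gg>" "nil_exp V u \<circ> nil_exp V v = nil_exp V z" using exp_mult[OF uv(1,2)] by auto
  have "nil_exp D x \<circ> nil_exp D y = nil_exp D (d\<pi> z)"
    unfolding uv dpi_exp[OF uv(1), symmetric] dpi_exp[OF uv(2), symmetric] dpi_exp[OF z(1), symmetric] z(2)[symmetric]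
    by (rule dpi_comp[OF exp_P[OF uv(1)] exp_P[OF uv(2)], symmetric])
  then show "\<exists>z\<in>\<qq>. nil_exp D x \<circ> nil_exp D y = nil_exp D z" using z by (auto simp: \<qq>_def)
qed

text \<open>For a basis \<open>xs @ ys @ zs\<close> of L adapted to \<open>V1\<close> and
  \<open>Vm\<close>, the images of \<open>xs @ ys\<close> under \<iota> and of
  \<open>ys @ zs\<close> under \<kappa> form a basis of the derived lattice; the block
  \<open>xs\<close> spans the kernel of \<kappa>.\<close>

lemma L'_full: "full_lattice D L'"
proof -
  from adapted_basis2[OF L V1 Vm V1m VmV]
  obtain xs ys zs where b: "q_indep (xs @ ys @ zs)" "L = zspan (xs @ ys @ zs)" "V = qspan (xs @ ys @ zs)"
    "L \<inter> V1 = zspan xs" "V1 = qspan xs" "L \<inter> Vm = zspan (xs @ ys)" "Vm = qspan (xs @ ys)"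
    by (elim exE conjE) (rule that; assumption)
  define us where "us = map \<iota> (xs @ ys)"
  define vs where "vs = map \<kappa> (ys @ zs)"
  have xV1: "set xs \<subseteq> V1" and xyVm: "set (xs @ ys) \<subseteq> Vm" and aV: "set (xs @ ys @ zs) \<subseteq> V"
    using set_qspan[of xs] set_qspan[of "xs @ ys"] set_qspan[of "xs @ ys @ zs"] b by auto
  have yzV: "set (ys @ zs) \<subseteq> V" using aV by auto
  have ixy: "q_indep (xs @ ys)" using q_indep_append(1)[of "xs @ ys" zs] b(1) by simp
  have \<iota>c: "qcomb c us = \<iota> (qcomb c (xs @ ys))" for c unfolding us_def by (rule qcomb_map[OF iota Vm xyVm])
  have \<kappa>c: "qcomb c vs = \<kappa> (qcomb c (ys @ zs))" for c unfolding vs_def by (rule qcomb_map[OF kappa V yzV])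
  have \<kappa>all: "\<kappa> (qcomb c (xs @ ys @ zs)) = \<kappa> (qcomb (\<lambda>i. c (length xs + i)) (ys @ zs))" for c
  proof -
    have 1: "qcomb c xs \<in> V1" using b(5) by blast
    have 2: "qcomb (\<lambda>i. c (length xs + i)) (ys @ zs) \<in> V" using qspan_subset[OF V yzV] by blast
    show ?thesis using 1 2 kappa0[of "qcomb c xs"] V1V
      by (auto simp: qcomb_append[of c xs] Lin_add[OF kappa])
  qed
  have iu: "q_indep us"
    unfolding q_indep_def
  proof (intro allI impI)
    fix c i assume "qcomb c us = 0" and i: "i < length us"
    then have "\<iota> (qcomb c (xs @ ys)) = \<iota> 0" by (simp add: \<iota>c Lin_zero[OF iota Vm])
    moreover have "qcomb c (xs @ ys) \<in> Vm" "0 \<in> Vm" using b(7) Q.subspace_0[OF Vm] by blast+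
    ultimately have "qcomb c (xs @ ys) = 0" using iota_inj by (auto simp: inj_on_def)
    then have "\<forall>i<length (xs @ ys). c i = 0" using ixy unfolding q_indep_def by (elim allE[of _ c]) simp
    then show "c i = 0" using i by (simp add: us_def)
  qed
  have iv: "q_indep vs"
    unfolding q_indep_def
  proof (intro allI impI)
    fix c i assume "qcomb c vs = 0" and i: "i < length vs"
    then have z: "\<kappa> (qcomb c (ys @ zs)) = 0" by (simp add: \<kappa>c)
    have m: "qcomb c (ys @ zs) \<in> qspan (ys @ zs)" by blast
    then have "qcomb c (ys @ zs) \<in> V" using qspan_subset[OF V yzV] by blast
    then have "qcomb c (ys @ zs) \<in> qspan xs" using kappa0 z b(5) by simp
    then have "qcomb c (ys @ zs) = 0" using m q_indep_append(3)[OF b(1)] by blast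
    then have "\<forall>i<length (ys @ zs). c i = 0"
      using q_indep_append(2)[OF b(1)] unfolding q_indep_def by (elim allE[of _ c]) simp
    then show "c i = 0" using i by (simp add: vs_def)
  qed
  have qu: "qspan us = \<iota> ` Vm" unfolding b(7) \<iota>c by (simp add: image_image)
  have zu: "zspan us = \<iota> ` (L \<inter> Vm)" unfolding b(6) zcomb_qcomb \<iota>c by (simp add: image_image)
  have qv: "qspan vs = \<kappa> ` V"
  proof
    show "qspan vs \<subseteq> \<kappa> ` V" unfolding \<kappa>c using qspan_subset[OF V yzV] by blast
    show "\<kappa> ` V \<subseteq> qspan vs" unfolding b(3) \<kappa>c using \<kappa>all by auto
  qed
  have zv: "zspan vs = \<kappa> ` L"
  proof
    show "zspan vs \<subseteq> \<kappa> ` L"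
    proof
      fix w assume "w \<in> zspan vs"
      then obtain c where c: "w = \<kappa> (zcomb c (ys @ zs))" unfolding zcomb_qcomb \<kappa>c by auto
      have "set (ys @ zs) \<subseteq> L" using set_zspan[of "xs @ ys @ zs"] b(2) by auto
      then show "w \<in> \<kappa> ` L" using c add_subgroup_zcomb[OF L_group] by blast
    qed
    show "\<kappa> ` L \<subseteq> zspan vs"
    proof
      fix w assume "w \<in> \<kappa> ` L"
      then obtain c where "w = \<kappa> (zcomb c (xs @ ys @ zs))" using b(2) by auto
      then have "w = zcomb (\<lambda>i. c (length xs + i)) vs" by (simp only: zcomb_qcomb \<kappa>c \<kappa>all)
      then show "w \<in> zspan vs" by blast
    qed
  qed
  have "q_indep (us @ vs)" by (rule q_indep_appendI[OF iu iv]) (simp only: qu qv D_Int)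
  moreover have "D = qspan (us @ vs)" unfolding qspan_append qu qv by (rule D_eq)
  moreover have "L' = zspan (us @ vs)" unfolding zspan_append zu zv by (simp add: L'_def)
  ultimately show ?thesis unfolding full_lattice_iff by blast
qed

text \<open>The conditions come from the injectivity of \<iota> and from the kernel of \<kappa>. So
  elements of \<open>\<nn>\<close> are maps from V modulo \<open>Vm\<close> to \<open>V1\<close>,
  whereas \<open>\<gg>\<close> maps V into \<open>Vm\<close> and kills \<open>V1\<close>; this is
  why mixed products vanish.\<close>

lemma n_iff: "x \<in> \<nn> \<longleftrightarrow> x \<in> \<gg> \<and> (\<forall>a\<in>Vm. x a = 0) \<and> (\<forall>b\<in>V. x b \<in> V1)"
proof -
  have "d\<pi> x = 0 \<longleftrightarrow> (\<forall>a\<in>Vm. x a = 0) \<and> (\<forall>b\<in>V. x b \<in> V1)" if x: "x \<in> \<gg>"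
  proof
    assume z: "d\<pi> x = 0"
    show "(\<forall>a\<in>Vm. x a = 0) \<and> (\<forall>b\<in>V. x b \<in> V1)"
    proof (intro conjI ballI)
      fix a assume a: "a \<in> Vm"
      then have "\<iota> (x a) = \<iota> 0" using dpi_iota[OF g_P[OF x] a] z by (simp add: Lin_zero[OF iota Vm])
      then show "x a = 0" using iota_inj P_D(2)[OF g_P[OF x] a] Q.subspace_0[OF Vm] by (auto simp: inj_on_def)
    next
      fix b assume b: "b \<in> V"
      then have "\<kappa> (x b) = 0" using dpi_kappa[OF g_P[OF x] b] z by simp
      then show "x b \<in> V1" using kappa0[OF Lin_in[OF gLin[OF x] b]] by simp
    qed
  next
    assume a: "(\<forall>a\<in>Vm. x a = 0) \<and> (\<forall>b\<in>V. x b \<in> V1)"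
    show "d\<pi> x = 0"
    proof (rule dpi_eqI)
      fix c d assume cd: "c \<in> Vm" "d \<in> V"
      have "\<kappa> (x d) = 0" using kappa0[of "x d"] a cd V1V by auto
      then show "d\<pi> x (\<iota> c + \<kappa> d) = 0 (\<iota> c + \<kappa> d)" using a cd by (simp add: dpi[OF g_P[OF x]] Lin_zero[OF iota Vm])
    qed (simp add: dpi_out)
  qed
  then show ?thesis by (auto simp: \<nn>_def)
qed

end

section \<open>Homomorphisms modulo a subgroup\<close>

lemma zcomb_Cons: "zcomb c (x # xs) = of_int (c 0) *\<^sub>Q x + zcomb (\<lambda>i. c (Suc i)) xs"
  unfolding zcomb_def length_Cons sum.lessThan_Suc_shift by simp

lemma (in group) power_product_subgroup:
  assumes "subgroup H G" "set gs \<subseteq> H" "length e = length gs" shows "power_product G gs e \<in> H"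
  using assms(2,3)
proof (induction gs arbitrary: e)
  case Nil then show ?case using subgroup.one_closed[OF assms(1)] by (simp add: power_product_simps)
next
  case (Cons g gs)
  obtain a e' where e: "e = a # e'" using Cons.prems by (cases e) auto
  show ?case unfolding e power_product_simps
    by (rule subgroup.m_closed[OF assms(1)]) (use Cons e int_pow_subgroup[OF assms(1)] in auto)
qed

lemma (in group) power_product_hom:
  assumes H: "subgroup H G" and G': "group G'" and \<pi>: "\<And>x. x \<in> H \<Longrightarrow> \<pi> x \<in> carrier G'"
    "\<And>x y. x \<in> H \<Longrightarrow> y \<in> H \<Longrightarrow> \<pi> (x \<otimes> y) = \<pi> x \<otimes>\<^bsub>G'\<^esub> \<pi> y"
    and gs: "set gs \<subseteq> H" "length e = length gs"
  shows "\<pi> (power_product G gs e) = power_product G' (map \<pi> gs) e"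
proof -
  interpret G': group G' by fact
  interpret h: group_hom "G\<lparr>carrier := H\<rparr>" G' \<pi>
    by (rule group_hom.intro[OF subgroup_imp_group[OF H] G']) (simp add: group_hom_axioms_def hom_def \<pi>)
  have p: "\<pi> (x [^] (m::int)) = \<pi> x [^]\<^bsub>G'\<^esub> m" if "x \<in> H" for x m
    using h.hom_int_pow[of x m] int_pow_consistent[OF H that, of m] that by simp
  show ?thesis using gs
  proof (induction gs arbitrary: e)
    case Nil then show ?case using h.hom_one by (simp add: power_product_simps G'.power_product_simps)
  next
    case (Cons g gs)
    obtain a e' where e: "e = a # e'" using Cons.prems by (cases e) auto
    have "\<pi> (g [^] a \<otimes> power_product G gs e') = \<pi> (g [^] a) \<otimes>\<^bsub>G'\<^esub> \<pi> (power_product G gs e')"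
      by (rule \<pi>(2)) (use Cons.prems e int_pow_subgroup[OF H] power_product_subgroup[OF H] in auto)
    then show ?case using Cons e p by (simp add: power_product_simps G'.power_product_simps)
  qed
qed

text \<open>f is a homomorphism into the quotient by \<Gamma>, expressed through representatives so
  that no quotient has to be formed.\<close>

lemma (in group) quasi_hom_inv:
  fixes f :: "'a \<Rightarrow> 'v::ab_group_add"
  assumes H: "subgroup H G" and \<Gamma>: "add_subgroup \<Gamma>" and x: "x \<in> H"
    and f: "\<And>x y. x \<in> H \<Longrightarrow> y \<in> H \<Longrightarrow> f (x \<otimes> y) - (f x + f y) \<in> \<Gamma>"
  shows "f \<one> \<in> \<Gamma>" "f (inv x) + f x \<in> \<Gamma>"
proof -
  interpret H: subgroup H G by fact
  have "f \<one> - (f \<one> + f \<one>) \<in> \<Gamma>" using f[of \<one> \<one>] by simp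
  then have "- f \<one> \<in> \<Gamma>" by simp
  then show 1: "f \<one> \<in> \<Gamma>" using add_subgroup_neg[OF \<Gamma>, of "- f \<one>"] by simp
  have "f \<one> - (f (inv x) + f x) \<in> \<Gamma>" using f[of "inv x" x] x by simp
  then show "f (inv x) + f x \<in> \<Gamma>" using add_subgroup_diff[OF \<Gamma> 1, of "f \<one> - (f (inv x) + f x)"] by (simp add: add.commute)
qed

lemma (in group) quasi_hom_power_product:
  fixes f :: "'a \<Rightarrow> 'v::rat_vector"
  assumes H: "subgroup H G" and \<Gamma>: "add_subgroup \<Gamma>"
    and f: "\<And>x y. x \<in> H \<Longrightarrow> y \<in> H \<Longrightarrow> f (x \<otimes> y) - (f x + f y) \<in> \<Gamma>"
    and gs: "set gs \<subseteq> H" "length e = length gs"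
  shows "f (power_product G gs e) - zcomb (\<lambda>i. e ! i) (map f gs) \<in> \<Gamma>"
proof -
  interpret H: subgroup H G by fact
  note inv = quasi_hom_inv[OF H \<Gamma> _ f]
  have nat: "f (x [^] n) - of_nat n *\<^sub>Q f x \<in> \<Gamma>" "x [^] n \<in> H" if x: "x \<in> H" for x and n :: nat
  proof (induction n)
    case (Suc n)
    { case 1
      have "f (x [^] n \<otimes> x) - (f (x [^] n) + f x) + (f (x [^] n) - of_nat n *\<^sub>Q f x) \<in> \<Gamma>"
        by (rule add_subgroup_add[OF \<Gamma> f]) (use Suc x in auto)
      then show ?case by (simp add: scaleQ_add_left scaleQ_one algebra_simps)
    next
      case 2 then show ?case using Suc x by simp }
  qed (use inv(1)[of \<one>] in auto)
  have int: "f (x [^] (m::int)) - of_int m *\<^sub>Q f x \<in> \<Gamma>" if x: "x \<in> H" for x m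
  proof (cases m)
    case (nonneg n) then show ?thesis using nat[OF x] by (simp add: int_pow_int)
  next
    case (neg n)
    have "f (inv (x [^] Suc n)) + f (x [^] Suc n) - (f (x [^] Suc n) - of_nat (Suc n) *\<^sub>Q f x) \<in> \<Gamma>"
      by (rule add_subgroup_diff[OF \<Gamma> inv(2) nat(1)]) (use nat(2)[OF x] x in auto)
    moreover have "f (inv (x [^] Suc n)) + f (x [^] Suc n) - (f (x [^] Suc n) - of_nat (Suc n) *\<^sub>Q f x)
       = f (inv (x [^] Suc n)) - (- of_nat (Suc n)) *\<^sub>Q f x" by (simp only: Q.scale_minus_left) simp
    moreover have "x [^] m = inv (x [^] Suc n)" using neg x int_pow_neg_int[of x "Suc n"] by simp
    moreover have "of_int m = (- of_nat (Suc n) :: rat)" using neg by simp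
    ultimately show ?thesis by (simp only:)
  qed
  show ?thesis using gs
  proof (induction gs arbitrary: e)
    case Nil then show ?case using inv(1)[of \<one>] by (simp add: power_product_simps zcomb_def)
  next
    case (Cons g gs)
    obtain a e' where e: "e = a # e'" using Cons.prems by (cases e) auto
    let ?p = "power_product G gs e'" let ?z = "zcomb (\<lambda>i. e' ! i) (map f gs)"
    have g: "g \<in> H" "set gs \<subseteq> H" "length e' = length gs" using Cons.prems e by auto
    \<comment> \<open>The defects of the product, of the power and of the remaining product add up
      to the defect in question.\<close>
    have "(f (g [^] a \<otimes> ?p) - (f (g [^] a) + f ?p)) + ((f (g [^] a) - of_int a *\<^sub>Q f g) + (f ?p - ?z)) \<in> \<Gamma>"
      by (intro add_subgroup_add[OF \<Gamma>] f int_pow_subgroup[OF H] power_product_subgroup[OF H] int Cons.IH g)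
    moreover have "(f (g [^] a \<otimes> ?p) - (f (g [^] a) + f ?p)) + ((f (g [^] a) - of_int a *\<^sub>Q f g) + (f ?p - ?z))
      = f (g [^] a \<otimes> ?p) - (of_int a *\<^sub>Q f g + ?z)" by (simp add: algebra_simps)
    ultimately show ?case unfolding e power_product_simps list.map zcomb_Cons by simp
  qed
qed

text \<open>The j-th subgroup consists of the images of the combinations whose first j coefficients
  vanish, and the j-th coordinate is the j-th coefficient. Commutators are trivial because addition
  is commutative.\<close>

lemma (in group) T_chain_free:
  assumes b: "z_basis xs A" and E: "\<And>x y. x \<in> A \<Longrightarrow> y \<in> A \<Longrightarrow> E (x + y) = E x \<otimes> E y"
    and Ec: "\<And>x. x \<in> A \<Longrightarrow> E x \<in> carrier G" and inj: "inj_on E A"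
  shows "\<exists>B \<psi>. T_chain G (E ` A) (map E xs) B \<psi>"
proof -
  let ?l = "length xs"
  have A: "A = zspan xs" and ind: "q_indep xs" using b by (auto simp: z_basis_iff)
  have zA: "zcomb c xs \<in> A" for c using A by blast
  \<comment> \<open>A choice of coefficients; since E is injective on A and \<open>xs\<close> is
    independent, it is determined at all indices below the length of \<open>xs\<close>.\<close>
  define cf where "cf g = (SOME c. g = E (zcomb c xs))" for g
  have cf: "cf (E (zcomb c xs)) i = c i" if "i < ?l" for c i
  proof -
    have "E (zcomb c xs) = E (zcomb (cf (E (zcomb c xs))) xs)" unfolding cf_def by (rule someI[of _ c]) simp
    then have "zcomb c xs = zcomb (cf (E (zcomb c xs))) xs" using inj zA by (auto simp: inj_on_def)
    then show ?thesis using zcomb_unique[OF ind _ that] by metis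
  qed
  define B where "B j = (\<lambda>c. E (zcomb c xs)) ` {c. \<forall>i<j. c i = 0}" for j
  define \<psi> where "\<psi> j g = cf g j" for j g
  have mult: "E (zcomb c xs) \<otimes> E (zcomb d xs) = E (zcomb (\<lambda>i. c i + d i) xs)" for c d
    by (simp add: E[OF zA zA, symmetric] zcomb_add)
  have Bi: "E (zcomb c xs) \<in> B j" if "\<forall>i<j. c i = 0" for c j using that by (auto simp: B_def)
  have E1: "E (zcomb (\<lambda>i. 0) xs) = \<one>"
    using mult[of "\<lambda>i. 0" "\<lambda>i. 0"] Ec[OF zA, of "\<lambda>i. 0"] by (simp add: l_cancel_one')
  have Einv: "inv (E (zcomb c xs)) = E (zcomb (\<lambda>i. - c i) xs)" for c
    using mult[of "\<lambda>i. - c i" c] E1 by (intro inv_equality Ec[OF zA]) simp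
  have sub: "subgroup (B j) G" for j
  proof (rule subgroupI)
    show "B j \<noteq> {}" using Bi[of j "\<lambda>i. 0"] by auto
    show "B j \<subseteq> carrier G" using Ec[OF zA] by (auto simp: B_def)
    fix a b assume "a \<in> B j" "b \<in> B j"
    then obtain c d where "a = E (zcomb c xs)" "b = E (zcomb d xs)" "\<forall>i<j. c i = 0" "\<forall>i<j. d i = 0" by (auto simp: B_def)
    then show "a \<otimes> b \<in> B j" using mult Bi[of j "\<lambda>i. c i + d i"] by simp
  next
    fix a assume "a \<in> B j"
    then obtain c where "a = E (zcomb c xs)" "\<forall>i<j. c i = 0" by (auto simp: B_def)
    then show "inv a \<in> B j" using Einv Bi[of j "\<lambda>i. - c i"] by simp
  qed
  have BA: "B j \<subseteq> E ` A" for j using zA by (auto simp: B_def)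
  have com: "inv h \<otimes> inv x \<otimes> h \<otimes> x = \<one>" if h: "h \<in> E ` A" and x: "x \<in> E ` A" for h x
  proof -
    obtain a b where ab: "h = E a" "x = E b" "a \<in> A" "b \<in> A" using h x by auto
    then have "h \<otimes> x = x \<otimes> h" using E[OF ab(3,4)] E[OF ab(4,3)] by (simp add: add.commute)
    then have "inv h \<otimes> inv x \<otimes> h \<otimes> x = inv h \<otimes> inv x \<otimes> (x \<otimes> h)" using ab Ec by (simp add: m_assoc)
    then show ?thesis using ab Ec by (simp add: m_assoc inv_solve_left')
  qed
  have "T_chain G (E ` A) (map E xs) B \<psi>"
    unfolding T_chain_def
  proof (intro conjI allI impI ballI)
    show "B 0 = E ` A" using A by (auto simp: B_def)
    show "B (length (map E xs)) = {\<one>}"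
    proof
      show "B (length (map E xs)) \<subseteq> {\<one>}"
      proof
        fix g assume "g \<in> B (length (map E xs))"
        then obtain c where c: "g = E (zcomb c xs)" "\<forall>i<?l. c i = 0" by (auto simp: B_def)
        then have "zcomb c xs = zcomb (\<lambda>i. 0) xs" by (intro zcomb_cong) auto
        then show "g \<in> {\<one>}" using c(1) E1 by simp
      qed
    qed (use subgroup.one_closed[OF sub] in auto)
    show "subgroup (B i) G" for i by (rule sub)
    fix i assume "i < length (map E xs)"
    then have i: "i < ?l" by simp
    let ?u = "\<lambda>k. if k = i then 1 else 0 :: int"
    have xi: "map E xs ! i = E (zcomb ?u xs)" using i by (simp add: zcomb_unit)
    show "map E xs ! i \<in> B i" unfolding xi by (rule Bi) simp
    show "\<psi> i (map E xs ! i) = 1" unfolding xi \<psi>_def using cf[OF i, of ?u] by simp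
    show "\<psi> i (x \<otimes> y) = \<psi> i x + \<psi> i y" if "x \<in> B i" "y \<in> B i" for x y
      using that by (auto simp: B_def mult \<psi>_def cf[OF i])
    show "B (Suc i) = {x \<in> B i. \<psi> i x = 0}"
      by (auto simp: B_def \<psi>_def cf[OF i] less_Suc_eq)
    show "inv h \<otimes> inv x \<otimes> h \<otimes> x \<in> B (Suc i)" if "h \<in> E ` A" "x \<in> B i" for h x
      using com[OF that(1), of x] BA[of i] that(2) subgroup.one_closed[OF sub] by auto
  qed
  then show ?thesis by blast
qed

section \<open>One level of the algorithm\<close>

context derived
begin

lemma exp_fix: "z \<in> \<gg> \<Longrightarrow> v \<in> V1 \<Longrightarrow> nil_exp V z v = v"
proof -
  assume z: "z \<in> \<gg>" and v: "v \<in> V1"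
  obtain s where s: "s \<in> Lin V V" "nil_exp V z - idmap V = s \<circ> z" using nil_exp_decomp[OF nilp[OF z]] by metis
  have "(nil_exp V z - idmap V) v = 0" unfolding s(2) by (simp add: gV1[OF z v] Lin_zero[OF s(1) V])
  then show ?thesis using v V1V by (auto simp: idmap_def)
qed

lemma exp_diff: "z \<in> \<gg> \<Longrightarrow> v \<in> V \<Longrightarrow> nil_exp V z v - v \<in> Vm"
proof -
  assume z: "z \<in> \<gg>" and v: "v \<in> V"
  obtain s where s: "s \<in> Lin V V" "nil_exp V z - idmap V = z \<circ> s" using nil_exp_decomp[OF nilp[OF z]] by metis
  have "nil_exp V z v - v = z (s v)" using fun_cong[OF s(2), of v] v by (simp add: idmap_def)
  then show ?thesis using gV[OF z Lin_in[OF s(1) v]] by simp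
qed

lemma exp_in: "z \<in> \<gg> \<Longrightarrow> v \<in> V \<Longrightarrow> nil_exp V z v \<in> V"
  by (rule Lin_in[OF nil_exp_Lin[OF nilp]])

lemma n_g: "x \<in> \<nn> \<Longrightarrow> x \<in> \<gg>" and n_Vm: "x \<in> \<nn> \<Longrightarrow> a \<in> Vm \<Longrightarrow> x a = 0" and n_V1: "x \<in> \<nn> \<Longrightarrow> b \<in> V \<Longrightarrow> x b \<in> V1"
  by (auto simp: n_iff)

lemma n_sub: "Q.subspace \<nn>"
  unfolding Q.subspace_def n_iff
proof (intro conjI ballI allI)
  fix x y a assume "x \<in> \<nn>" "y \<in> \<nn>"
  note xy = this
  show "x + y \<in> \<gg>" by (rule Q.subspace_add[OF gsub n_g[OF xy(1)] n_g[OF xy(2)]])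
  show "(x + y) a = 0" if "a \<in> Vm" using n_Vm[OF xy(1) that] n_Vm[OF xy(2) that] by simp
  show "(x + y) a \<in> V1" if "a \<in> V" using Q.subspace_add[OF V1 n_V1[OF xy(1) that] n_V1[OF xy(2) that]] by simp
next
  fix x a q assume x: "x \<in> \<nn>"
  show "q *\<^sub>Q x \<in> \<gg>" by (rule Q.subspace_scale[OF gsub n_g[OF x]])
  show "(q *\<^sub>Q x) a = 0" if "a \<in> Vm" using n_Vm[OF x that] by (simp add: scaleQ_fun_def)
  show "(q *\<^sub>Q x) a \<in> V1" if "a \<in> V" using Q.subspace_scale[OF V1 n_V1[OF x that]] by (simp add: scaleQ_fun_def)
qed (use Q.subspace_0[OF gsub] Q.subspace_0[OF V1] in simp_all)

text \<open>x maps V into \<open>V1\<close>, which lies in \<open>Vm\<close>, and kills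
  \<open>Vm\<close>; so its square is zero.\<close>

lemma exp_n: assumes x: "x \<in> \<nn>" shows "nil_exp V x = idmap V + x"
  by (rule nil_exp_square_zero[OF V gLin[OF n_g[OF x]]]) (use n_Vm[OF x] n_V1[OF x] V1m in auto)

lemma exp_n_apply: "x \<in> \<nn> \<Longrightarrow> v \<in> V \<Longrightarrow> nil_exp V x v = v + x v"
  by (simp add: exp_n idmap_def)

lemma exp_n_add: assumes x: "x \<in> \<nn>" and y: "y \<in> \<nn>" shows "nil_exp V (x + y) = nil_exp V x \<circ> nil_exp V y"
proof (rule Lin_eqI)
  have xy: "x + y \<in> \<nn>" by (rule Q.subspace_add[OF n_sub x y])
  show "nil_exp V (x + y) \<in> Lin V V" by (rule nil_exp_Lin[OF nilp[OF n_g[OF xy]]])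
  show "nil_exp V x \<circ> nil_exp V y \<in> Lin V V"
    by (rule Lin_comp[OF nil_exp_Lin[OF nilp[OF n_g[OF x]]] nil_exp_Lin[OF nilp[OF n_g[OF y]]] V])
  fix v assume v: "v \<in> V"
  have yv: "y v \<in> V" "x (y v) = 0" using n_V1[OF y v] V1V V1m n_Vm[OF x] by auto
  show "nil_exp V (x + y) v = (nil_exp V x \<circ> nil_exp V y) v"
    using v yv Q.subspace_add[OF V v yv(1)]
    by (simp add: exp_n_apply[OF xy] exp_n_apply[OF x] exp_n_apply[OF y] Lin_add[OF gLin[OF n_g[OF x]]])
qed

text \<open>exp z fixes the values of x, which lie in \<open>V1\<close>, and moves each v by an
  element of \<open>Vm\<close>, which x kills. The common value of both products shows that exp x is
  central; being a sum, it also makes \<epsilon> exactly additive on such products.\<close>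

lemma exp_n_mult: assumes z: "z \<in> \<gg>" and x: "x \<in> \<nn>"
  shows "nil_exp V z \<circ> nil_exp V x = nil_exp V z + x" "nil_exp V x \<circ> nil_exp V z = nil_exp V z + x"
proof -
  have xL: "x \<in> Lin V V" by (rule gLin[OF n_g[OF x]])
  have eL: "nil_exp V z \<in> Lin V V" "nil_exp V x \<in> Lin V V" using nil_exp_Lin nilp z n_g[OF x] by auto
  have sL: "nil_exp V z + x \<in> Lin V V" using Q.subspace_add[OF subspace_Lin[OF V] eL(1) xL] .
  show "nil_exp V z \<circ> nil_exp V x = nil_exp V z + x"
  proof (rule Lin_eqI[OF Lin_comp[OF eL V] sL])
    fix v assume v: "v \<in> V"
    show "(nil_exp V z \<circ> nil_exp V x) v = (nil_exp V z + x) v"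
      using v n_V1[OF x v] V1V by (auto simp: exp_n_apply[OF x] Lin_add[OF eL(1)] exp_fix[OF z])
  qed
  show "nil_exp V x \<circ> nil_exp V z = nil_exp V z + x"
  proof (rule Lin_eqI[OF Lin_comp[OF eL(2,1) V] sL])
    fix v assume v: "v \<in> V"
    have "x (nil_exp V z v) - x v = 0"
      using n_Vm[OF x exp_diff[OF z v]] Lin_diff[OF xL V exp_in[OF z v] v] by simp
    then show "(nil_exp V x \<circ> nil_exp V z) v = (nil_exp V z + x) v"
      using exp_in[OF z v] by (simp add: exp_n_apply[OF x])
  qed
qed

section \<open>The preimage of the stabilizer of the derived lattice\<close>

definition "H' = {h \<in> nil_exp V ` \<gg>. d\<pi> h \<in> stab D \<qq> L'}"

interpretation GL: group "GL V" by (rule group_GL[OF V])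
interpretation GD: group "GL D" by (rule group_GL[OF D_sub])
interpretation Dg: exp_group D \<qq> "n - 1" F' by (rule exp_group.intro[OF q_data])

lemma L'D: "L' \<subseteq> D" by (rule full_lattice_subset[OF L'_full])

lemma stabD_subgroup: "subgroup (stab D \<qq> L') (GL D)" by (rule Dg.stab_subgroup[OF L'D])

lemma dpi_mult: "x \<in> nil_exp V ` \<gg> \<Longrightarrow> y \<in> nil_exp V ` \<gg> \<Longrightarrow> d\<pi> (x \<circ> y) = d\<pi> x \<circ> d\<pi> y"
  using dpi_comp exp_P by blast

lemma dpi_exp_in: "x \<in> nil_exp V ` \<gg> \<Longrightarrow> d\<pi> x \<in> nil_exp D ` \<qq>"
  using dpi_exp by (auto simp: \<qq>_def)

lemma dpi_inv: assumes "x \<in> nil_exp V ` \<gg>" shows "d\<pi> (inv\<^bsub>GL V\<^esub> x) = inv\<^bsub>GL D\<^esub> (d\<pi> x)"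
proof -
  obtain z where z: "z \<in> \<gg>" "x = nil_exp V z" using assms by auto
  have "d\<pi> (- z) = - d\<pi> z" using dpi_scale[OF g_P[OF z(1)], of "- 1"] by (simp add: scaleQ_one)
  then show ?thesis using z by (simp add: exp_inv dpi_exp neg nil_exp_inv[OF dpi_nilp[OF z(1)]])
qed

lemma H'_subgroup: "subgroup H' (GL V)"
proof (rule GL.subgroupI)
  interpret H: subgroup "nil_exp V ` \<gg>" "GL V" by (rule exp_subgroup)
  interpret S: subgroup "stab D \<qq> L'" "GL D" by (rule stabD_subgroup)
  show "H' \<subseteq> carrier (GL V)" using H.subset by (auto simp: H'_def)
  have i: "idmap V \<in> nil_exp V ` \<gg>" using H.one_closed by (simp add: GL_simps)
  \<comment> \<open>The image of the unit is idempotent in a group, hence it is the unit.\<close>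
  then have "d\<pi> (idmap V) = d\<pi> (idmap V) \<circ> d\<pi> (idmap V)"
    using dpi_mult[OF i i] idmap_comp[OF idmap_Lin[OF V] V] by simp
  then have "d\<pi> (idmap V) = \<one>\<^bsub>GL D\<^esub>"
    using subsetD[OF subgroup.subset[OF Dg.exp_subgroup] dpi_exp_in[OF i]] GD.l_cancel_one' by (simp add: GL_simps(2))
  then have "idmap V \<in> H'" using i S.one_closed by (simp add: H'_def)
  then show "H' \<noteq> {}" by blast
  fix a assume a: "a \<in> H'"
  then show "inv\<^bsub>GL V\<^esub> a \<in> H'" using H.m_inv_closed[of a] S.m_inv_closed[of "d\<pi> a"] by (simp add: H'_def dpi_inv)
  fix b assume b: "b \<in> H'"
  then show "a \<otimes>\<^bsub>GL V\<^esub> b \<in> H'"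
    using a H.m_closed[of a b] S.m_closed[of "d\<pi> a" "d\<pi> b"] by (simp add: H'_def dpi_mult GL_simps)
qed

text \<open>The element (a, 0) lies in the derived lattice, and so does its image, whose first
  component is determined uniquely.\<close>

lemma H'_Vm: assumes "h \<in> H'" "a \<in> L \<inter> Vm" shows "h a \<in> L \<inter> Vm"
proof -
  obtain z where z: "z \<in> \<gg>" "h = nil_exp V z" using assms by (auto simp: H'_def)
  have hP: "h \<in> P" using exp_P z by simp
  have 0: "0 \<in> L" by (rule add_subgroup_0[OF L_group])
  have "\<iota> a + \<kappa> 0 \<in> L'" using assms 0 by (auto simp: L'_def set_sum_def)
  then have "d\<pi> h (\<iota> a + \<kappa> 0) \<in> L'" using assms(1) by (auto simp: H'_def stab_def)
  then have "\<iota> (h a) + \<kappa> (h 0) \<in> L'" using dpi[OF hP] assms LV 0 by auto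
  then obtain a' l where a': "a' \<in> L \<inter> Vm" "l \<in> L" "\<iota> (h a) + \<kappa> (h 0) = \<iota> a' + \<kappa> l" by (auto simp: L'_def set_sum_def)
  have "h a = a'" by (rule D_unique(1)[OF _ _ _ _ a'(3)]) (use a' assms P_D[OF hP] Lin_in[OF P_D(1)[OF hP]] LV 0 in auto)
  then show ?thesis using a' by simp
qed

text \<open>The second component of the image of (0, b) determines h b only modulo
  \<open>V1\<close>. The missing component in \<open>V1\<close> is what \<epsilon> measures.\<close>

lemma H'_L: assumes "h \<in> H'" "b \<in> L" obtains l where "l \<in> L" "h b - l \<in> V1"
proof -
  obtain z where z: "z \<in> \<gg>" "h = nil_exp V z" using assms by (auto simp: H'_def)
  have hP: "h \<in> P" using exp_P z by simp
  have 0: "0 \<in> L \<inter> Vm" using add_subgroup_0[OF L_group] Q.subspace_0[OF Vm] by simp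
  have "\<iota> 0 + \<kappa> b \<in> L'" using assms 0 by (auto simp: L'_def set_sum_def)
  then have "d\<pi> h (\<iota> 0 + \<kappa> b) \<in> L'" using assms(1) by (auto simp: H'_def stab_def)
  then have "\<iota> (h 0) + \<kappa> (h b) \<in> L'" using dpi[OF hP, of 0 b] assms LV 0 by auto
  then obtain a' l where a': "a' \<in> L \<inter> Vm" "l \<in> L" "\<iota> (h 0) + \<kappa> (h b) = \<iota> a' + \<kappa> l" by (auto simp: L'_def set_sum_def)
  have "h b - l \<in> V1" by (rule D_unique(2)[OF _ _ _ _ a'(3)]) (use a' assms P_D[OF hP] Lin_in[OF P_D(1)[OF hP]] LV 0 in auto)
  then show ?thesis using that a' by blast
qed

lemma stab_H': assumes "h \<in> stab V \<gg> L" shows "h \<in> H'"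
proof -
  interpret S: subgroup "stab V \<gg> L" "GL V" by (rule stab_subgroup[OF LV])
  have sub: "d\<pi> k ` L' \<subseteq> L'" if k: "k \<in> stab V \<gg> L" for k
  proof
    fix w assume "w \<in> d\<pi> k ` L'"
    then obtain a b where ab: "a \<in> L \<inter> Vm" "b \<in> L" "w = d\<pi> k (\<iota> a + \<kappa> b)" by (auto simp: L'_def set_sum_def)
    have kP: "k \<in> P" and kL: "k ` L = L" using k exp_P by (auto simp: stab_def)
    have "w = \<iota> (k a) + \<kappa> (k b)" unfolding ab(3) by (rule dpi[OF kP]) (use ab LV in auto)
    moreover have "k a \<in> L \<inter> Vm" "k b \<in> L" using ab kL P_D(2)[OF kP] by auto
    ultimately show "w \<in> L'" by (auto simp: L'_def set_sum_def)
  qed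
  have h: "h \<in> nil_exp V ` \<gg>" using assms by (simp add: stab_def)
  have "d\<pi> h \<in> stab D \<qq> L'"
    by (rule Dg.stabI[OF dpi_exp_in[OF h] sub[OF assms] _ L'D])
      (use sub[OF S.m_inv_closed[OF assms]] dpi_inv[OF h] in simp)
  then show ?thesis using h by (simp add: H'_def)
qed

text \<open>The exponential is injective on nilpotent maps because log inverts it, so a trivial
  image of exp z forces \<open>d\<pi> z = 0\<close>.\<close>

lemma kernel: assumes "h \<in> nil_exp V ` \<gg>" "d\<pi> h = \<one>\<^bsub>GL D\<^esub>" obtains x where "x \<in> \<nn>" "h = nil_exp V x"
proof -
  obtain z where z: "z \<in> \<gg>" "h = nil_exp V z" using assms by auto
  have "nil_exp D (d\<pi> z) = idmap D" using assms(2) z by (simp add: dpi_exp GL_simps)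
  then have "d\<pi> z = unip_log D (nil_exp D 0)" using unip_log_nil_exp[OF dpi_nilp[OF z(1)]] nil_exp_0[OF D_sub] by simp
  moreover have "nilp D (n - 1) 0" using Dg.nilp[OF Q.subspace_0[OF q_sub]] .
  ultimately have "d\<pi> z = 0" using unip_log_nil_exp by metis
  then show ?thesis using that z by (auto simp: \<nn>_def)
qed

lemma dpi_exp_n: "x \<in> \<nn> \<Longrightarrow> d\<pi> (nil_exp V x) = \<one>\<^bsub>GL D\<^esub>"
  using dpi_exp[of x] by (simp add: \<nn>_def nil_exp_0[OF D_sub] GL_simps)

end

section \<open>The map \<epsilon> and the lattice \<Gamma> for a fixed pair of L-complements\<close>

locale step = derived V \<gg> n F L D \<iota> \<kappa>
  for V :: "'v::rat_vector set" and \<gg> n F and L :: "'v set" and D :: "'u::rat_vector set" and \<iota> \<kappa> +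
  fixes W1 Wm :: "'v set"
  assumes W: "(W1, Wm) \<in> L_complements V L (F 1) (F (n - 1))"
begin

text \<open>This and the next definitions repeat expressions of \<open>main_step\<close>, so that
  unfolding them turns \<open>tail\<close> into the goal for the algorithm.\<close>

definition "p = projection V1 W1"
definition "\<epsilon> = (\<lambda>\<phi> w. if w \<in> Wm then p (\<phi> w) else 0)"
definition "\<Gamma> = {\<gamma> \<in> Lin Wm V1. \<gamma> ` (L \<inter> Wm) \<subseteq> L \<inter> V1}"
definition "\<nn>\<^sub>L = {x \<in> \<nn>. \<epsilon> x \<in> \<Gamma>}"
definition "W' = \<epsilon> ` \<nn>"

lemma Wm1: "Wm \<subseteq> W1" and W1: "Q.subspace W1" and Wm: "Q.subspace Wm"
  and W1_Int: "V1 \<inter> W1 = {0}" and W1_sum: "set_sum V1 W1 = V" and Wm_sum: "set_sum Vm Wm = V"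
  and LW1: "set_sum (L \<inter> V1) (L \<inter> W1) = L" and LWm: "set_sum (L \<inter> Vm) (L \<inter> Wm) = L"
  using W by (auto simp: L_complements_def direct_sum_def)

lemma WmV: "Wm \<subseteq> V"
proof
  fix w assume "w \<in> Wm"
  then have "0 + w \<in> set_sum Vm Wm" using Q.subspace_0[OF Vm] unfolding set_sum_def by blast
  then show "w \<in> V" using Wm_sum by simp
qed

lemma p_eq: assumes "u \<in> V1" "v - u \<in> W1" shows "p v = u"
  unfolding p_def projection_def
proof (rule the_equality)
  fix u' assume u': "u' \<in> V1 \<and> v - u' \<in> W1"
  then have "u' - u \<in> V1" "(v - u) - (v - u') \<in> W1"
    using Q.subspace_diff[OF V1] Q.subspace_diff[OF W1] assms by blast+
  then have "u' - u \<in> V1 \<inter> W1" by simp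
  then have "u' - u \<in> {0}" unfolding W1_Int .
  then show "u' = u" by simp
qed (use assms in auto)

lemma p_in: assumes "v \<in> V" shows "p v \<in> V1" "v - p v \<in> W1"
proof -
  obtain u w where uw: "u \<in> V1" "w \<in> W1" "v = u + w" using assms W1_sum by (auto simp: set_sum_def)
  then have "p v = u" by (intro p_eq) auto
  then show "p v \<in> V1" "v - p v \<in> W1" using uw by auto
qed

lemma p_add: "v \<in> V \<Longrightarrow> w \<in> V \<Longrightarrow> p (v + w) = p v + p w"
  by (rule p_eq[OF Q.subspace_add[OF V1]])
    (use p_in Q.subspace_add[OF W1, of "v - p v" "w - p w"] in \<open>auto simp: algebra_simps\<close>)

lemma p_scale: "v \<in> V \<Longrightarrow> p (q *\<^sub>Q v) = q *\<^sub>Q p v"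
  by (rule p_eq[OF Q.subspace_scale[OF V1]])
    (use p_in Q.subspace_scale[OF W1, of "v - p v" q] in \<open>auto simp: Q.scale_right_diff_distrib\<close>)

lemma p_V1: "u \<in> V1 \<Longrightarrow> p u = u"
  using p_eq[of u u] Q.subspace_0[OF W1] by simp

lemma p_W1: "w \<in> W1 \<Longrightarrow> p w = 0"
  using p_eq[of 0 w] Q.subspace_0[OF V1] by simp

lemma p_L: assumes "l \<in> L" shows "p l \<in> L \<inter> V1" "l - p l \<in> L \<inter> W1"
proof -
  have "l \<in> set_sum (L \<inter> V1) (L \<inter> W1)" unfolding LW1 by (rule assms)
  then obtain u w where uw: "u \<in> L \<inter> V1" "w \<in> L \<inter> W1" "l = u + w" by (auto simp: set_sum_def)
  then have "p l = u" by (intro p_eq) auto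
  then show "p l \<in> L \<inter> V1" "l - p l \<in> L \<inter> W1" using uw by auto
qed

lemma eps_Lin: assumes "\<phi> \<in> Lin V V" shows "\<epsilon> \<phi> \<in> Lin Wm V1"
proof (rule LinI)
  fix w q assume w: "w \<in> Wm"
  then have wV: "w \<in> V" using WmV by auto
  show "\<epsilon> \<phi> w \<in> V1" using w p_in[OF Lin_in[OF assms wV]] by (simp add: \<epsilon>_def)
  show "\<epsilon> \<phi> (q *\<^sub>Q w) = q *\<^sub>Q \<epsilon> \<phi> w"
    using w Q.subspace_scale[OF Wm w] by (simp add: \<epsilon>_def Lin_scale[OF assms wV] p_scale[OF Lin_in[OF assms wV]])
  fix w' assume w': "w' \<in> Wm"
  then have wV': "w' \<in> V" using WmV by auto
  show "\<epsilon> \<phi> (w + w') = \<epsilon> \<phi> w + \<epsilon> \<phi> w'"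
    using w w' Q.subspace_add[OF Wm w w']
    by (simp add: \<epsilon>_def Lin_add[OF assms wV wV'] p_add[OF Lin_in[OF assms wV] Lin_in[OF assms wV']])
qed (simp add: \<epsilon>_def)

lemma eps_add: assumes "\<phi> \<in> Lin V V" "\<psi> \<in> Lin V V" shows "\<epsilon> (\<phi> + \<psi>) = \<epsilon> \<phi> + \<epsilon> \<psi>"
  using WmV by (auto simp: fun_eq_iff \<epsilon>_def p_add Lin_in[OF assms(1)] Lin_in[OF assms(2)] subset_iff)

lemma eps_scale: assumes "\<phi> \<in> Lin V V" shows "\<epsilon> (q *\<^sub>Q \<phi>) = q *\<^sub>Q \<epsilon> \<phi>"
  using WmV by (auto simp: fun_eq_iff \<epsilon>_def scaleQ_fun_def p_scale Lin_in[OF assms(1)] subset_iff)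

lemma eps_neg: assumes "\<phi> \<in> Lin V V" shows "\<epsilon> (- \<phi>) = - \<epsilon> \<phi>"
  using eps_scale[OF assms, of "- 1"] by (simp add: scaleQ_one)

lemma n_Lin: "x \<in> \<nn> \<Longrightarrow> x \<in> Lin V V" using gLin n_g by blast

lemma eps_n: "x \<in> \<nn> \<Longrightarrow> w \<in> Wm \<Longrightarrow> \<epsilon> x w = x w"
  using p_V1 n_V1 WmV by (auto simp: \<epsilon>_def)

text \<open>Elements of \<open>\<nn>\<close> vanish on \<open>Vm\<close> and are determined by their
  values on the complement \<open>Wm\<close>. This is the uniqueness that \<open>the_only\<close>
  demands.\<close>

lemma eps_inj: assumes "x \<in> \<nn>" "y \<in> \<nn>" "\<epsilon> x = \<epsilon> y" shows "x = y"
proof (rule Lin_eqI[OF n_Lin[OF assms(1)] n_Lin[OF assms(2)]])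
  fix v assume "v \<in> V"
  then obtain a w where aw: "a \<in> Vm" "w \<in> Wm" "v = a + w" using Wm_sum by (auto simp: set_sum_def)
  have "x w = y w" using eps_n[OF assms(1) aw(2)] eps_n[OF assms(2) aw(2)] assms(3) by simp
  moreover have "a \<in> V" "w \<in> V" using aw VmV WmV by auto
  ultimately show "x v = y v" using n_Vm[OF assms(1) aw(1)] n_Vm[OF assms(2) aw(1)]
    by (simp add: aw(3) Lin_add[OF n_Lin[OF assms(1)]] Lin_add[OF n_Lin[OF assms(2)]])
qed

lemma Gamma_group: "add_subgroup \<Gamma>"
  unfolding add_subgroup_def
proof (intro conjI ballI)
  have 0: "0 \<in> L" by (rule add_subgroup_0[OF L_group])
  show "0 \<in> \<Gamma>" using Q.subspace_0[OF subspace_Lin[OF V1, of Wm]] 0 Q.subspace_0[OF V1] by (auto simp: \<Gamma>_def)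
  fix x y assume xy: "x \<in> \<Gamma>" "y \<in> \<Gamma>"
  then have "x - y \<in> Lin Wm V1" using Q.subspace_diff[OF subspace_Lin[OF V1, of Wm]] by (auto simp: \<Gamma>_def)
  moreover have "(x - y) w \<in> L \<inter> V1" if "w \<in> L \<inter> Wm" for w
  proof -
    have "x w \<in> L \<inter> V1" "y w \<in> L \<inter> V1" using that xy by (auto simp: \<Gamma>_def)
    then show ?thesis using add_subgroup_diff[OF L_group, of "x w" "y w"] Q.subspace_diff[OF V1, of "x w" "y w"] by simp
  qed
  ultimately show "x - y \<in> \<Gamma>" by (auto simp: \<Gamma>_def)
qed

lemma W'_sub: "Q.subspace W'"
  unfolding Q.subspace_def W'_def
proof (intro conjI ballI allI)
  have "\<epsilon> 0 = 0" using eps_scale[of 0 0] Q.subspace_0[OF subspace_Lin[OF V, of V]] by simp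
  then show "0 \<in> \<epsilon> ` \<nn>" using Q.subspace_0[OF n_sub] by (metis image_eqI)
next
  fix x y assume "x \<in> \<epsilon> ` \<nn>" "y \<in> \<epsilon> ` \<nn>"
  then obtain a b where "x = \<epsilon> a" "y = \<epsilon> b" "a \<in> \<nn>" "b \<in> \<nn>" by auto
  then show "x + y \<in> \<epsilon> ` \<nn>" using eps_add[OF n_Lin n_Lin, of a b] Q.subspace_add[OF n_sub, of a b] by (metis image_eqI)
next
  fix q x assume "x \<in> \<epsilon> ` \<nn>"
  then obtain a where "x = \<epsilon> a" "a \<in> \<nn>" by auto
  then show "q *\<^sub>Q x \<in> \<epsilon> ` \<nn>" using eps_scale[OF n_Lin, of a q] Q.subspace_scale[OF n_sub, of a q] by (metis image_eqI)
qed

lemma GW_group: "add_subgroup (set_sum \<Gamma> W')"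
  by (rule set_sum_group[OF Gamma_group add_subgroup_subspace[OF W'_sub]])

text \<open>Additivity is exact here and not only modulo \<Gamma>; therefore the correction by
  \<open>n_w\<close> in the algorithm removes the component \<open>v\<close> completely.\<close>

lemma eps_exp_n:
  assumes "z \<in> \<gg>" "x \<in> \<nn>" shows "\<epsilon> (nil_exp V z \<circ> nil_exp V x) = \<epsilon> (nil_exp V z) + \<epsilon> x"
  unfolding exp_n_mult[OF assms] by (rule eps_add[OF nil_exp_Lin[OF nilp[OF assms(1)]] n_Lin[OF assms(2)]])

lemma H'_exp: "h \<in> H' \<Longrightarrow> h \<in> nil_exp V ` \<gg>" by (simp add: H'_def)

lemma H'_Lin: "h \<in> H' \<Longrightarrow> h \<in> Lin V V"
  using nil_exp_Lin[OF nilp] by (auto simp: H'_def)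

text \<open>For w in L and \<open>Wm\<close> let u = k w and m = u - p u - w. As k maps w into L up
  to \<open>V1\<close>, the difference u - p u lies in L, so m lies in L and in \<open>Vm\<close>.
  Since h fixes p u, applying p to h u = p u + h w + h m leaves the defect p (h m), and h m lies in
  L because h preserves the part of L in \<open>Vm\<close>.\<close>

lemma eps_mult: assumes h: "h \<in> H'" and k: "k \<in> H'" shows "\<epsilon> (h \<circ> k) - (\<epsilon> h + \<epsilon> k) \<in> \<Gamma>"
proof -
  obtain y z where y: "y \<in> \<gg>" "h = nil_exp V y" and z: "z \<in> \<gg>" "k = nil_exp V z" using H'_exp h k by blast
  note hL = H'_Lin[OF h] and kL = H'_Lin[OF k]
  have "\<epsilon> (h \<circ> k) \<in> Lin Wm V1" "\<epsilon> h \<in> Lin Wm V1" "\<epsilon> k \<in> Lin Wm V1"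
    using eps_Lin hL kL Lin_comp[OF hL kL V] by auto
  then have lin: "\<epsilon> (h \<circ> k) - (\<epsilon> h + \<epsilon> k) \<in> Lin Wm V1"
    by (intro Q.subspace_diff[OF subspace_Lin[OF V1]] Q.subspace_add[OF subspace_Lin[OF V1]])
  have "(\<epsilon> (h \<circ> k) - (\<epsilon> h + \<epsilon> k)) w \<in> L \<inter> V1" if w: "w \<in> L \<inter> Wm" for w
  proof -
    have wV: "w \<in> V" and wW: "w \<in> Wm" and wL: "w \<in> L" using w WmV by auto
    define u where "u = k w"
    have uV: "u \<in> V" unfolding u_def by (rule Lin_in[OF kL wV])
    have pu: "p u \<in> V1" "p u \<in> V" using p_in[OF uV] V1V by auto
    obtain l where l: "l \<in> L" "u - l \<in> V1" using H'_L[OF k wL] unfolding u_def by blast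
    have "p u = (u - l) + p l"
      by (rule p_eq[OF Q.subspace_add[OF V1 l(2)]]) (use p_L[OF l(1)] in auto)
    then have "u - p u = l - p l" by simp
    then have upL: "u - p u \<in> L" using p_L[OF l(1)] by simp
    \<comment> \<open>m collects the movement of w by k that stays in the lattice after the
      component p u in \<open>V1\<close> has been split off.\<close>
    define m where "m = u - p u - w"
    have "u - w \<in> Vm" unfolding u_def z(2) by (rule exp_diff[OF z(1) wV])
    then have "(u - w) - p u \<in> Vm" using pu V1m Q.subspace_diff[OF Vm] by blast
    then have m: "m \<in> L \<inter> Vm" using add_subgroup_diff[OF L_group upL wL] by (simp add: m_def algebra_simps)
    then have mV: "m \<in> V" using VmV by auto
    have hm: "h m \<in> L \<inter> Vm" by (rule H'_Vm[OF h m])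
    then have hmV: "h m \<in> V" using VmV by auto
    have "u = p u + (w + m)" by (simp add: m_def)
    then have "h u = h (p u + (w + m))" by simp
    also have "\<dots> = h (p u) + (h w + h m)"
      using Lin_add[OF hL pu(2) Q.subspace_add[OF V wV mV]] Lin_add[OF hL wV mV] by simp
    also have "h (p u) = p u" unfolding y(2) by (rule exp_fix[OF y(1) pu(1)])
    finally have "p (h u) = p (p u) + (p (h w) + p (h m))"
      using p_add[OF pu(2) Q.subspace_add[OF V Lin_in[OF hL wV] hmV]] p_add[OF Lin_in[OF hL wV] hmV] by simp
    then have "(\<epsilon> (h \<circ> k) - (\<epsilon> h + \<epsilon> k)) w = p (h m)"
      using wW p_V1[OF pu(1)] by (simp add: \<epsilon>_def u_def)
    then show ?thesis using p_L(1)[of "h m"] hm by simp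
  qed
  then show ?thesis using lin by (auto simp: \<Gamma>_def)
qed

interpretation GL: group "GL V" by (rule group_GL[OF V])
interpretation GD: group "GL D" by (rule group_GL[OF D_sub])
interpretation Dg: exp_group D \<qq> "n - 1" F' by (rule exp_group.intro[OF q_data])
interpretation H': subgroup H' "GL V" by (rule H'_subgroup)

lemma eps_mult': "h \<in> H' \<Longrightarrow> k \<in> H' \<Longrightarrow> \<epsilon> (h \<otimes>\<^bsub>GL V\<^esub> k) - (\<epsilon> h + \<epsilon> k) \<in> \<Gamma>"
  using eps_mult by (simp add: GL_simps)

text \<open>L is the sum of its parts in \<open>Vm\<close> and \<open>Wm\<close>. The first is
  preserved by all of \<open>H'\<close>. For w in the second, k w lies in L up to an element of
  \<open>V1\<close>, so it lies in L as soon as its component \<open>\<epsilon> k w\<close>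
  does.\<close>

lemma stab_iff: "h \<in> stab V \<gg> L \<longleftrightarrow> h \<in> H' \<and> \<epsilon> h \<in> \<Gamma>"
proof
  assume h: "h \<in> stab V \<gg> L"
  then have H: "h \<in> H'" and hL: "h ` L = L" using stab_H' by (auto simp: stab_def)
  have "\<epsilon> h w \<in> L \<inter> V1" if "w \<in> L \<inter> Wm" for w using that hL p_L(1)[of "h w"] by (auto simp: \<epsilon>_def)
  then show "h \<in> H' \<and> \<epsilon> h \<in> \<Gamma>" using H eps_Lin[OF H'_Lin[OF H]] by (auto simp: \<Gamma>_def)
next
  assume "h \<in> H' \<and> \<epsilon> h \<in> \<Gamma>"
  then have h: "h \<in> H'" "\<epsilon> h \<in> \<Gamma>" by auto
  have sub: "k ` L \<subseteq> L" if k: "k \<in> H'" "\<epsilon> k \<in> \<Gamma>" for k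
  proof
    fix x assume "x \<in> k ` L"
    then obtain l where l: "l \<in> L" "x = k l" by auto
    have "l \<in> set_sum (L \<inter> Vm) (L \<inter> Wm)" unfolding LWm by (rule l(1))
    then obtain a w where aw: "a \<in> L \<inter> Vm" "w \<in> L \<inter> Wm" "l = a + w" by (auto simp: set_sum_def)
    have V: "a \<in> V" "w \<in> V" "k w \<in> V" using aw LV Lin_in[OF H'_Lin[OF k(1)]] by auto
    have "\<epsilon> k w \<in> L" using k(2) aw(2) by (auto simp: \<Gamma>_def)
    then have pk: "p (k w) \<in> L" using aw by (simp add: \<epsilon>_def)
    obtain l' where l': "l' \<in> L" "k w - l' \<in> V1" using H'_L[OF k(1), of w] aw(2) by blast
    have "p (k w) = (k w - l') + p l'"
      by (rule p_eq[OF Q.subspace_add[OF V1 l'(2)]]) (use p_L[OF l'(1)] in auto)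
    then have "k w = p (k w) + (l' - p l')" by simp
    moreover have "p (k w) + (l' - p l') \<in> L" using add_subgroup_add[OF L_group pk] p_L(2)[OF l'(1)] by blast
    ultimately have "k w \<in> L" by (simp only:)
    then show "x \<in> L" using l aw V H'_Vm[OF k(1) aw(1)] Lin_add[OF H'_Lin[OF k(1)], of a w]
      add_subgroup_add[OF L_group, of "k a" "k w"] by auto
  qed
  have i: "inv\<^bsub>GL V\<^esub> h \<in> H'" using h by simp
  have "\<epsilon> (inv\<^bsub>GL V\<^esub> h) + \<epsilon> h \<in> \<Gamma>" by (rule GL.quasi_hom_inv(2)[OF H'_subgroup Gamma_group h(1) eps_mult'])
  then have "\<epsilon> (inv\<^bsub>GL V\<^esub> h) + \<epsilon> h - \<epsilon> h \<in> \<Gamma>" using add_subgroup_diff[OF Gamma_group _ h(2)] by blast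
  then have "\<epsilon> (inv\<^bsub>GL V\<^esub> h) \<in> \<Gamma>" by simp
  then show "h \<in> stab V \<gg> L" using stabI[OF H'_exp[OF h(1)] sub[OF h] sub[OF i] LV] by blast
qed

lemma full_V1: "full_lattice V1 (L \<inter> V1)" and full_Wm: "full_lattice Wm (L \<inter> Wm)"
  using full_lattice_Int[OF L V1 V1V] full_lattice_Int[OF L Wm WmV] by auto

text \<open>Every vector of \<open>V1\<close> has a positive multiple in the lattice, and it
  suffices to find a common multiplier for the finitely many values on a basis of the lattice of
  \<open>Wm\<close>. This is the source of the full rank of the relation lattice.\<close>

lemma Gamma_torsion: assumes "\<gamma> \<in> Lin Wm V1" shows "\<exists>m>0. of_int m *\<^sub>Q \<gamma> \<in> \<Gamma>"
proof -
  obtain cs where cs: "Wm = qspan cs" "L \<inter> Wm = zspan cs" using full_Wm by (auto simp: full_lattice_iff)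
  obtain us where us: "V1 = qspan us" "L \<inter> V1 = zspan us" using full_V1 by (auto simp: full_lattice_iff)
  have g: "add_subgroup (L \<inter> V1)" unfolding us(2) by (rule add_subgroup_zspan)
  have csW: "set cs \<subseteq> Wm" using set_qspan cs by blast
  have "\<exists>m>0. \<forall>c\<in>set ds. of_int m *\<^sub>Q \<gamma> c \<in> L \<inter> V1" if "set ds \<subseteq> Wm" for ds
    using that
  proof (induction ds)
    case (Cons d ds)
    then obtain m where m: "m > 0" "\<forall>c\<in>set ds. of_int m *\<^sub>Q \<gamma> c \<in> L \<inter> V1" by auto
    have "\<gamma> d \<in> qspan us" using Lin_in[OF assms] Cons.prems us by auto
    from qspan_multiple[OF this] obtain k where k: "k > 0" "of_int k *\<^sub>Q \<gamma> d \<in> L \<inter> V1" unfolding us(2) by (elim exE conjE)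
    have "of_int (k * m) *\<^sub>Q \<gamma> c \<in> L \<inter> V1" if "c \<in> set ds" for c
      using add_subgroup_scale[OF g, of "of_int m *\<^sub>Q \<gamma> c" k] m that by (simp add: scaleQ_scaleQ)
    moreover have "of_int (k * m) *\<^sub>Q \<gamma> d \<in> L \<inter> V1"
      using add_subgroup_scale[OF g k(2), of m] by (simp add: scaleQ_scaleQ mult.commute)
    ultimately show ?case using m k by (intro exI[of _ "k * m"]) auto
  qed (auto intro: exI[of _ 1])
  then obtain m where m: "m > 0" "\<forall>c\<in>set cs. of_int m *\<^sub>Q \<gamma> c \<in> L \<inter> V1" using csW by blast
  let ?g = "of_int m *\<^sub>Q \<gamma>"
  have gL: "?g \<in> Lin Wm V1" by (rule Q.subspace_scale[OF subspace_Lin[OF V1] assms])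
  have "set (map ?g cs) \<subseteq> L \<inter> V1" using m by (auto simp: scaleQ_fun_def)
  then have "zcomb c (map ?g cs) \<in> L \<inter> V1" for c by (rule add_subgroup_zcomb[OF g])
  then have "?g (zcomb c cs) \<in> L \<inter> V1" for c
    unfolding zcomb_qcomb qcomb_map[OF gL Wm csW] .
  then have "?g \<in> \<Gamma>" unfolding \<Gamma>_def cs(2) using gL by auto
  then show ?thesis using m(1) by blast
qed

lemma nL_group: "add_subgroup \<nn>\<^sub>L"
  unfolding add_subgroup_def
proof (intro conjI ballI)
  have "\<epsilon> 0 = 0" using eps_scale[of 0 0] Q.subspace_0[OF subspace_Lin[OF V, of V]] by simp
  then show "0 \<in> \<nn>\<^sub>L" using Q.subspace_0[OF n_sub] add_subgroup_0[OF Gamma_group] by (simp add: \<nn>\<^sub>L_def)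
  fix x y assume "x \<in> \<nn>\<^sub>L" "y \<in> \<nn>\<^sub>L"
  then have xy: "x \<in> \<nn>" "y \<in> \<nn>" "\<epsilon> x \<in> \<Gamma>" "\<epsilon> y \<in> \<Gamma>" by (auto simp: \<nn>\<^sub>L_def)
  have "\<epsilon> (x - y) = \<epsilon> x - \<epsilon> y"
    using eps_add[OF n_Lin[OF xy(1)] n_Lin[OF Q.subspace_neg[OF n_sub xy(2)]]] eps_neg[OF n_Lin[OF xy(2)]] by simp
  then show "x - y \<in> \<nn>\<^sub>L" using xy Q.subspace_diff[OF n_sub] add_subgroup_diff[OF Gamma_group] by (simp add: \<nn>\<^sub>L_def)
qed

text \<open>With respect to lattice bases of \<open>Wm\<close> and \<open>V1\<close>, the elements
  of \<open>\<nn>\<^sub>L\<close> are integral matrices, and \<epsilon> is injective on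
  \<open>\<nn>\<close>; so \<open>\<nn>\<^sub>L\<close> embeds into some Z^N.\<close>

lemma nL_basis: "\<exists>xs. z_basis xs \<nn>\<^sub>L"
proof -
  obtain cs where cs: "Wm = qspan cs" "L \<inter> Wm = zspan cs" using full_Wm by (auto simp: full_lattice_iff)
  obtain us where us: "q_indep us" "L \<inter> V1 = zspan us" using full_V1 by (auto simp: full_lattice_iff)
  let ?r = "length us"
  define co where "co y = (SOME c. zcomb c us = y)" for y
  have co: "zcomb (co y) us = y" if "y \<in> L \<inter> V1" for y
    using that unfolding us(2) co_def by (metis (mono_tags, lifting) imageE someI)
  have codiff: "co (x - y) j = co x j - co y j" if x: "x \<in> L \<inter> V1" and y: "y \<in> L \<inter> V1" and j: "j < ?r" for x y j
  proof -
    have "x - y \<in> L \<inter> V1" using x y add_subgroup_diff[OF L_group] Q.subspace_diff[OF V1] by blast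
    then show ?thesis by (intro zcomb_unique[OF us(1) _ j]) (simp only: zcomb_diff co[OF x] co[OF y] co)
  qed
  have csW: "set cs \<subseteq> Wm" "set cs \<subseteq> L \<inter> Wm" using set_qspan cs(1) set_zspan cs(2) by blast+
  have val: "x c \<in> L \<inter> V1" if "x \<in> \<nn>\<^sub>L" "c \<in> L \<inter> Wm" for x c
  proof -
    have "x \<in> \<nn>" "\<epsilon> x \<in> \<Gamma>" using that by (auto simp: \<nn>\<^sub>L_def)
    then show ?thesis using that eps_n[of x c] by (auto simp: \<Gamma>_def)
  qed
  \<comment> \<open>The matrix is read as one sequence: index k stands for the coordinate
    \<open>k mod ?r\<close> of the value at \<open>cs ! (k div ?r)\<close>.\<close>
  define \<phi> where "\<phi> x k = co (x (cs ! (k div ?r))) (k mod ?r)" for x :: "'v \<Rightarrow> 'v" and k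
  let ?N = "length cs * ?r"
  have k: "cs ! (k div ?r) \<in> L \<inter> Wm" "k mod ?r < ?r" if "k < ?N" for k
  proof -
    have r: "0 < ?r" using that by (cases "?r") auto
    then have "k div ?r < length cs" using that by (simp add: less_mult_imp_div_less)
    then show "cs ! (k div ?r) \<in> L \<inter> Wm" using csW by auto
    show "k mod ?r < ?r" using r by simp
  qed
  show ?thesis
  proof (rule z_basis_int_hom[where \<phi> = \<phi> and N = ?N, OF nL_group])
    fix x y i assume "x \<in> \<nn>\<^sub>L" "y \<in> \<nn>\<^sub>L" "i < ?N"
    then show "\<phi> (x - y) i = \<phi> x i - \<phi> y i" unfolding \<phi>_def using codiff[OF val val k(2)] k(1) by simp
  next
    fix x assume x: "x \<in> \<nn>\<^sub>L" and z: "\<And>i. i < ?N \<Longrightarrow> \<phi> x i = 0"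
    then have xn: "x \<in> \<nn>" by (simp add: \<nn>\<^sub>L_def)
    have x0: "x (cs ! i) = 0" if i: "i < length cs" for i
    proof -
      have m: "cs ! i \<in> L \<inter> Wm" using csW i by auto
      have "co (x (cs ! i)) j = 0" if j: "j < ?r" for j
      proof -
        have "i * ?r + j < Suc i * ?r" using j by simp
        also have "\<dots> \<le> ?N" using i by (intro mult_right_mono) auto
        finally have "\<phi> x (j + i * ?r) = 0" using z[of "j + i * ?r"] by (simp add: add.commute)
        moreover have "(j + i * ?r) div ?r = i" by (rule div_nat_eqI) (use j in \<open>simp_all add: algebra_simps\<close>)
        moreover have "(j + i * ?r) mod ?r = j" using j by simp
        ultimately show ?thesis unfolding \<phi>_def by simp
      qed
      then have "zcomb (co (x (cs ! i))) us = zcomb (\<lambda>j. 0) us" by (intro zcomb_cong) auto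
      then show ?thesis using co[OF val[OF x m]] by (simp add: zcomb_zero)
    qed
    have csV: "set cs \<subseteq> V" using csW WmV by auto
    have "x w = 0" if "w \<in> Wm" for w
    proof -
      obtain c where "w = qcomb c cs" using cs(1) \<open>w \<in> Wm\<close> by auto
      then have "x w = qcomb c (map x cs)" using qcomb_map[OF n_Lin[OF xn] V csV] by simp
      also have "\<dots> = 0" using x0 by (simp add: qcomb_def)
      finally show ?thesis .
    qed
    then have "\<epsilon> x = \<epsilon> 0" using eps_n[OF xn] p_V1[OF Q.subspace_0[OF V1]] by (auto simp: \<epsilon>_def fun_eq_iff)
    then show "x = 0" using eps_inj[OF xn Q.subspace_0[OF n_sub]] by blast
  qed
qed

end

section \<open>Correctness of one level\<close>

text \<open>The sequencing rule of a Hoare logic for total correctness under all choices: P is the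
  assertion between the two computations.\<close>

lemma always_returns_bind:
  assumes "always_returns m P" "\<And>x. P x \<Longrightarrow> always_returns (f x) Q" shows "always_returns (m \<triangleright> f) Q"
proof -
  obtain X where X: "m = Results X" "X \<noteq> {}" "\<forall>x\<in>X. P x" using assms(1) by (auto simp: always_returns_def)
  have "\<forall>x\<in>X. \<exists>Y. f x = Results Y \<and> Y \<noteq> {} \<and> (\<forall>y\<in>Y. Q y)" using assms(2) X(3) by (auto simp: always_returns_def)
  from bchoice[OF this] obtain Y where Y: "\<And>x. x \<in> X \<Longrightarrow> f x = Results (Y x) \<and> Y x \<noteq> {} \<and> (\<forall>y\<in>Y x. Q y)" by auto
  then have "m \<triangleright> f = Results (\<Union>x\<in>X. Y x)" by (auto simp: and_then_def X(1))
  then show ?thesis unfolding always_returns_def using X(2) Y by (intro exI[of _ "\<Union>x\<in>X. Y x"]) auto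
qed

lemma always_returns_choose: "S \<noteq> {} \<Longrightarrow> always_returns (choose_from S) (\<lambda>x. x \<in> S)"
  by (simp add: always_returns_def choose_from_def)

lemma always_returns_the_only: "x \<in> S \<Longrightarrow> (\<And>y. y \<in> S \<Longrightarrow> y = x) \<Longrightarrow> always_returns (the_only S) (\<lambda>x. x \<in> S)"
  by (auto simp: always_returns_def the_only_def is_singleton_def)

lemma always_returns_return: "P x \<Longrightarrow> always_returns (return x) P"
  by (simp add: always_returns_def return_def)

lemma lists_from_nonempty: assumes "\<And>i. i < k \<Longrightarrow> S i \<noteq> {}" shows "lists_from k S \<noteq> {}"
proof -
  have "map (\<lambda>i. SOME x. x \<in> S i) [0..<k] \<in> lists_from k S"
    using assms by (auto simp: lists_from_def some_in_eq)
  then show ?thesis by blast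
qed

context step
begin

interpretation GL: group "GL V" by (rule group_GL[OF V])
interpretation GD: group "GL D" by (rule group_GL[OF D_sub])
interpretation H': subgroup H' "GL V" by (rule H'_subgroup)

text \<open>q is exp of some \<open>d\<pi> x\<close>, so its logarithm has a preimage. Every other
  preimage y gives the same image, because \<open>d\<pi>\<close> commutes with exp.\<close>

lemma stab_lift:
  assumes q: "q \<in> stab D \<qq> L'"
  shows "\<exists>x\<in>\<gg>. d\<pi> x = unip_log D q"
    and "\<And>y. y \<in> \<gg> \<Longrightarrow> d\<pi> y = unip_log D q \<Longrightarrow> nil_exp V y \<in> H' \<and> d\<pi> (nil_exp V y) = q"
proof -
  obtain x where x: "x \<in> \<gg>" "q = nil_exp D (d\<pi> x)" using q by (auto simp: stab_def \<qq>_def)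
  have l: "unip_log D q = d\<pi> x" unfolding x(2) by (rule unip_log_nil_exp[OF dpi_nilp[OF x(1)]])
  then show "\<exists>x\<in>\<gg>. d\<pi> x = unip_log D q" using x(1) by auto
  fix y assume y: "y \<in> \<gg>" "d\<pi> y = unip_log D q"
  then have "d\<pi> (nil_exp V y) = q" using l x by (simp add: dpi_exp)
  then show "nil_exp V y \<in> H' \<and> d\<pi> (nil_exp V y) = q" using y q by (simp add: H'_def)
qed

lemma qs_stab: assumes "T_chain (GL D) (stab D \<qq> L') qs A \<chi>" "i < length qs" shows "qs ! i \<in> stab D \<qq> L'"
  using GD.T_chain_antimono[OF assms(1), of 0 i] T_chainD(1,4)[OF assms(1)] assms(2) by auto

lemma dpi_H': "h \<in> H' \<Longrightarrow> d\<pi> h \<in> carrier (GL D)" "h \<in> H' \<Longrightarrow> k \<in> H' \<Longrightarrow> d\<pi> (h \<otimes>\<^bsub>GL V\<^esub> k) = d\<pi> h \<otimes>\<^bsub>GL D\<^esub> d\<pi> k"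
  using subgroup.subset[OF stabD_subgroup] dpi_mult by (auto simp: H'_def GL_simps(2))

section \<open>Lifts of the recursive result and their relations\<close>

lemma lifts_map:
  assumes "length gqs = length qs" "\<forall>i<length qs. gqs ! i \<in> H' \<and> d\<pi> (gqs ! i) = qs ! i"
  shows "set gqs \<subseteq> H'" "map d\<pi> gqs = qs"
  using assms by (auto simp: in_set_conv_nth intro: nth_equalityI)

lemma lifts_power_product:
  assumes g: "length gqs = length qs" "\<forall>i<length qs. gqs ! i \<in> H' \<and> d\<pi> (gqs ! i) = qs ! i"
    and e: "length e = length qs"
  shows "power_product (GL V) gqs e \<in> H'"
    and "d\<pi> (power_product (GL V) gqs e) = power_product (GL D) qs e"
    and "\<epsilon> (power_product (GL V) gqs e) - zcomb (\<lambda>i. e ! i) (map \<epsilon> gqs) \<in> \<Gamma>"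
proof -
  note m = lifts_map[OF g]
  have e': "length e = length gqs" using g e by simp
  show "power_product (GL V) gqs e \<in> H'" by (rule GL.power_product_subgroup[OF H'_subgroup m(1) e'])
  have "d\<pi> (power_product (GL V) gqs e) = power_product (GL D) (map d\<pi> gqs) e"
    by (rule GL.power_product_hom[OF H'_subgroup group_GL[OF D_sub] dpi_H' m(1) e'])
  then show "d\<pi> (power_product (GL V) gqs e) = power_product (GL D) qs e" using m(2) by simp
  show "\<epsilon> (power_product (GL V) gqs e) - zcomb (\<lambda>i. e ! i) (map \<epsilon> gqs) \<in> \<Gamma>"
    by (rule GL.quasi_hom_power_product[OF H'_subgroup Gamma_group eps_mult' m(1) e'])
qed

lemma Gamma_sub_sum: "\<Gamma> \<subseteq> set_sum \<Gamma> W'" and W'_sub_sum: "W' \<subseteq> set_sum \<Gamma> W'"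
proof -
  have "x + 0 \<in> set_sum \<Gamma> W'" if "x \<in> \<Gamma>" for x using that Q.subspace_0[OF W'_sub] unfolding set_sum_def by blast
  then show "\<Gamma> \<subseteq> set_sum \<Gamma> W'" by auto
  have "0 + x \<in> set_sum \<Gamma> W'" if "x \<in> W'" for x using that add_subgroup_0[OF Gamma_group] unfolding set_sum_def by blast
  then show "W' \<subseteq> set_sum \<Gamma> W'" by auto
qed

lemma relation_lattice_iff:
  assumes g: "length gqs = length qs" "\<forall>i<length qs. gqs ! i \<in> H' \<and> d\<pi> (gqs ! i) = qs ! i"
    and e: "length e = length qs"
  shows "e \<in> relation_lattice (set_sum \<Gamma> W') (map \<epsilon> gqs) \<longleftrightarrow> \<epsilon> (power_product (GL V) gqs e) \<in> set_sum \<Gamma> W'"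
proof -
  let ?x = "\<epsilon> (power_product (GL V) gqs e)" and ?y = "zcomb (\<lambda>i. e ! i) (map \<epsilon> gqs)"
  have d: "?x - ?y \<in> set_sum \<Gamma> W'" using lifts_power_product(3)[OF g e] Gamma_sub_sum by blast
  have "?y \<in> set_sum \<Gamma> W' \<longleftrightarrow> ?x \<in> set_sum \<Gamma> W'"
    using add_subgroup_add[OF GW_group d, of ?y] add_subgroup_diff[OF GW_group _ d, of ?x] by auto
  then show ?thesis using g(1) e by (simp add: relation_lattice_def)
qed

text \<open>x and the product h of the lifts have the same image, so x = h exp z with z in
  \<open>\<nn>\<close>. Then \<open>\<epsilon> h = \<epsilon> x - \<epsilon> z\<close> is a
  difference of an element of \<Gamma> and one of \<open>W'\<close>.\<close>

lemma stab_relation: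
  assumes g: "length gqs = length qs" "\<forall>i<length qs. gqs ! i \<in> H' \<and> d\<pi> (gqs ! i) = qs ! i"
    and e: "length e = length qs" and x: "x \<in> stab V \<gg> L" "d\<pi> x = power_product (GL D) qs e"
  shows "e \<in> relation_lattice (set_sum \<Gamma> W') (map \<epsilon> gqs)"
proof -
  define h where "h = power_product (GL V) gqs e"
  have h: "h \<in> H'" "d\<pi> h = d\<pi> x" using lifts_power_product(1,2)[OF g e] x(2) by (simp_all add: h_def)
  have xH: "x \<in> H'" "\<epsilon> x \<in> \<Gamma>" using x(1) by (auto simp: stab_iff)
  let ?y = "inv\<^bsub>GL V\<^esub> h \<otimes>\<^bsub>GL V\<^esub> x"
  have y: "?y \<in> H'" using h xH by simp
  have "d\<pi> ?y = \<one>\<^bsub>GL D\<^esub>"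
    using h xH dpi_inv[OF H'_exp[OF h(1)]] dpi_H'(1)[OF xH(1)] by (simp add: dpi_H'(2))
  then obtain z where z: "z \<in> \<nn>" "?y = nil_exp V z" using kernel[OF H'_exp[OF y]] by blast
  have "x = h \<otimes>\<^bsub>GL V\<^esub> ?y" using h(1) xH(1) by (simp add: GL.m_assoc[symmetric])
  then have xh: "x = h \<circ> nil_exp V z" unfolding z(2) by (simp add: GL_simps)
  obtain u where u: "u \<in> \<gg>" "h = nil_exp V u" using H'_exp[OF h(1)] by auto
  have "\<epsilon> x = \<epsilon> h + \<epsilon> z" unfolding xh u(2) by (rule eps_exp_n[OF u(1) z(1)])
  then have "\<epsilon> h = \<epsilon> x - \<epsilon> z" by simp
  moreover have "\<epsilon> z \<in> set_sum \<Gamma> W'" using z(1) W'_sub_sum by (auto simp: W'_def)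
  ultimately have "\<epsilon> h \<in> set_sum \<Gamma> W'" using add_subgroup_diff[OF GW_group, of "\<epsilon> x" "\<epsilon> z"] xH(2) Gamma_sub_sum by auto
  then show ?thesis using relation_lattice_iff[OF g e] by (simp add: h_def)
qed

lemma relation_basis:
  assumes gqs: "set gqs \<subseteq> H'" and k: "k = length gqs"
  shows "\<exists>ws. length ws = k \<and> hermite_normal_form k ws \<and> int_basis k ws (relation_lattice (set_sum \<Gamma> W') (map \<epsilon> gqs))"
proof (rule hermite_basis_exists)
  let ?M = "relation_lattice (set_sum \<Gamma> W') (map \<epsilon> gqs)"
  show "length e = k" if "e \<in> ?M" for e using that k by (simp add: relation_lattice_def)
  show "replicate k 0 \<in> ?M"
  proof -
    have "zcomb (\<lambda>i. replicate k 0 ! i) (map \<epsilon> gqs) = zcomb (\<lambda>i. 0) (map \<epsilon> gqs)" by (rule zcomb_cong) (simp add: k)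
    then show ?thesis using add_subgroup_0[OF GW_group] by (simp add: relation_lattice_def k zcomb_zero)
  qed
  show "map (\<lambda>i. e ! i - m * f ! i) [0..<k] \<in> ?M" if "e \<in> ?M" "f \<in> ?M" for e f m
  proof -
    have "zcomb (\<lambda>i. map (\<lambda>i. e ! i - m * f ! i) [0..<k] ! i) (map \<epsilon> gqs) = zcomb (\<lambda>i. e ! i - m * f ! i) (map \<epsilon> gqs)"
      by (rule zcomb_cong) (simp add: k)
    also have "\<dots> = zcomb (\<lambda>i. e ! i) (map \<epsilon> gqs) - of_int m *\<^sub>Q zcomb (\<lambda>i. f ! i) (map \<epsilon> gqs)"
      by (simp add: zcomb_diff zcomb_scale)
    also have "\<dots> \<in> set_sum \<Gamma> W'"
      using that by (intro add_subgroup_diff[OF GW_group] add_subgroup_scale[OF GW_group]) (auto simp: relation_lattice_def)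
    finally show ?thesis by (simp add: relation_lattice_def k)
  qed
  show "\<exists>e\<in>?M. (\<forall>l<i. e ! l = 0) \<and> 0 < e ! i" if i: "i < k" for i
  proof -
    have "gqs ! i \<in> H'" using gqs i k by auto
    then have "\<epsilon> (gqs ! i) \<in> Lin Wm V1" by (intro eps_Lin H'_Lin)
    \<comment> \<open>The resulting multiple of the i-th unit vector is a relation with exactly the
      leading zeros that \<open>hermite_basis_exists\<close> requires.\<close>
    then obtain m where m: "m > 0" "of_int m *\<^sub>Q \<epsilon> (gqs ! i) \<in> \<Gamma>" using Gamma_torsion by blast
    let ?e = "map (\<lambda>j. if j = i then m else 0) [0..<k]"
    have "zcomb (\<lambda>j. ?e ! j) (map \<epsilon> gqs) = zcomb (\<lambda>j. m * (if j = i then 1 else 0)) (map \<epsilon> gqs)"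
      by (rule zcomb_cong) (simp add: k)
    also have "\<dots> = of_int m *\<^sub>Q \<epsilon> (gqs ! i)" unfolding zcomb_scale using i k by (simp add: zcomb_unit)
    finally have "?e \<in> ?M" using m(2) Gamma_sub_sum by (auto simp: relation_lattice_def k)
    moreover have "(\<forall>l<i. ?e ! l = 0) \<and> 0 < ?e ! i" using i m(1) by simp
    ultimately show ?thesis by blast
  qed
qed

text \<open>For x in \<open>\<nn>\<close> the identity part of exp x contributes nothing to
  \<epsilon>, as p kills \<open>Wm\<close>; so \<epsilon> has the same value at exp x and at
  x.\<close>

lemma kernel_stab: "nil_exp V ` \<nn>\<^sub>L = {x \<in> stab V \<gg> L. d\<pi> x = \<one>\<^bsub>GL D\<^esub>}"
proof -
  have e: "\<epsilon> (nil_exp V x) = \<epsilon> x" if x: "x \<in> \<nn>" for x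
    using WmV p_W1 Wm1 p_add n_V1[OF x] V1V by (fastforce simp: fun_eq_iff \<epsilon>_def exp_n_apply[OF x])
  have H: "nil_exp V x \<in> H'" if x: "x \<in> \<nn>" for x
    using n_g[OF x] dpi_exp_n[OF x] subgroup.one_closed[OF stabD_subgroup] by (simp add: H'_def)
  show ?thesis
  proof
    show "nil_exp V ` \<nn>\<^sub>L \<subseteq> {x \<in> stab V \<gg> L. d\<pi> x = \<one>\<^bsub>GL D\<^esub>}"
      using e H dpi_exp_n by (auto simp: \<nn>\<^sub>L_def stab_iff)
    show "{x \<in> stab V \<gg> L. d\<pi> x = \<one>\<^bsub>GL D\<^esub>} \<subseteq> nil_exp V ` \<nn>\<^sub>L"
    proof
      fix h assume "h \<in> {x \<in> stab V \<gg> L. d\<pi> x = \<one>\<^bsub>GL D\<^esub>}"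
      then have h: "h \<in> H'" "\<epsilon> h \<in> \<Gamma>" "d\<pi> h = \<one>\<^bsub>GL D\<^esub>" by (auto simp: stab_iff)
      then obtain x where x: "x \<in> \<nn>" "h = nil_exp V x" using kernel[OF H'_exp[OF h(1)] h(3)] by blast
      then show "h \<in> nil_exp V ` \<nn>\<^sub>L" using h(2) e by (auto simp: \<nn>\<^sub>L_def)
    qed
  qed
qed

lemma kernel_chain: assumes "z_basis xs \<nn>\<^sub>L"
  shows "\<exists>B \<psi>. T_chain (GL V) (nil_exp V ` \<nn>\<^sub>L) (map (nil_exp V) xs) B \<psi>"
proof (rule GL.T_chain_free[OF assms])
  have n: "\<nn>\<^sub>L \<subseteq> \<nn>" by (auto simp: \<nn>\<^sub>L_def)
  show "nil_exp V (x + y) = nil_exp V x \<otimes>\<^bsub>GL V\<^esub> nil_exp V y" if "x \<in> \<nn>\<^sub>L" "y \<in> \<nn>\<^sub>L" for x y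
    using exp_n_add that n by (auto simp: GL_simps)
  show "nil_exp V x \<in> carrier (GL V)" if "x \<in> \<nn>\<^sub>L" for x using exp_GL n_g that n by blast
  show "inj_on (nil_exp V) \<nn>\<^sub>L"
  proof (rule inj_onI)
    fix x y assume xy: "x \<in> \<nn>\<^sub>L" "y \<in> \<nn>\<^sub>L" "nil_exp V x = nil_exp V y"
    then have "idmap V + x = idmap V + y" using exp_n[OF subsetD[OF n xy(1)]] exp_n[OF subsetD[OF n xy(2)]] by simp
    then show "x = y" by simp
  qed
qed

text \<open>\<open>T_chain_extension\<close> with the diagonal entries as divisors. An element of
  the stabilizer with image in \<open>A i\<close> has a normal form whose exponents are a relation
  with i leading zeros; the coordinate is its entry at i, a multiple of the diagonal entry.
  Conversely the i-th result has \<epsilon>-value \<open>v + \<gamma> - v\<close>, which lies in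
  \<Gamma>, and its image has the diagonal entry as its coordinate.\<close>

lemma result_chain:
  assumes c: "T_chain (GL D) (stab D \<qq> L') qs A \<chi>" and xs: "z_basis xs \<nn>\<^sub>L"
    and g: "length gqs = length qs" "\<forall>i<length qs. gqs ! i \<in> H' \<and> d\<pi> (gqs ! i) = qs ! i"
    and ws: "length ws = length qs" "hermite_normal_form (length qs) ws"
      "int_basis (length qs) ws (relation_lattice (set_sum \<Gamma> W') (map \<epsilon> gqs))"
    and gws: "gws = map (power_product (GL V) gqs) ws"
    and vs: "\<And>i. i < length qs \<Longrightarrow> snd (vs ! i) \<in> \<Gamma> \<and> fst (vs ! i) + snd (vs ! i) = \<epsilon> (gws ! i)"
    and nws: "\<And>i. i < length qs \<Longrightarrow> nws ! i \<in> \<nn> \<and> \<epsilon> (nws ! i) = - fst (vs ! i)"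
  shows "\<exists>A \<chi>. T_chain (GL V) (stab V \<gg> L)
    (map (\<lambda>i. gws ! i \<otimes>\<^bsub>GL V\<^esub> nil_exp V (nws ! i)) [0..<length qs] @ map (nil_exp V) xs) A \<chi>"
proof -
  let ?k = "length qs"
  note tri = hermite_normal_form_square[OF ws(2,1)]
  obtain B \<psi> where B: "T_chain (GL V) (nil_exp V ` \<nn>\<^sub>L) (map (nil_exp V) xs) B \<psi>" using kernel_chain[OF xs] by blast
  have stH: "x \<in> H'" if "x \<in> stab V \<gg> L" for x using that by (simp add: stab_iff)
  have qsc: "set qs \<subseteq> carrier (GL D)"
    using subsetD[OF subgroup.subset[OF stabD_subgroup] qs_stab[OF c]] by (auto simp: in_set_conv_nth)
  show ?thesis
  proof (rule T_chain_extension[where \<pi> = d\<pi> and d = "\<lambda>i. ws ! i ! i", OF group_GL[OF V] group_GL[OF D_sub]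
        stab_subgroup[OF LV] c _ _ _ _ _ B kernel_stab])
    show "d\<pi> x \<in> stab D \<qq> L'" if "x \<in> stab V \<gg> L" for x using stH[OF that] by (simp add: H'_def)
    show "d\<pi> (x \<otimes>\<^bsub>GL V\<^esub> y) = d\<pi> x \<otimes>\<^bsub>GL D\<^esub> d\<pi> y" if "x \<in> stab V \<gg> L" "y \<in> stab V \<gg> L" for x y
      using dpi_H'(2) stH that by blast
    show "ws ! i ! i dvd \<chi> i (d\<pi> x)" if i: "i < ?k" and x: "x \<in> stab V \<gg> L" "d\<pi> x \<in> A i" for i x
    proof -
      obtain e where e: "length e = ?k" "\<forall>j<i. e ! j = 0" "d\<pi> x = power_product (GL D) (drop i qs) (drop i e)"
        using GD.T_chain_normal_form[OF c _ x(2)] i by auto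
      then have "d\<pi> x = power_product (GL D) qs e"
        using GD.power_product_leading_zeros[OF qsc e(1) _ e(2)] i by simp
      then have eM: "e \<in> relation_lattice (set_sum \<Gamma> W') (map \<epsilon> gqs)" by (rule stab_relation[OF g e(1) x(1)])
      have "ws ! i ! i dvd e ! i" by (rule triangular_leading_dvd[OF ws(3,1) tri eM i e(2)])
      then show ?thesis using GD.power_product_drop(2)[OF c e(1) _ i] i e(3) by simp
    qed
    show "map (\<lambda>i. gws ! i \<otimes>\<^bsub>GL V\<^esub> nil_exp V (nws ! i)) [0..<?k] ! i \<in> stab V \<gg> L
      \<and> d\<pi> (map (\<lambda>i. gws ! i \<otimes>\<^bsub>GL V\<^esub> nil_exp V (nws ! i)) [0..<?k] ! i) \<in> A i
      \<and> \<chi> i (d\<pi> (map (\<lambda>i. gws ! i \<otimes>\<^bsub>GL V\<^esub> nil_exp V (nws ! i)) [0..<?k] ! i)) = ws ! i ! i \<and> 0 < ws ! i ! i"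
      if i: "i < ?k" for i
    proof -
      have lw: "length (ws ! i) = ?k" using ws(1,3) i by (auto simp: int_basis_def)
      have gi: "gws ! i = power_product (GL V) gqs (ws ! i)" using gws i ws(1) by simp
      note pp = lifts_power_product[OF g lw, folded gi]
      note n = nws[OF i] and v = vs[OF i]
      obtain u where u: "u \<in> \<gg>" "gws ! i = nil_exp V u" using H'_exp[OF pp(1)] by auto
      let ?g = "gws ! i \<otimes>\<^bsub>GL V\<^esub> nil_exp V (nws ! i)"
      have nH: "nil_exp V (nws ! i) \<in> H'"
        using n n_g dpi_exp_n subgroup.one_closed[OF stabD_subgroup] by (simp add: H'_def)
      have gH: "?g \<in> H'" using pp(1) nH by simp
      have "\<epsilon> ?g = \<epsilon> (gws ! i) + \<epsilon> (nws ! i)"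
        unfolding u(2) GL_simps(2) using n by (intro eps_exp_n[OF u(1)]) simp
      also have "\<dots> = (fst (vs ! i) + snd (vs ! i)) + - fst (vs ! i)" using n v by (simp only:)
      also have "\<dots> = snd (vs ! i)" by simp
      finally have "\<epsilon> ?g \<in> \<Gamma>" using v by simp
      then have gS: "?g \<in> stab V \<gg> L" using gH by (simp add: stab_iff)
      have "d\<pi> ?g = d\<pi> (gws ! i)" using dpi_H'[OF pp(1)] dpi_H'(2)[OF pp(1) nH] dpi_exp_n n by simp
      also have "\<dots> = power_product (GL D) (drop i qs) (drop i (ws ! i))"
        unfolding pp(2) by (rule GD.power_product_leading_zeros[OF qsc lw]) (use i tri(1) in auto)
      finally have d: "d\<pi> ?g = power_product (GL D) (drop i qs) (drop i (ws ! i))" .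
      show ?thesis using gS GD.power_product_drop[OF c lw, of i] i tri(2) by (simp add: d)
    qed
    show "h \<otimes>\<^bsub>GL V\<^esub> x = x \<otimes>\<^bsub>GL V\<^esub> h" if h: "h \<in> stab V \<gg> L" and x: "x \<in> nil_exp V ` \<nn>\<^sub>L" for h x
    proof -
      obtain z y where "z \<in> \<gg>" "h = nil_exp V z" "y \<in> \<nn>" "x = nil_exp V y" using h x by (auto simp: stab_def \<nn>\<^sub>L_def)
      then show ?thesis using exp_n_mult[of z y] by (simp add: GL_simps)
    qed
  qed simp
qed

text \<open>The part of the algorithm after the choice of L-complements. Each choice is shown to be
  possible from the facts collected about the previous ones, so no particular choice is ever
  fixed.\<close>

lemma tail:
  assumes c: "T_chain (GL D) (stab D \<qq> L') qs A \<chi>"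
  shows "always_returns
    (choose_from {xs. z_basis xs \<nn>\<^sub>L} \<triangleright> (\<lambda>xs.
     choose_from (lists_from (length qs) (\<lambda>i. {x \<in> \<gg>. d\<pi> x = unip_log D (qs ! i)})) \<triangleright> (\<lambda>ys.
     choose_from {ws. length ws = length qs \<and> hermite_normal_form (length qs) ws
          \<and> int_basis (length qs) ws (relation_lattice (set_sum \<Gamma> W') (map \<epsilon> (map (nil_exp V) ys)))} \<triangleright> (\<lambda>ws.
     choose_from (lists_from (length qs) (\<lambda>i. {(v, \<gamma>). v \<in> W' \<and> \<gamma> \<in> \<Gamma>
          \<and> v + \<gamma> = \<epsilon> (map (power_product (GL V) (map (nil_exp V) ys)) ws ! i)})) \<triangleright> (\<lambda>vs.
     the_only (lists_from (length qs) (\<lambda>i. {x \<in> \<nn>. \<epsilon> x = - fst (vs ! i)})) \<triangleright> (\<lambda>nws.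
     return (map (\<lambda>i. map (power_product (GL V) (map (nil_exp V) ys)) ws ! i \<otimes>\<^bsub>GL V\<^esub> nil_exp V (nws ! i)) [0..<length qs]
        @ map (nil_exp V) xs)))))))
    (\<lambda>gs. \<exists>A \<chi>. T_chain (GL V) (stab V \<gg> L) gs A \<chi>)"
proof (rule always_returns_bind[OF always_returns_choose], goal_cases)
  case 1
  show ?case using nL_basis by simp
next
  case (2 xs)
  then have xs: "z_basis xs \<nn>\<^sub>L" by simp
  let ?k = "length qs"
  show ?case
  proof (rule always_returns_bind[OF always_returns_choose], goal_cases)
    case 1
    show ?case by (rule lists_from_nonempty) (use stab_lift(1)[OF qs_stab[OF c]] in blast)
  next
    case (2 ys)
    define gqs where "gqs = map (nil_exp V) ys"
    have g: "length gqs = ?k" "\<forall>i<?k. gqs ! i \<in> H' \<and> d\<pi> (gqs ! i) = qs ! i"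
      using 2 stab_lift(2)[OF qs_stab[OF c]] by (auto simp: gqs_def lists_from_def)
    show ?case
      unfolding gqs_def[symmetric]
    proof (rule always_returns_bind[OF always_returns_choose], goal_cases)
      case 1
      show ?case
        using relation_basis[OF lifts_map(1)[OF g] g(1)[symmetric]] by (elim exE) (rule ex_in_conv[THEN iffD1], rule exI, rule CollectI)
    next
      case (2 ws)
      then have ws: "length ws = ?k" "hermite_normal_form ?k ws"
          "int_basis ?k ws (relation_lattice (set_sum \<Gamma> W') (map \<epsilon> gqs))" by auto
      define gws where "gws = map (power_product (GL V) gqs) ws"
      have sums: "\<epsilon> (gws ! i) \<in> set_sum \<Gamma> W'" if i: "i < ?k" for i
      proof -
        have l: "length (ws ! i) = ?k" using ws(1,3) i by (auto simp: int_basis_def)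
        \<comment> \<open>A row of the basis is the combination with a unit vector as coefficients,
          so it belongs to the relation lattice.\<close>
        have "ws ! i = map (\<lambda>t. \<Sum>j<length ws. (if j = i then 1 else 0) * ws ! j ! t) [0..<?k]"
          using i ws(1) l by (intro nth_equalityI) (simp_all add: if_distrib[of "\<lambda>x. x * _"] cong: if_cong)
        moreover have "relation_lattice (set_sum \<Gamma> W') (map \<epsilon> gqs)
          = range (\<lambda>c. map (\<lambda>t. \<Sum>j<length ws. c j * ws ! j ! t) [0..<?k])"
          using ws(3) by (simp only: int_basis_def)
        ultimately have "ws ! i \<in> relation_lattice (set_sum \<Gamma> W') (map \<epsilon> gqs)"
          by (simp only:) (rule range_eqI, rule refl)
        then show ?thesis using relation_lattice_iff[OF g l] i ws(1) by (simp add: gws_def)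
      qed
      show ?case
        unfolding gws_def[symmetric]
      proof (rule always_returns_bind[OF always_returns_choose], goal_cases)
        case 1
        show ?case
        proof (rule lists_from_nonempty)
          fix i assume "i < ?k"
          then have "\<epsilon> (gws ! i) \<in> set_sum \<Gamma> W'" by (rule sums)
          then obtain \<gamma> v where "\<gamma> \<in> \<Gamma>" "v \<in> W'" "\<epsilon> (gws ! i) = \<gamma> + v" unfolding set_sum_def by blast
          then have "(v, \<gamma>) \<in> {(v, \<gamma>). v \<in> W' \<and> \<gamma> \<in> \<Gamma> \<and> v + \<gamma> = \<epsilon> (gws ! i)}" by (simp add: add.commute)
          then show "{(v, \<gamma>). v \<in> W' \<and> \<gamma> \<in> \<Gamma> \<and> v + \<gamma> = \<epsilon> (gws ! i)} \<noteq> {}" by blast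
        qed
      next
        case (2 vs)
        have vs: "fst (vs ! i) \<in> W' \<and> snd (vs ! i) \<in> \<Gamma> \<and> fst (vs ! i) + snd (vs ! i) = \<epsilon> (gws ! i)" if "i < ?k" for i
          using 2 that by (auto simp: lists_from_def case_prod_beta)
        have "lists_from ?k (\<lambda>i. {x \<in> \<nn>. \<epsilon> x = - fst (vs ! i)}) \<noteq> {}"
        proof (rule lists_from_nonempty)
          fix i assume "i < ?k"
          then have "- fst (vs ! i) \<in> W'" using vs Q.subspace_neg[OF W'_sub] by blast
          then obtain x where "x \<in> \<nn>" "\<epsilon> x = - fst (vs ! i)" by (auto simp: W'_def)
          then show "{x \<in> \<nn>. \<epsilon> x = - fst (vs ! i)} \<noteq> {}" by blast
        qed
        then obtain nws0 where n0: "nws0 \<in> lists_from ?k (\<lambda>i. {x \<in> \<nn>. \<epsilon> x = - fst (vs ! i)})" by blast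
        show ?case
        proof (rule always_returns_bind[OF always_returns_the_only[OF n0]], goal_cases)
          case (1 nws)
          \<comment> \<open>Uniqueness of the list is uniqueness of each preimage under
            \<epsilon>.\<close>
          then show ?case using n0 eps_inj by (intro nth_equalityI) (auto simp: lists_from_def)
        next
          case (2 nws)
          then show ?case
            by (intro always_returns_return, intro result_chain[OF c xs g ws gws_def])
              (use vs in \<open>auto simp: lists_from_def\<close>)
        qed
      qed
    qed
  qed
qed

end

section \<open>Correctness of the algorithm\<close>

text \<open>Interleaving inside the space of rational sequences: even positions hold the coordinates
  of an element of \<open>Vm\<close>, odd positions those of an element of V modulo
  \<open>V1\<close>, namely the coordinates from \<open>length xs\<close> on for a basis adapted to
  \<open>V1\<close>.\<close>

lemma derived_spaces_nonempty:
  fixes V :: "'v::rat_vector set"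
  assumes L: "full_lattice V L" and V1: "Q.subspace V1" and Vm: "Q.subspace Vm" and V1m: "V1 \<subseteq> Vm" and VmV: "Vm \<subseteq> V"
  shows "(derived_spaces V V1 Vm :: ((nat \<Rightarrow> rat) set \<times> ('v \<Rightarrow> nat \<Rightarrow> rat) \<times> ('v \<Rightarrow> nat \<Rightarrow> rat)) set) \<noteq> {}"
proof -
  obtain bs where "V = qspan bs" "L = zspan bs" using L by (auto simp: full_lattice_iff)
  moreover obtain xs ys where b: "q_indep (xs @ ys)" "qspan (xs @ ys) = qspan bs" "V1 = qspan xs"
    using adapted_basis[OF V1, of bs] V1m VmV calculation by blast
  ultimately have Vq: "V = qspan (xs @ ys)" by simp
  have V: "Q.subspace V" unfolding Vq by (rule subspace_qspan)
  let ?d = "length (xs @ ys)" and ?r = "length xs"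
  define cf where "cf v = (SOME c. v = qcomb c (xs @ ys))" for v
  have cf: "v = qcomb (cf v) (xs @ ys)" if "v \<in> V" for v
    unfolding cf_def using that Vq by (intro someI_ex[of "\<lambda>c. v = qcomb c (xs @ ys)"]) auto
  have uni: "cf v i = c i" if "v = qcomb c (xs @ ys)" "i < ?d" for v c i
  proof -
    have "v \<in> V" using that(1) Vq by blast
    then show ?thesis using q_indep_unique[OF b(1), of "cf v" c i] cf[of v] that by simp
  qed
  have cfadd: "cf (v + w) i = cf v i + cf w i" if "v \<in> V" "w \<in> V" "i < ?d" for v w i
    by (rule uni[OF _ that(3)]) (simp only: qcomb_add cf[OF that(1), symmetric] cf[OF that(2), symmetric])
  have cfsc: "cf (q *\<^sub>Q v) i = q * cf v i" if "v \<in> V" "i < ?d" for v q i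
    by (rule uni[OF _ that(2)]) (simp only: qcomb_scale cf[OF that(1), symmetric])
  have cf0: "v = 0" if "v \<in> V" "\<forall>i<?d. cf v i = 0" for v
  proof -
    have "qcomb (cf v) (xs @ ys) = qcomb (\<lambda>i. 0) (xs @ ys)" by (rule qcomb_cong) (use that in auto)
    then show ?thesis using cf[OF that(1)] by (simp add: qcomb_zero)
  qed
  have cfV1: "v \<in> V1 \<longleftrightarrow> (\<forall>i<?d. ?r \<le> i \<longrightarrow> cf v i = 0)" if v: "v \<in> V" for v
  proof
    assume "v \<in> V1"
    then obtain c where c: "v = qcomb c xs" using b(3) by auto
    define c' where "c' i = (if i < ?r then c i else 0)" for i
    have "qcomb c' (xs @ ys) = qcomb c xs"
      unfolding qcomb_append c'_def by (simp add: qcomb_zero cong: qcomb_cong)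
    then have "v = qcomb c' (xs @ ys)" using c by simp
    then have "cf v i = c' i" if "i < ?d" for i by (rule uni[OF _ that])
    then show "\<forall>i<?d. ?r \<le> i \<longrightarrow> cf v i = 0" by (simp add: c'_def)
  next
    assume a: "\<forall>i<?d. ?r \<le> i \<longrightarrow> cf v i = 0"
    have "v = qcomb (cf v) xs + qcomb (\<lambda>i. cf v (?r + i)) ys" using cf[OF v] unfolding qcomb_append .
    also have "qcomb (\<lambda>i. cf v (?r + i)) ys = qcomb (\<lambda>i. 0) ys" by (rule qcomb_cong) (use a in auto)
    finally show "v \<in> V1" unfolding b(3) by (simp add: qcomb_zero)
  qed
  define \<iota> where "\<iota> v i = (if v \<in> Vm \<and> even i \<and> i div 2 < ?d then cf v (i div 2) else 0)" for v and i :: nat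
  define \<kappa> where "\<kappa> v i = (if v \<in> V \<and> odd i \<and> i div 2 < ?d \<and> ?r \<le> i div 2 then cf v (i div 2) else 0)" for v and i :: nat
  define D where "D = set_sum (\<iota> ` Vm) (\<kappa> ` V)"
  have \<iota>L: "\<iota> \<in> Lin Vm UNIV"
    by (rule LinI) (use VmV Q.subspace_add[OF Vm] Q.subspace_scale[OF Vm] in
        \<open>auto simp: \<iota>_def fun_eq_iff scaleQ_fun_def scaleQ_rat_def subset_iff cfadd cfsc\<close>)
  have \<kappa>L: "\<kappa> \<in> Lin V UNIV"
    by (rule LinI) (use Q.subspace_add[OF V] Q.subspace_scale[OF V] in
        \<open>auto simp: \<kappa>_def fun_eq_iff scaleQ_fun_def scaleQ_rat_def cfadd cfsc\<close>)
  have im: "Q.subspace (\<iota> ` Vm)" "Q.subspace (\<kappa> ` V)"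
    using subspace_image[OF \<iota>L Vm order_refl Vm] subspace_image[OF \<kappa>L V order_refl V] by simp_all
  have \<iota>0: "v = 0" if "v \<in> Vm" "\<iota> v = 0" for v
  proof (rule cf0)
    show "\<forall>i<?d. cf v i = 0"
    proof (intro allI impI)
      fix i assume "i < ?d"
      then show "cf v i = 0" using fun_cong[OF that(2), of "2 * i"] that(1) by (simp add: \<iota>_def)
    qed
  qed (use that VmV in auto)
  have inj: "inj_on \<iota> Vm"
  proof (rule inj_onI)
    fix v w assume "v \<in> Vm" "w \<in> Vm" "\<iota> v = \<iota> w"
    then show "v = w" using \<iota>0[of "v - w"] Lin_diff[OF \<iota>L Vm, of v w] Q.subspace_diff[OF Vm] by simp
  qed
  have \<kappa>0: "\<kappa> v = 0 \<longleftrightarrow> v \<in> V1" if v: "v \<in> V" for v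
  proof
    assume z: "\<kappa> v = 0"
    have "cf v i = 0" if "i < ?d" "?r \<le> i" for i
      using fun_cong[OF z, of "2 * i + 1"] that v by (simp add: \<kappa>_def)
    then show "v \<in> V1" using cfV1[OF v] by blast
  next
    assume "v \<in> V1"
    then have "\<forall>i<?d. ?r \<le> i \<longrightarrow> cf v i = 0" using cfV1[OF v] by blast
    then show "\<kappa> v = 0" unfolding \<kappa>_def fun_eq_iff zero_fun_def by simp
  qed
  have Int: "\<iota> ` Vm \<inter> \<kappa> ` V = {0}"
  proof
    show "\<iota> ` Vm \<inter> \<kappa> ` V \<subseteq> {0}"
    proof
      fix f assume "f \<in> \<iota> ` Vm \<inter> \<kappa> ` V"
      then obtain v w where f: "f = \<iota> v" "f = \<kappa> w" by blast
      have "f i = 0" for i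
      proof (cases "even i")
        case True
        then show ?thesis unfolding f(2) by (simp add: \<kappa>_def)
      next
        case False
        then show ?thesis unfolding f(1) by (simp add: \<iota>_def)
      qed
      then show "f \<in> {0}" by (auto simp: fun_eq_iff)
    qed
    show "{0} \<subseteq> \<iota> ` Vm \<inter> \<kappa> ` V" using Q.subspace_0[OF im(1)] Q.subspace_0[OF im(2)] by simp
  qed
  have "\<iota> ` Vm \<subseteq> D" "\<kappa> ` V \<subseteq> D"
  proof -
    have "\<iota> a + 0 \<in> D" if "a \<in> Vm" for a using that Q.subspace_0[OF im(2)] unfolding D_def set_sum_def by blast
    then show "\<iota> ` Vm \<subseteq> D" by auto
    have "0 + \<kappa> a \<in> D" if "a \<in> V" for a using that Q.subspace_0[OF im(1)] unfolding D_def set_sum_def by blast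
    then show "\<kappa> ` V \<subseteq> D" by auto
  qed
  then have "\<iota> \<in> Lin Vm D" "\<kappa> \<in> Lin V D" using \<iota>L \<kappa>L by (auto simp: Lin_def)
  moreover have "direct_sum D (\<iota> ` Vm) (\<kappa> ` V)"
    using im(1) im(2) Int by (simp add: direct_sum_def D_def)
  moreover have "{v \<in> V. \<kappa> v = 0} = V1" using \<kappa>0 V1m VmV by auto
  ultimately have "(D, \<iota>, \<kappa>) \<in> derived_spaces V V1 Vm" using inj by (simp add: derived_spaces_def)
  then show ?thesis by blast
qed

text \<open>V may live in any type, as it does in the outermost call, while recursive calls take
  place in the space of rational sequences. The assumption on \<open>rec\<close> is the induction
  hypothesis for flags of length n - 1.\<close>

lemma main_step_correct:
  fixes V :: "'v::rat_vector set"
  assumes L: "full_lattice V L" and data: "exp_data V \<gg> n F"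
    and rec: "\<And>D L' \<qq> F'. 2 \<le> n \<Longrightarrow> full_lattice D L' \<Longrightarrow> exp_data D \<qq> (n - 1) F'
      \<Longrightarrow> always_returns (rec D L' \<qq> F') (\<lambda>gs. \<exists>A \<chi>. T_chain (GL D) (stab D \<qq> L') gs A \<chi>)"
  shows "always_returns (main_step (rec :: (nat \<Rightarrow> rat) set \<Rightarrow> _) n V L \<gg> F)
    (\<lambda>gs. \<exists>A \<chi>. T_chain (GL V) (stab V \<gg> L) gs A \<chi>)"
proof -
  interpret exp_group V \<gg> n F by (rule exp_group.intro[OF data])
  show ?thesis
  proof (cases "n = 1")
    case True
    note LV = full_lattice_subset[OF L]
    \<comment> \<open>With n = 1 the flag is 0 < V, so \<open>\<gg>\<close> kills V and the
      stabilizer is trivial.\<close>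
    have z: "x = 0" if x: "x \<in> \<gg>" for x
    proof
      fix v show "x v = 0 v"
        using Fact[of 0 x v] True x F0 Fn Lin_out[OF gLin[OF x], of v] by (cases "v \<in> V") auto
    qed
    have "\<gg> = {0}" using z Q.subspace_0[OF gsub] by auto
    then have "stab V \<gg> L \<subseteq> {\<one>\<^bsub>GL V\<^esub>}" using nil_exp_0[OF V] by (auto simp: stab_def GL_simps)
    then have st: "stab V \<gg> L = {\<one>\<^bsub>GL V\<^esub>}" using subgroup.one_closed[OF stab_subgroup[OF LV]] by blast
    have "T_chain (GL V) (stab V \<gg> L) [] (\<lambda>i. {\<one>\<^bsub>GL V\<^esub>}) (\<lambda>i x. 0)"
      unfolding T_chain_def using stab_subgroup[OF LV] st by simp
    then show ?thesis using True unfolding main_step_def by (auto intro!: always_returns_return)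
  next
    case False
    then have n2: "2 \<le> n" using n1 by simp
    have Vs: "Q.subspace (F 1)" "Q.subspace (F (n - 1))" "F 1 \<subseteq> F (n - 1)" "F (n - 1) \<subseteq> V"
      using Fsub n2 Fmono FV by auto
    have ne: "(derived_spaces V (F 1) (F (n - 1)) :: ((nat \<Rightarrow> rat) set \<times> ('v \<Rightarrow> nat \<Rightarrow> rat) \<times> ('v \<Rightarrow> nat \<Rightarrow> rat)) set) \<noteq> {}"
      by (rule derived_spaces_nonempty[OF L Vs])
    show ?thesis
      unfolding main_step_def Let_def if_not_P[OF False]
    proof (rule always_returns_bind[OF always_returns_choose[OF ne]], goal_cases)
      case (1 x)
      obtain D \<iota> \<kappa> where x: "x = (D, \<iota>, \<kappa>)" by (cases x)
      interpret derived V \<gg> n F L D \<iota> \<kappa> by unfold_locales (use L n2 1 x in simp_all)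
      show ?case
        unfolding x prod.case d\<pi>_def[symmetric] L'_def[symmetric] F'_def[symmetric] \<qq>_def[symmetric] \<nn>_def[symmetric]
      proof (rule always_returns_bind[OF rec[OF n2 L'_full q_data]], goal_cases)
        case (1 qs)
        then obtain A \<chi> where c: "T_chain (GL D) (stab D \<qq> L') qs A \<chi>" by blast
        show ?case
        proof (rule always_returns_bind[OF always_returns_choose], goal_cases)
          case 1
          show ?case by (rule L_complements_nonempty[OF L Vs])
        next
          case (2 W)
          obtain W1 Wm where eq: "W = (W1, Wm)" by (cases W)
          interpret step V \<gg> n F L D \<iota> \<kappa> W1 Wm by unfold_locales (use 2 eq in simp)
          show ?case unfolding eq prod.case
            by (rule tail[OF c, unfolded \<nn>\<^sub>L_def W'_def \<Gamma>_def \<epsilon>_def p_def])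
        qed
      qed
    qed
  qed
qed

lemma main_algorithm_universe_correct:
  assumes "full_lattice V L" "exp_data V \<gg> n F"
  shows "always_returns (main_algorithm_universe n V L \<gg> F) (\<lambda>gs. \<exists>A \<chi>. T_chain (GL V) (stab V \<gg> L) gs A \<chi>)"
  using assms
proof (induction n arbitrary: V L \<gg> F)
  case 0
  then show ?case by (simp add: exp_data_def)
next
  case (Suc n)
  then show ?case by (simp, intro main_step_correct) simp_all
qed

lemma main_algorithm_correct:
  assumes "full_lattice V L" "exp_data V \<gg> n F"
  shows "always_returns (main_algorithm n V L \<gg> F) (\<lambda>gs. T_sequence ((GL V)\<lparr>carrier := stab V \<gg> L\<rparr>) gs)"
proof -
  interpret exp_group V \<gg> n F by (rule exp_group.intro[OF assms(2)])
  note LV = full_lattice_subset[OF assms(1)]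
  have "always_returns (main_algorithm n V L \<gg> F) (\<lambda>gs. \<exists>A \<chi>. T_chain (GL V) (stab V \<gg> L) gs A \<chi>)"
    unfolding main_algorithm_def
    by (rule main_step_correct[OF assms]) (rule main_algorithm_universe_correct)
  moreover have "T_sequence ((GL V)\<lparr>carrier := stab V \<gg> L\<rparr>) gs" if "\<exists>A \<chi>. T_chain (GL V) (stab V \<gg> L) gs A \<chi>" for gs
    using group.T_chain_T_sequence[OF group_GL[OF V] stab_subgroup[OF LV]] that by blast
  ultimately show ?thesis unfolding always_returns_def by blast
qed

section \<open>Polynomial functions along curves\<close>

abbreviation curve :: "nat \<Rightarrow> (nat \<Rightarrow> nat \<Rightarrow> complex poly) \<Rightarrow> complex \<Rightarrow> complex mat" where
  "curve d P t \<equiv> mat d d (\<lambda>(i, j). poly (P i j) t)"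

lemma polyfun_sum: "finite I \<Longrightarrow> 0 \<in> K \<Longrightarrow> (\<And>i. i \<in> I \<Longrightarrow> polyfun K d (f i)) \<Longrightarrow> polyfun K d (\<lambda>A. \<Sum>i\<in>I. f i A)"
proof (induction I rule: finite_induct)
  case empty
  then show ?case using polyfun.const[of 0 K d] by simp
next
  case (insert i I)
  then have "polyfun K d (\<lambda>A. f i A + (\<Sum>i\<in>I. f i A))" by (intro polyfun.add) auto
  then show ?case using insert by simp
qed

lemma polyfun_mono: "polyfun K d f \<Longrightarrow> K \<subseteq> K' \<Longrightarrow> polyfun K' d f"
  by (induction rule: polyfun.induct) (auto intro: polyfun.intros)

text \<open>h is the gradient of f, characterized by the chain rule along curves with polynomial
  entries. There f becomes a polynomial in t, so \<open>pderiv\<close> replaces calculus in several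
  variables.\<close>

definition partials :: "nat \<Rightarrow> (complex mat \<Rightarrow> complex) \<Rightarrow> (nat \<Rightarrow> nat \<Rightarrow> complex mat \<Rightarrow> complex) \<Rightarrow> bool" where
  "partials d f h \<longleftrightarrow> (\<forall>i j. polyfun UNIV d (h i j)) \<and> (\<forall>P. \<exists>p. (\<forall>t. poly p t = f (curve d P t))
    \<and> (\<forall>t. poly (pderiv p) t = (\<Sum>i<d. \<Sum>j<d. h i j (curve d P t) * poly (pderiv (P i j)) t)))"

lemma partials_curve: assumes "partials d f h"
  obtains p where "\<And>t. poly p t = f (curve d P t)"
    "\<And>t. poly (pderiv p) t = (\<Sum>i<d. \<Sum>j<d. h i j (curve d P t) * poly (pderiv (P i j)) t)"
  using spec[OF conjunct2[OF assms[unfolded partials_def]], of P] by (elim exE conjE) (rule that; erule spec)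

lemma polyfun_partials: assumes "polyfun UNIV d f" shows "\<exists>h. partials d f h"
  using assms
proof (induction rule: polyfun.induct)
  case (const c)
  show ?case by (rule exI[of _ "\<lambda>i j A. 0"]) (auto simp: partials_def intro!: polyfun.const exI[of _ "[:c:]"])
next
  case (entry i0 j0)
  let ?h = "\<lambda>i j A. if i = i0 \<and> j = j0 then 1 else 0 :: complex"
  have s: "(\<Sum>i<d. \<Sum>j<d. ?h i j A * g i j) = g i0 j0" for A :: "complex mat" and g :: "nat \<Rightarrow> nat \<Rightarrow> complex"
  proof -
    have "(\<Sum>i<d. \<Sum>j<d. ?h i j A * g i j) = (\<Sum>i<d. if i = i0 then g i0 j0 else 0)"
    proof (rule sum.cong)
      fix i assume "i \<in> {..<d}"
      have "(\<Sum>j<d. ?h i j A * g i j) = (\<Sum>j<d. if j = j0 then (if i = i0 then g i0 j0 else 0) else 0)"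
        by (rule sum.cong) auto
      then show "(\<Sum>j<d. ?h i j A * g i j) = (if i = i0 then g i0 j0 else 0)" using entry by simp
    qed simp
    then show ?thesis using entry by simp
  qed
  have h: "polyfun UNIV d (?h i j)" for i j by (rule polyfun.const) simp
  show ?case
    unfolding partials_def by (rule exI[of _ ?h], intro conjI allI h exI[of _ "_ i0 j0"]) (use s entry in auto)
next
  case (add f k)
  then obtain h1 h2 where h: "partials d f h1" "partials d k h2" by blast
  show ?case
    unfolding partials_def
  proof (rule exI[of _ "\<lambda>i j A. h1 i j A + h2 i j A"], intro conjI allI)
    show "polyfun UNIV d (\<lambda>A. h1 i j A + h2 i j A)" for i j using h by (intro polyfun.add) (auto simp: partials_def)
    fix P
    obtain p where p: "\<And>t. poly p t = f (curve d P t)" "\<And>t. poly (pderiv p) t = (\<Sum>i<d. \<Sum>j<d. h1 i j (curve d P t) * poly (pderiv (P i j)) t)"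
      by (rule partials_curve[OF h(1), where P = P]) (rule that; assumption)
    obtain q where q: "\<And>t. poly q t = k (curve d P t)" "\<And>t. poly (pderiv q) t = (\<Sum>i<d. \<Sum>j<d. h2 i j (curve d P t) * poly (pderiv (P i j)) t)"
      by (rule partials_curve[OF h(2), where P = P]) (rule that; assumption)
    show "\<exists>p. (\<forall>t. poly p t = f (curve d P t) + k (curve d P t)) \<and>
      (\<forall>t. poly (pderiv p) t = (\<Sum>i<d. \<Sum>j<d. (h1 i j (curve d P t) + h2 i j (curve d P t)) * poly (pderiv (P i j)) t))"
      by (rule exI[of _ "p + q"]) (simp add: p q pderiv_add distrib_right sum.distrib)
  qed
next
  case (mult f k)
  then obtain h1 h2 where h: "partials d f h1" "partials d k h2" by blast
  show ?case
    unfolding partials_def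
  proof (rule exI[of _ "\<lambda>i j A. f A * h2 i j A + k A * h1 i j A"], intro conjI allI)
    show "polyfun UNIV d (\<lambda>A. f A * h2 i j A + k A * h1 i j A)" for i j
      using h mult.hyps by (intro polyfun.add polyfun.mult) (auto simp: partials_def)
    fix P
    obtain p where p: "\<And>t. poly p t = f (curve d P t)" "\<And>t. poly (pderiv p) t = (\<Sum>i<d. \<Sum>j<d. h1 i j (curve d P t) * poly (pderiv (P i j)) t)"
      by (rule partials_curve[OF h(1), where P = P]) (rule that; assumption)
    obtain q where q: "\<And>t. poly q t = k (curve d P t)" "\<And>t. poly (pderiv q) t = (\<Sum>i<d. \<Sum>j<d. h2 i j (curve d P t) * poly (pderiv (P i j)) t)"
      by (rule partials_curve[OF h(2), where P = P]) (rule that; assumption)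
    show "\<exists>p. (\<forall>t. poly p t = f (curve d P t) * k (curve d P t)) \<and>
      (\<forall>t. poly (pderiv p) t = (\<Sum>i<d. \<Sum>j<d. (f (curve d P t) * h2 i j (curve d P t) + k (curve d P t) * h1 i j (curve d P t)) * poly (pderiv (P i j)) t))"
      by (rule exI[of _ "p * q"]) (simp add: p q pderiv_mult distrib_right sum.distrib sum_distrib_left mult.assoc)
  qed
qed

text \<open>Left translation preserves polynomial functions; it serves to move the tangent condition
  from the identity to other points of G.\<close>

lemma polyfun_left_mult:
  assumes "polyfun UNIV d f" "A \<in> carrier_mat d d"
  shows "\<exists>f'. polyfun UNIV d f' \<and> (\<forall>B\<in>carrier_mat d d. f' B = f (A * B))"
  using assms(1)
proof (induction rule: polyfun.induct)
  case (const c)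
  then show ?case by (intro exI[of _ "\<lambda>A. c"]) (auto intro: polyfun.const)
next
  case (entry i j)
  let ?f = "\<lambda>B. \<Sum>l<d. A $$ (i, l) * B $$ (l, j)"
  have "polyfun UNIV d ?f" by (intro polyfun_sum polyfun.mult polyfun.const polyfun.entry) (use entry in auto)
  moreover have "?f B = (A * B) $$ (i, j)" if "B \<in> carrier_mat d d" for B
    using that assms(2) entry by (simp add: scalar_prod_def lessThan_atLeast0)
  ultimately show ?case by blast
next
  case (add f h)
  then obtain f' h' where "polyfun UNIV d f'" "polyfun UNIV d h'"
    "\<forall>B\<in>carrier_mat d d. f' B = f (A * B)" "\<forall>B\<in>carrier_mat d d. h' B = h (A * B)" by blast
  then show ?case by (intro exI[of _ "\<lambda>A. f' A + h' A"]) (auto intro: polyfun.add)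
next
  case (mult f h)
  then obtain f' h' where "polyfun UNIV d f'" "polyfun UNIV d h'"
    "\<forall>B\<in>carrier_mat d d. f' B = f (A * B)" "\<forall>B\<in>carrier_mat d d. h' B = h (A * B)" by blast
  then show ?case by (intro exI[of _ "\<lambda>A. f' A * h' A"]) (auto intro: polyfun.mult)
qed

section \<open>The rational points as exponentials\<close>

lemma GL_C_simps: "A \<in> carrier (GL_C d) \<Longrightarrow> A \<in> carrier_mat d d" "A \<otimes>\<^bsub>GL_C d\<^esub> B = A * B" "\<one>\<^bsub>GL_C d\<^esub> = 1\<^sub>m d"
  by (auto simp: GL_C_def units_of_def Units_def ring_mat_def)

lemma GL_C_I: "A \<in> carrier_mat d d \<Longrightarrow> B \<in> carrier_mat d d \<Longrightarrow> A * B = 1\<^sub>m d \<Longrightarrow> B * A = 1\<^sub>m d \<Longrightarrow> A \<in> carrier (GL_C d)"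
  by (auto simp: GL_C_def units_of_def Units_def ring_mat_def)

section \<open>Coordinates and matrices with respect to the basis\<close>

locale unipotent_group =
  fixes V :: "'v::rat_vector set" and bs :: "'v list" and G :: "complex mat set"
  assumes bs: "q_basis bs V" and G: "unipotent_algebraic_group (length bs) G"
begin

abbreviation "d \<equiv> length bs"
definition "co v i = Q.representation (set bs) v (bs ! i)"

lemma V: "Q.subspace V" using bs Q.subspace_span by (auto simp: q_basis_def)

lemma bsV: "i < d \<Longrightarrow> bs ! i \<in> V"
  using bs Q.span_superset[of "set bs"] by (auto simp: q_basis_def)

lemma ind: "Q.independent (set bs)" and sp: "Q.span (set bs) = V" and dis: "distinct bs"
  using bs by (auto simp: q_basis_def)

lemma co_scale: "v \<in> V \<Longrightarrow> co (q *\<^sub>Q v) i = q * co v i"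
  using Q.representation_scale[OF ind] by (simp add: co_def sp)

lemma co_sum: "(\<And>k. k \<in> K \<Longrightarrow> f k \<in> V) \<Longrightarrow> co (\<Sum>k\<in>K. f k) i = (\<Sum>k\<in>K. co (f k) i)"
  using Q.representation_sum[OF ind, of K f] by (simp add: co_def sp)

lemma co_unit: "i < d \<Longrightarrow> j < d \<Longrightarrow> co (bs ! j) i = (if i = j then 1 else 0)"
  using Q.representation_basis[OF ind, of "bs ! j"] dis by (auto simp: co_def nth_eq_iff_index_eq)

lemma co_expand: assumes "v \<in> V" shows "v = (\<Sum>i<d. co v i *\<^sub>Q bs ! i)"
proof -
  have "v \<in> qspan bs" using assms sp span_qspan[of bs] by simp
  then obtain c where c: "v = (\<Sum>i<d. c i *\<^sub>Q bs ! i)" by (auto simp: qcomb_def)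
  have "co v i = c i" if i: "i < d" for i
  proof -
    have "co v i = (\<Sum>k<d. co (c k *\<^sub>Q bs ! k) i)"
      unfolding c by (rule co_sum) (use bsV Q.subspace_scale[OF V] in auto)
    also have "\<dots> = (\<Sum>k<d. if k = i then c i else 0)"
      by (rule sum.cong) (auto simp: co_scale bsV co_unit i)
    finally show ?thesis using i by simp
  qed
  then show ?thesis using c by simp
qed

lemma co_zero: "v \<in> V \<Longrightarrow> (\<And>i. i < d \<Longrightarrow> co v i = 0) \<Longrightarrow> v = 0"
  using co_expand[of v] by simp

lemma co_apply: assumes "f \<in> Lin V V" "v \<in> V" shows "co (f v) i = (\<Sum>l<d. co v l * co (f (bs ! l)) i)"
proof -
  have "f v = f (\<Sum>l<d. co v l *\<^sub>Q bs ! l)" using co_expand[OF assms(2)] by simp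
  also have "\<dots> = (\<Sum>l<d. f (co v l *\<^sub>Q bs ! l))"
    by (rule Lin_sum[OF assms(1) V]) (use bsV Q.subspace_scale[OF V] in auto)
  finally have "co (f v) i = (\<Sum>l<d. co (f (co v l *\<^sub>Q bs ! l)) i)"
    using co_sum[of "{..<d}"] bsV Q.subspace_scale[OF V] Lin_in[OF assms(1)] by simp
  then show ?thesis by (simp add: Lin_scale[OF assms(1)] bsV co_scale Lin_in[OF assms(1)])
qed

lemma cmat_carrier [simp]: "cmat bs f \<in> carrier_mat d d" by (simp add: cmat_def)

lemma cmat_index: "i < d \<Longrightarrow> j < d \<Longrightarrow> cmat bs f $$ (i, j) = of_rat (co (f (bs ! j)) i)"
  by (simp add: cmat_def co_def)

lemma cmat_comp: assumes "f \<in> Lin V V" "h \<in> Lin V V" shows "cmat bs (f \<circ> h) = cmat bs f * cmat bs h"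
proof (rule eq_matI)
  fix i j assume "i < dim_row (cmat bs f * cmat bs h)" "j < dim_col (cmat bs f * cmat bs h)"
  then have ij: "i < d" "j < d" by (simp_all add: cmat_def)
  have "(cmat bs f * cmat bs h) $$ (i, j) = (\<Sum>l<d. cmat bs f $$ (i, l) * cmat bs h $$ (l, j))"
    using ij by (simp add: scalar_prod_def lessThan_atLeast0 cmat_def)
  also have "\<dots> = of_rat (\<Sum>l<d. co (h (bs ! j)) l * co (f (bs ! l)) i)"
    using ij by (simp add: cmat_index of_rat_sum of_rat_mult mult.commute)
  also have "\<dots> = cmat bs (f \<circ> h) $$ (i, j)"
    using ij co_apply[OF assms(1) Lin_in[OF assms(2) bsV[OF ij(2)]], of i] by (simp add: cmat_index)
  finally show "cmat bs (f \<circ> h) $$ (i, j) = (cmat bs f * cmat bs h) $$ (i, j)" by simp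
qed (simp_all add: cmat_def)

lemma cmat_id: "cmat bs (idmap V) = 1\<^sub>m d"
  by (rule eq_matI) (auto simp: cmat_index co_unit idmap_def bsV, simp_all add: cmat_def)

lemma G_sub: "subgroup G (GL_C d)" using G by (simp add: unipotent_algebraic_group_def)

lemma G_carrier: "A \<in> G \<Longrightarrow> A \<in> carrier_mat d d" using subgroup.subset[OF G_sub] GL_C_simps(1) by blast

lemma G_one: "1\<^sub>m d \<in> G" using subgroup.one_closed[OF G_sub] by (simp add: GL_C_simps)

lemma G_mult: "A \<in> G \<Longrightarrow> B \<in> G \<Longrightarrow> A * B \<in> G" using subgroup.m_closed[OF G_sub] by (simp add: GL_C_simps)

section \<open>The Lie algebra as a subspace\<close>

abbreviation "\<gg> \<equiv> lie_algebra V bs G"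

lemma g_Lin: "x \<in> \<gg> \<Longrightarrow> x \<in> Lin V V" by (simp add: lie_algebra_def)

definition "vanishing f \<longleftrightarrow> polyfun UNIV d f \<and> (\<forall>A\<in>G. f A = 0)"

text \<open>A line is a curve with entries of degree at most one; this links the complex derivative
  in \<open>lie_algebra\<close> with \<open>partials\<close>.\<close>

lemma line_derivative:
  assumes h: "partials d f h"
    and AB: "A \<in> carrier_mat d d" "B \<in> carrier_mat d d"
  shows "((\<lambda>t. f (A + t \<cdot>\<^sub>m B)) has_field_derivative (\<Sum>i<d. \<Sum>j<d. h i j A * B $$ (i, j))) (at 0)"
proof -
  let ?P = "\<lambda>i j. [:A $$ (i, j), B $$ (i, j):]"
  obtain p where p: "\<And>t. poly p t = f (curve d ?P t)"
    "\<And>t. poly (pderiv p) t = (\<Sum>i<d. \<Sum>j<d. h i j (curve d ?P t) * poly (pderiv (?P i j)) t)"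
    by (rule partials_curve[OF h, where P = ?P]) (rule that; assumption)
  have c: "curve d ?P t = A + t \<cdot>\<^sub>m B" for t by (rule eq_matI) (use AB in auto)
  have "curve d ?P 0 = A" by (rule eq_matI) (use AB in auto)
  then have "poly (pderiv p) 0 = (\<Sum>i<d. \<Sum>j<d. h i j A * B $$ (i, j))" using p(2)[of 0] by (simp add: pderiv_pCons)
  moreover have "f (A + t \<cdot>\<^sub>m B) = poly p t" for t using p(1)[of t] unfolding c by (rule sym)
  then have "(\<lambda>t. f (A + t \<cdot>\<^sub>m B)) = poly p" by (rule ext)
  ultimately show ?thesis using poly_DERIV[of p 0] by simp
qed

lemma g_iff:
  "x \<in> \<gg> \<longleftrightarrow> x \<in> Lin V V \<and> (\<forall>f. vanishing f \<longrightarrow>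
    ((\<lambda>t. f (1\<^sub>m d + t \<cdot>\<^sub>m cmat bs x)) has_field_derivative 0) (at 0))"
  by (auto simp: lie_algebra_def vanishing_def)

text \<open>For each vanishing f the tangent condition is a linear equation in the matrix entries of
  x, with the gradient of f at the identity as coefficients.\<close>

lemma g_subspace: "Q.subspace \<gg>"
proof -
  have ex: "\<exists>h. \<forall>x. ((\<lambda>t. f (1\<^sub>m d + t \<cdot>\<^sub>m cmat bs x)) has_field_derivative 0) (at 0)
      \<longleftrightarrow> (\<Sum>i<d. \<Sum>j<d. h i j * of_rat (co (x (bs ! j)) i)) = (0::complex)" if f: "vanishing f" for f
  proof -
    have pf: "polyfun UNIV d f" using f by (simp add: vanishing_def)
    obtain h where h: "partials d f h" using polyfun_partials[OF pf] ..
    have der: "((\<lambda>t. f (1\<^sub>m d + t \<cdot>\<^sub>m cmat bs x)) has_field_derivative (\<Sum>i<d. \<Sum>j<d. h i j (1\<^sub>m d) * of_rat (co (x (bs ! j)) i))) (at 0)" for x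
      using line_derivative[OF h one_carrier_mat cmat_carrier, of x] by (simp add: cmat_index)
    show ?thesis
    proof (rule exI[of _ "\<lambda>i j. h i j (1\<^sub>m d)"], intro allI iffI)
      fix x assume "((\<lambda>t. f (1\<^sub>m d + t \<cdot>\<^sub>m cmat bs x)) has_field_derivative 0) (at 0)"
      from DERIV_unique[OF der this] show "(\<Sum>i<d. \<Sum>j<d. h i j (1\<^sub>m d) * of_rat (co (x (bs ! j)) i)) = 0" .
    next
      fix x assume "(\<Sum>i<d. \<Sum>j<d. h i j (1\<^sub>m d) * of_rat (co (x (bs ! j)) i)) = 0"
      with der[of x] show "((\<lambda>t. f (1\<^sub>m d + t \<cdot>\<^sub>m cmat bs x)) has_field_derivative 0) (at 0)" by (simp only:)
    qed
  qed
  note LV = subspace_Lin[OF V, of V]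
  show ?thesis unfolding Q.subspace_def
  proof (intro conjI ballI allI)
    show "0 \<in> \<gg>" unfolding g_iff
    proof (intro conjI allI impI)
      show "0 \<in> Lin V V" by (rule Q.subspace_0[OF LV])
      fix f assume "vanishing f"
      from ex[OF this] obtain h where "\<forall>x. ((\<lambda>t. f (1\<^sub>m d + t \<cdot>\<^sub>m cmat bs x)) has_field_derivative 0) (at 0)
        \<longleftrightarrow> (\<Sum>i<d. \<Sum>j<d. h i j * of_rat (co (x (bs ! j)) i)) = (0::complex)" ..
      then show "((\<lambda>t. f (1\<^sub>m d + t \<cdot>\<^sub>m cmat bs 0)) has_field_derivative 0) (at 0)"
        by (simp add: co_def Q.representation_zero)
    qed
  next
    fix x y assume xy: "x \<in> \<gg>" "y \<in> \<gg>"
    have L: "x \<in> Lin V V" "y \<in> Lin V V" using xy g_Lin by auto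
    show "x + y \<in> \<gg>" unfolding g_iff
    proof (intro conjI allI impI)
      show "x + y \<in> Lin V V" by (rule Q.subspace_add[OF LV L])
      fix f assume f: "vanishing f"
      from ex[OF this] obtain h where h: "\<forall>x. ((\<lambda>t. f (1\<^sub>m d + t \<cdot>\<^sub>m cmat bs x)) has_field_derivative 0) (at 0)
        \<longleftrightarrow> (\<Sum>i<d. \<Sum>j<d. h i j * of_rat (co (x (bs ! j)) i)) = (0::complex)" ..
      have "co ((x + y) (bs ! j)) i = co (x (bs ! j)) i + co (y (bs ! j)) i" if "j < d" for i j
        using Q.representation_add[OF ind] Lin_in[OF L(1) bsV[OF that]] Lin_in[OF L(2) bsV[OF that]] by (simp add: co_def sp)
      then have "(\<Sum>i<d. \<Sum>j<d. h i j * of_rat (co ((x + y) (bs ! j)) i)) = (\<Sum>i<d. \<Sum>j<d. h i j * of_rat (co (x (bs ! j)) i))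
         + (\<Sum>i<d. \<Sum>j<d. h i j * of_rat (co (y (bs ! j)) i))"
        by (simp add: of_rat_add distrib_left sum.distrib)
      also have "\<dots> = 0"
        using iffD1[OF spec[OF h, of x]] iffD1[OF spec[OF h, of y]] xy f by (simp add: g_iff)
      finally show "((\<lambda>t. f (1\<^sub>m d + t \<cdot>\<^sub>m cmat bs (x + y))) has_field_derivative 0) (at 0)" using h by blast
    qed
  next
    fix q x assume x: "x \<in> \<gg>"
    have L: "x \<in> Lin V V" using x g_Lin by auto
    show "q *\<^sub>Q x \<in> \<gg>" unfolding g_iff
    proof (intro conjI allI impI)
      show "q *\<^sub>Q x \<in> Lin V V" by (rule Q.subspace_scale[OF LV L])
      fix f assume f: "vanishing f"
      from ex[OF this] obtain h where h: "\<forall>x. ((\<lambda>t. f (1\<^sub>m d + t \<cdot>\<^sub>m cmat bs x)) has_field_derivative 0) (at 0)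
        \<longleftrightarrow> (\<Sum>i<d. \<Sum>j<d. h i j * of_rat (co (x (bs ! j)) i)) = (0::complex)" ..
      have "co ((q *\<^sub>Q x) (bs ! j)) i = q * co (x (bs ! j)) i" if "j < d" for i j
        using co_scale[OF Lin_in[OF L bsV[OF that]]] by (simp add: scaleQ_fun_def)
      then have "(\<Sum>i<d. \<Sum>j<d. h i j * of_rat (co ((q *\<^sub>Q x) (bs ! j)) i)) = of_rat q * (\<Sum>i<d. \<Sum>j<d. h i j * of_rat (co (x (bs ! j)) i))"
        by (simp add: of_rat_mult sum_distrib_left mult.left_commute)
      also have "\<dots> = 0" using iffD1[OF spec[OF h, of x]] x f by (simp add: g_iff)
      finally show "((\<lambda>t. f (1\<^sub>m d + t \<cdot>\<^sub>m cmat bs (q *\<^sub>Q x))) has_field_derivative 0) (at 0)" using h by blast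
    qed
  qed
qed

section \<open>One-parameter groups\<close>

definition "pow_entry x k i j = (of_rat (co ((x ^^ k) (bs ! j)) i) :: complex)"
text \<open>The entry (i, j) of the matrix of exp(t x), as a complex polynomial in t. It makes sense
  for complex t, whereas \<open>nil_exp\<close> only allows rational multiples of x.\<close>

definition "exp_poly N x i j = (\<Sum>k<N. monom (pow_entry x k i j / fact k) k)"

lemma pow_entry_0: "i < d \<Longrightarrow> j < d \<Longrightarrow> pow_entry x 0 i j = (if i = j then 1 else 0)"
  by (simp add: pow_entry_def co_unit)

lemma funpow_Lin: assumes "x \<in> Lin V V" shows "(\<lambda>v. if v \<in> V then (x ^^ k) v else 0) \<in> Lin V V"
  by (rule LinI) (auto simp: funpow_lin[OF assms] Q.subspace_add[OF V] Q.subspace_scale[OF V]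
      intro: funpow_in[OF Lin_in[OF assms]])

lemma pow_entry_Suc: assumes "x \<in> Lin V V" "j < d"
  shows "pow_entry x (Suc k) i j = (\<Sum>l<d. pow_entry x k i l * cmat bs x $$ (l, j))"
proof -
  let ?f = "\<lambda>v. if v \<in> V then (x ^^ k) v else 0"
  have xV: "x (bs ! j) \<in> V" using Lin_in[OF assms(1) bsV[OF assms(2)]] .
  have "(x ^^ Suc k) (bs ! j) = ?f (x (bs ! j))" using xV by (simp add: funpow_swap1)
  then have "co ((x ^^ Suc k) (bs ! j)) i = (\<Sum>l<d. co (x (bs ! j)) l * co (?f (bs ! l)) i)"
    using co_apply[OF funpow_Lin[OF assms(1), of k] xV, of i] by simp
  then show ?thesis using assms(2) bsV
    by (simp add: pow_entry_def of_rat_sum of_rat_mult cmat_index mult.commute)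
qed

lemma pow_mat_cmat: assumes "x \<in> Lin V V" "i < d" "j < d" shows "(cmat bs x ^\<^sub>m k) $$ (i, j) = pow_entry x k i j"
  using assms(3)
proof (induction k arbitrary: j)
  case 0
  then show ?case using assms(2) by (simp add: pow_entry_0 cmat_def)
next
  case (Suc k)
  have c: "cmat bs x ^\<^sub>m k \<in> carrier_mat d d" by simp
  have "(cmat bs x ^\<^sub>m Suc k) $$ (i, j) = (\<Sum>l<d. (cmat bs x ^\<^sub>m k) $$ (i, l) * cmat bs x $$ (l, j))"
    using assms(2) Suc.prems c by (simp add: scalar_prod_def lessThan_atLeast0 cmat_def)
  then show ?case using Suc by (simp add: pow_entry_Suc[OF assms(1)])
qed

lemma coeff_exp_poly: assumes "nilp V N x" "i < d" "j < d" shows "coeff (exp_poly N x i j) k = pow_entry x k i j / fact k"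
proof -
  have "coeff (exp_poly N x i j) k = (\<Sum>m<N. if m = k then pow_entry x k i j / fact k else 0)"
    unfolding exp_poly_def coeff_sum by (rule sum.cong) auto
  moreover have "pow_entry x k i j = 0" if "N \<le> k"
    using nilp_pow_0[OF assms(1) bsV[OF assms(3)] that] by (simp add: pow_entry_def co_def Q.representation_zero)
  ultimately show ?thesis by (cases "k < N") auto
qed

text \<open>The differential equation d/dt exp(t x) = exp(t x) x, compared coefficient by
  coefficient.\<close>

lemma pderiv_exp_poly: assumes "nilp V N x" "i < d" "j < d"
  shows "pderiv (exp_poly N x i j) = (\<Sum>l<d. smult (cmat bs x $$ (l, j)) (exp_poly N x i l))"
proof (rule poly_eqI)
  fix k
  have "coeff (pderiv (exp_poly N x i j)) k = of_nat (Suc k) * (pow_entry x (Suc k) i j / fact (Suc k))"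
    by (simp add: coeff_pderiv coeff_exp_poly[OF assms])
  also have "\<dots> = pow_entry x (Suc k) i j / fact k" by (simp add: field_simps del: of_nat_Suc)
  also have "\<dots> = (\<Sum>l<d. cmat bs x $$ (l, j) * (pow_entry x k i l / fact k))"
    by (simp add: pow_entry_Suc[OF nilp_Lin[OF assms(1)] assms(3)] sum_divide_distrib mult.commute)
  also have "\<dots> = coeff (\<Sum>l<d. smult (cmat bs x $$ (l, j)) (exp_poly N x i l)) k"
    by (simp add: coeff_sum coeff_exp_poly[OF assms(1,2)])
  finally show "coeff (pderiv (exp_poly N x i j)) k = coeff (\<Sum>l<d. smult (cmat bs x $$ (l, j)) (exp_poly N x i l)) k" .
qed

abbreviation "exp_curve N x \<equiv> curve d (exp_poly N x)"

lemma exp_curve_rat: assumes "nilp V N x" shows "exp_curve N x (of_rat q) = cmat bs (nil_exp V (q *\<^sub>Q x))"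
proof (rule eq_matI)
  fix i j assume "i < dim_row (cmat bs (nil_exp V (q *\<^sub>Q x)))" "j < dim_col (cmat bs (nil_exp V (q *\<^sub>Q x)))"
  then have ij: "i < d" "j < d" by (simp_all add: cmat_def)
  have p: "(x ^^ k) (bs ! j) \<in> V" for k by (rule nilp_pow_in[OF assms bsV[OF ij(2)]])
  have "nil_exp V (q *\<^sub>Q x) (bs ! j) = (\<Sum>k<N. (q ^ k / fact k) *\<^sub>Q (x ^^ k) (bs ! j))"
    unfolding nil_exp_scale[OF assms] fps_op_nilp_eq[OF assms bsV[OF ij(2)] order_refl] by simp
  then have "co (nil_exp V (q *\<^sub>Q x) (bs ! j)) i = (\<Sum>k<N. q ^ k / fact k * co ((x ^^ k) (bs ! j)) i)"
    using co_sum[of "{..<N}" "\<lambda>k. (q ^ k / fact k) *\<^sub>Q (x ^^ k) (bs ! j)" i] p Q.subspace_scale[OF V]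
    by (simp add: co_scale)
  moreover have "of_rat (fact k) = (fact k :: complex)" for k
    using of_rat_of_nat_eq[of "fact k"] by (metis of_nat_fact)
  ultimately show "exp_curve N x (of_rat q) $$ (i, j) = cmat bs (nil_exp V (q *\<^sub>Q x)) $$ (i, j)"
    using ij by (simp add: cmat_index exp_poly_def poly_sum poly_monom pow_entry_def of_rat_sum of_rat_mult
        of_rat_divide of_rat_power mult.commute)
qed (simp_all add: cmat_def)

lemma exp_curve_0: assumes "nilp V N x" shows "exp_curve N x 0 = 1\<^sub>m d"
  using exp_curve_rat[OF assms, of 0] by (simp add: nil_exp_0[OF V] cmat_id)

lemma exp_curve_chain:
  assumes h: "partials d f h"
    and x: "nilp V N x"
  shows "\<exists>p. (\<forall>t. poly p t = f (exp_curve N x t)) \<and> (\<forall>t. poly (pderiv p) t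
    = (\<Sum>i<d. \<Sum>j<d. h i j (exp_curve N x t) * (\<Sum>l<d. exp_curve N x t $$ (i, l) * cmat bs x $$ (l, j))))"
proof -
  obtain p where p: "\<And>t. poly p t = f (exp_curve N x t)"
    "\<And>t. poly (pderiv p) t = (\<Sum>i<d. \<Sum>j<d. h i j (exp_curve N x t) * poly (pderiv (exp_poly N x i j)) t)"
    by (rule partials_curve[OF h, where P = "exp_poly N x"]) (rule that; assumption)
  have e: "poly (pderiv (exp_poly N x i j)) t = (\<Sum>l<d. exp_curve N x t $$ (i, l) * cmat bs x $$ (l, j))"
    if "i < d" "j < d" for i j t
    using that by (simp add: pderiv_exp_poly[OF x] poly_sum mult.commute)
  have "poly (pderiv p) t = (\<Sum>i<d. \<Sum>j<d. h i j (exp_curve N x t) * (\<Sum>l<d. exp_curve N x t $$ (i, l) * cmat bs x $$ (l, j)))" for t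
    unfolding p(2) by (intro sum.cong refl arg_cong2[of _ _ _ _ times] e) auto
  then show ?thesis using p(1) by blast
qed

text \<open>The derivation along x, \<open>f \<mapsto> (A \<mapsto> d/dt f(A exp(t x)))\<close>, maps polynomials vanishing on G to
  polynomials vanishing on G; so all derivatives of \<open>f(exp(t x))\<close> vanish at 0.\<close>

lemma vanishing_exp_curve:
  assumes x: "x \<in> \<gg>" "nilp V N x" and f: "vanishing f" "\<forall>t. poly p t = f (exp_curve N x t)"
  shows "p = 0"
  using f
proof (induction "degree p" arbitrary: p f rule: less_induct)
  case less
  have pf: "polyfun UNIV d f" using less.prems by (simp add: vanishing_def)
  obtain h where h: "partials d f h" using polyfun_partials[OF pf] ..
  define Df where "Df A = (\<Sum>i<d. \<Sum>j<d. h i j A * (\<Sum>l<d. A $$ (i, l) * cmat bs x $$ (l, j)))" for A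
  have "\<exists>p. (\<forall>t. poly p t = f (exp_curve N x t)) \<and> (\<forall>t. poly (pderiv p) t = Df (exp_curve N x t))"
    unfolding Df_def by (rule exp_curve_chain[OF h x(2)])
  then obtain p' where p': "\<forall>t. poly p' t = f (exp_curve N x t)" "\<forall>t. poly (pderiv p') t = Df (exp_curve N x t)"
    by (elim exE conjE) (rule that)
  have "poly p' = poly p" using p'(1) less.prems(2) by (simp add: fun_eq_iff)
  then have pp: "p' = p" by (simp add: poly_eq_poly_eq_iff)
  have "vanishing Df"
    unfolding vanishing_def
  proof (intro conjI ballI)
    show "polyfun UNIV d Df" unfolding Df_def
      by (intro polyfun_sum polyfun.mult polyfun.const polyfun.entry) (use h in \<open>auto simp: partials_def\<close>)
    fix A assume A: "A \<in> G"
    note Ac = G_carrier[OF A]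
    \<comment> \<open>The translate of f by A again vanishes on G, so the tangent condition of x at
      the identity applies to it.\<close>
    obtain f' where f': "polyfun UNIV d f'" "\<forall>B\<in>carrier_mat d d. f' B = f (A * B)"
      using polyfun_left_mult[OF pf Ac] by blast
    have "vanishing f'" using f' G_mult[OF A] G_carrier less.prems(1) by (simp add: vanishing_def)
    then have "((\<lambda>t. f' (1\<^sub>m d + t \<cdot>\<^sub>m cmat bs x)) has_field_derivative 0) (at 0)" using x(1) by (simp add: g_iff)
    moreover have "f' (1\<^sub>m d + t \<cdot>\<^sub>m cmat bs x) = f (A + t \<cdot>\<^sub>m (A * cmat bs x))" for t
    proof -
      have "A * (1\<^sub>m d + t \<cdot>\<^sub>m cmat bs x) = A + t \<cdot>\<^sub>m (A * cmat bs x)"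
        by (simp only: mult_add_distrib_mat[OF Ac one_carrier_mat smult_carrier_mat[OF cmat_carrier]]
            right_mult_one_mat[OF Ac] mult_smult_distrib[OF Ac cmat_carrier])
      then show ?thesis using f'(2) by simp
    qed
    ultimately have "((\<lambda>t. f (A + t \<cdot>\<^sub>m (A * cmat bs x))) has_field_derivative 0) (at 0)" by simp
    moreover have "((\<lambda>t. f (A + t \<cdot>\<^sub>m (A * cmat bs x))) has_field_derivative
        (\<Sum>i<d. \<Sum>j<d. h i j A * (A * cmat bs x) $$ (i, j))) (at 0)"
      by (rule line_derivative[OF h Ac]) (use Ac in auto)
    ultimately have "(\<Sum>i<d. \<Sum>j<d. h i j A * (A * cmat bs x) $$ (i, j)) = 0" by (rule DERIV_unique[symmetric])
    moreover have "(A * cmat bs x) $$ (i, j) = (\<Sum>l<d. A $$ (i, l) * cmat bs x $$ (l, j))" if "i < d" "j < d" for i j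
      using that Ac by (simp add: scalar_prod_def lessThan_atLeast0 cmat_def)
    ultimately show "Df A = 0" by (simp add: Df_def)
  qed
  \<comment> \<open>The derivative of p is the polynomial belonging to \<open>Df\<close> and has
    smaller degree. So p is constant, and its value is that of f at the identity matrix.\<close>
  then have "pderiv p = 0" if "degree p \<noteq> 0"
    using less.hyps[of "pderiv p" Df] p'(2) pp that by (simp add: degree_pderiv)
  then have "degree p = 0" using pderiv_eq_0_iff by blast
  then obtain c where c: "p = [:c:]" by (rule degree_eq_zeroE)
  have "poly p 0 = 0" using less.prems G_one exp_curve_0[OF x(2)] by (simp add: vanishing_def)
  then show "p = 0" using c by simp
qed

text \<open>The equations of G vanish along the whole curve exp(t x); the point exp x is its value
  at t = 1.\<close>

lemma exp_rational_point: assumes x: "x \<in> \<gg>" "nilp V N x" shows "nil_exp V x \<in> rational_points V bs G"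
proof -
  let ?A = "cmat bs (nil_exp V x)"
  have xm: "nilp V N (- x)" using nilp_scale[OF x(2), of "- 1"] by (simp add: scaleQ_one)
  have "?A \<in> carrier (GL_C d)"
    by (rule GL_C_I[of _ _ "cmat bs (nil_exp V (- x))"])
      (simp_all add: cmat_comp[symmetric] nil_exp_Lin[OF x(2)] nil_exp_Lin[OF xm] nil_exp_uminus[OF x(2)] cmat_id)
  moreover obtain S where S: "\<forall>f\<in>S. polyfun \<rat> d f" "G = {A \<in> carrier (GL_C d). \<forall>f\<in>S. f A = 0}"
    using G by (auto simp: unipotent_algebraic_group_def)
  have "f ?A = 0" if f: "f \<in> S" for f
  proof -
    have "polyfun UNIV d f" using S(1) f polyfun_mono by blast
    moreover have "f A = 0" if "A \<in> G" for A using that S(2) f by blast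
    ultimately have v: "vanishing f" by (simp add: vanishing_def)
    obtain p where p: "\<forall>t. poly p t = f (exp_curve N x t)"
      using polyfun_partials[of d f] v unfolding vanishing_def partials_def by blast
    have "f (exp_curve N x (of_rat 1)) = 0" using vanishing_exp_curve[OF x v p] p by (metis poly_0)
    then show ?thesis using exp_curve_rat[OF x(2), of 1] by (simp add: scaleQ_one)
  qed
  ultimately have "?A \<in> G" using S(2) by simp
  then show ?thesis using nil_exp_GL[OF x(2)] by (simp add: rational_points_def)
qed

text \<open>Unipotence makes log g nilpotent, and exp(m log g) is the m-th power of g. A polynomial
  vanishing on G thus has infinitely many zeros along the curve and is zero there; its derivative at
  t = 0 is the tangent condition.\<close>

lemma rational_point_log:
  assumes g: "g \<in> rational_points V bs G"
  shows "unip_log V g \<in> \<gg>" "nil_exp V (unip_log V g) = g"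
proof -
  have gG: "cmat bs g \<in> G" and gL: "g \<in> Lin V V" using g by (auto simp: rational_points_def GL_simps)
  let ?z = "g - idmap V"
  have zL: "?z \<in> Lin V V" by (rule Q.subspace_diff[OF subspace_Lin[OF V] gL idmap_Lin[OF V]])
  have cz: "cmat bs ?z = cmat bs g - 1\<^sub>m d"
  proof (rule eq_matI)
    fix i j assume "i < dim_row (cmat bs g - 1\<^sub>m d)" "j < dim_col (cmat bs g - 1\<^sub>m d)"
    then have ij: "i < d" "j < d" by simp_all
    have "co (g (bs ! j) - bs ! j) i = co (g (bs ! j)) i - co (bs ! j) i"
      using Q.representation_diff[OF ind] Lin_in[OF gL bsV[OF ij(2)]] bsV[OF ij(2)] by (simp add: co_def sp)
    then show "cmat bs ?z $$ (i, j) = (cmat bs g - 1\<^sub>m d) $$ (i, j)"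
      using ij by (simp add: cmat_index idmap_def bsV co_unit of_rat_diff)
  qed (simp_all add: cmat_def)
  obtain k where k: "(cmat bs g - 1\<^sub>m d) ^\<^sub>m k = 0\<^sub>m d d"
    using G gG unfolding unipotent_algebraic_group_def by blast
  \<comment> \<open>Nilpotency is transferred from the matrix to the map by comparing
    coordinates.\<close>
  have "(?z ^^ k) v = 0" if v: "v \<in> V" for v
  proof -
    let ?f = "\<lambda>v. if v \<in> V then (?z ^^ k) v else 0"
    have fL: "?f \<in> Lin V V" by (rule funpow_Lin[OF zL])
    have "co (?f (bs ! j)) i = 0" if "i < d" "j < d" for i j
      using pow_mat_cmat[OF zL that, of k] k that bsV unfolding cz pow_entry_def by simp
    then have "co (?f v) i = 0" if "i < d" for i using co_apply[OF fL v] that by simp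
    then have "?f v = 0" by (intro co_zero Lin_in[OF fL v])
    then show ?thesis using v by simp
  qed
  then have n: "nilp V k ?z" using V zL by (simp add: nilp_def)
  let ?y = "unip_log V g"
  have y: "nilp V k ?y" "nil_exp V ?y = g" using unip_log[OF gL n] by auto
  show "nil_exp V ?y = g" by (rule y(2))
  have pow: "cmat bs (nil_exp V (of_nat m *\<^sub>Q ?y)) \<in> G" for m
  proof (induction m)
    case 0
    show ?case using G_one by (simp only: of_nat_0 Q.scale_zero_left nil_exp_0[OF V] cmat_id)
  next
    case (Suc m)
    have "nil_exp V (of_nat (Suc m) *\<^sub>Q ?y) = nil_exp V (of_nat m *\<^sub>Q ?y) \<circ> g"
      using nil_exp_scale_add[OF y(1), of "of_nat m" 1] y(2) by (simp add: add.commute scaleQ_one)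
    then show ?case using G_mult[OF Suc gG]
      by (simp only: cmat_comp[OF nil_exp_Lin[OF nilp_scale[OF y(1)]] gL])
  qed
  show "?y \<in> \<gg>" unfolding g_iff
  proof (intro conjI allI impI nilp_Lin[OF y(1)])
    fix f assume f: "vanishing f"
    have pf: "polyfun UNIV d f" using f by (simp add: vanishing_def)
    obtain h where h: "partials d f h" using polyfun_partials[OF pf] ..
    obtain p where p: "\<forall>t. poly p t = f (exp_curve k ?y t)" "\<forall>t. poly (pderiv p) t
      = (\<Sum>i<d. \<Sum>j<d. h i j (exp_curve k ?y t) * (\<Sum>l<d. exp_curve k ?y t $$ (i, l) * cmat bs ?y $$ (l, j)))"
      using exp_curve_chain[OF h y(1)] by (elim exE conjE) (rule that)
    have "poly p (of_nat m) = 0" for m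
      using p(1) exp_curve_rat[OF y(1), of "of_nat m"] pow[of m] f by (simp add: vanishing_def)
    then have "range (of_nat :: nat \<Rightarrow> complex) \<subseteq> {t. poly p t = 0}" by auto
    moreover have "infinite (range (of_nat :: nat \<Rightarrow> complex))" by (rule range_inj_infinite) (simp add: inj_on_def)
    ultimately have "p = 0" using poly_roots_finite finite_subset by blast
    \<comment> \<open>At t = 0 the curve passes through the identity matrix with velocity
      \<open>cmat bs ?y\<close>.\<close>
    then have "0 = (\<Sum>i<d. \<Sum>j<d. h i j (1\<^sub>m d) * (\<Sum>l<d. 1\<^sub>m d $$ (i, l) * cmat bs ?y $$ (l, j)))"
      using spec[OF p(2), of 0] by (simp add: exp_curve_0[OF y(1)])
    moreover have "(\<Sum>l<d. 1\<^sub>m d $$ (i, l) * cmat bs ?y $$ (l, j)) = cmat bs ?y $$ (i, j)" if "i < d" for i j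
    proof -
      have "(\<Sum>l<d. 1\<^sub>m d $$ (i, l) * cmat bs ?y $$ (l, j)) = (\<Sum>l<d. if l = i then cmat bs ?y $$ (i, j) else 0)"
        by (rule sum.cong) (use that in auto)
      then show ?thesis using that by simp
    qed
    ultimately have "(\<Sum>i<d. \<Sum>j<d. h i j (1\<^sub>m d) * cmat bs ?y $$ (i, j)) = 0" by simp
    then show "((\<lambda>t. f (1\<^sub>m d + t \<cdot>\<^sub>m cmat bs ?y)) has_field_derivative 0) (at 0)"
      using line_derivative[OF h one_carrier_mat cmat_carrier, of ?y] by simp
  qed
qed

text \<open>The flag supplies the nilpotency that makes exp map \<open>\<gg>\<close> to rational
  points; log gives the converse. Closure of the exponentials under products is then closure of the
  rational points.\<close>

lemma lie_algebra_exp_data: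
  assumes "V \<noteq> {0}" and F: "flag_wrt V \<gg> n F"
  shows "exp_data V \<gg> n F" and "rational_points V bs G = nil_exp V ` \<gg>"
proof -
  have gL: "\<gg> \<subseteq> Lin V V" using g_Lin by blast
  note nilp = flag_nilp[OF V gL F]
  show eq: "rational_points V bs G = nil_exp V ` \<gg>"
  proof
    show "rational_points V bs G \<subseteq> nil_exp V ` \<gg>"
    proof
      fix g assume "g \<in> rational_points V bs G"
      from rational_point_log[OF this] show "g \<in> nil_exp V ` \<gg>" by (metis image_eqI)
    qed
    show "nil_exp V ` \<gg> \<subseteq> rational_points V bs G" using exp_rational_point nilp by blast
  qed
  have "n \<noteq> 0" using F assms(1) by (auto simp: flag_wrt_def)
  moreover have "\<exists>z\<in>\<gg>. nil_exp V x \<circ> nil_exp V y = nil_exp V z" if xy: "x \<in> \<gg>" "y \<in> \<gg>" for x y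
  proof -
    note L = nil_exp_Lin[OF nilp[OF xy(1)]] nil_exp_Lin[OF nilp[OF xy(2)]]
    have r: "nil_exp V x \<in> rational_points V bs G" "nil_exp V y \<in> rational_points V bs G" using eq xy by auto
    then have "nil_exp V x \<circ> nil_exp V y \<in> carrier (GL V)"
      using monoid.m_closed[OF group.is_monoid[OF group_GL[OF V]], of "nil_exp V x" "nil_exp V y"]
      by (simp add: rational_points_def GL_simps(2))
    moreover have "cmat bs (nil_exp V x \<circ> nil_exp V y) \<in> G"
      using r G_mult by (simp add: cmat_comp[OF L] rational_points_def)
    ultimately have "nil_exp V x \<circ> nil_exp V y \<in> nil_exp V ` \<gg>" using eq by (auto simp: rational_points_def)
    then show ?thesis by auto
  qed
  ultimately show "exp_data V \<gg> n F" using V g_subspace gL F by (simp add: exp_data_def)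
qed

end

theorem theorem7p1:
  fixes V L :: "'v::rat_vector set"
    and bs :: "'v list"
    and G :: "complex mat set"
    and F :: "nat \<Rightarrow> 'v set"
    and n :: nat
  assumes "q_basis bs V"
    and "V \<noteq> {0}"
    and "full_lattice V L"
    and "unipotent_algebraic_group (length bs) G"
    and "flag_wrt V (lie_algebra V bs G) n F"
  shows "always_returns (main_algorithm n V L (lie_algebra V bs G) F)
           (\<lambda>gs. T_sequence ((GL V)\<lparr>carrier := {g \<in> rational_points V bs G. g ` L = L}\<rparr>) gs)"
proof -
  interpret unipotent_group V bs G by unfold_locales (rule assms)+
  have "{g \<in> rational_points V bs G. g ` L = L} = stab V (lie_algebra V bs G) L"
    using lie_algebra_exp_data(2)[OF assms(2,5)] by (simp add: stab_def)
  then show ?thesis using main_algorithm_correct[OF assms(3) lie_algebra_exp_data(1)[OF assms(2,5)]] by simp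
qed

end
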